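(* Let $w\in\mathcal M$ be a submultiplicative normalized weight. Then the union over all $N$ of the sets of $N$-gap potentials (in $\mathcal H^w$) is dense in $\mathcal H^w$.
   Context: Let $S^1=\mathbb R/\mathbb Z$. A normalized weight is a function $w:\mathbb Z\to\mathbb R$, $n\mapsto w_n$, with $w_n=w_{-n}\ge1$ for all $n$. $\mathcal M$ is the class of normalized weights that are submultiplicative: $w_{n+m}\le w_nw_m$ for all $n,m$. For a complex 1-periodic function $q=\sum_{n\in\mathbb Z}q_ne^{2n\pi ix}$ put $\|q\|_w^2=\sum_{n\in\mathbb Z}w_n^2|q_n|^2$, and $\mathcal H^w=\{q\in L^2(S^1,\mathbb C):\|q\|_w<\infty\}$ with norm $\|\cdot\|_w$. For complex $q\in L^2(S^1,\mathbb C)$, the periodic eigenvalues of $q$ are the eigenvalues of $L=-\frac{d^2}{dx^2}+q$ on $[0,1]$ with periodic or anti-periodic boundary conditions (both types taken together; equivalently the eigenvalues of $-\frac{d^2}{dx^2}+q$ on functions of period 2), listed with algebraic multiplicity. They are ordered lexicographically, first by real part and then by imaginary part: $\lambda_0(q)\prec\lambda_1^-(q)\preceq\lambda_1^+(q)\prec\dots\prec\lambda_n^-(q)\preceq\lambda_n^+(q)\prec\cdots$. The gap lengths are $\gamma_n(q)=\lambda_n^+(q)-\lambda_n^-(q)$, $n\ge1$. A potential $q$ is an $N$-gap potential if $\gamma_n(q)=0$ for all $n>N$ (it is not required that the first $N$ gap lengths be nonzero). *)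

theory Defs
  imports "HOL-Analysis.Analysis" "HOL-Library.Function_Algebras"
begin

definition normalized_weight :: "(int \<Rightarrow> real) \<Rightarrow> bool" where
  "normalized_weight w \<longleftrightarrow> (\<forall>n. w (- n) = w n \<and> 1 \<le> w n)"

definition submultiplicative :: "(int \<Rightarrow> real) \<Rightarrow> bool" where
  "submultiplicative w \<longleftrightarrow> (\<forall>n m. w (n + m) \<le> w n * w m)"

text \<open>
  Elements of \<open>L\<^sup>2(\<real>/T\<int>, \<complex>)\<close> are represented by functions on the whole real line; functions
  that agree almost everywhere represent the same element.
\<close>

definition L2_per :: "real \<Rightarrow> (real \<Rightarrow> complex) set" where
  "L2_per T = {f. (\<forall>x. f (x + T) = f x) \<and> f \<in> borel_measurable lebesgue \<and>
     set_integrable lebesgue {0..T} (\<lambda>x. (cmod (f x))\<^sup>2)}"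

definition fourier_coeff :: "(real \<Rightarrow> complex) \<Rightarrow> int \<Rightarrow> complex" where
  "fourier_coeff q n = (LINT x:{0..1}|lebesgue. q x * cis (- (2 * of_int n * pi * x)))"

definition wnorm :: "(int \<Rightarrow> real) \<Rightarrow> (real \<Rightarrow> complex) \<Rightarrow> real" where
  "wnorm w q = sqrt (\<Sum>\<^sub>\<infinity>n. (w n)\<^sup>2 * (cmod (fourier_coeff q n))\<^sup>2)"

text \<open>Summability expresses finiteness of the norm (\<open>infsum\<close> of a divergent family is \<open>0\<close>).\<close>

definition weighted_space :: "(int \<Rightarrow> real) \<Rightarrow> (real \<Rightarrow> complex) set" where
  "weighted_space w =
     {q \<in> L2_per 1. (\<lambda>n. (w n)\<^sup>2 * (cmod (fourier_coeff q n))\<^sup>2) summable_on UNIV}"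

text \<open>
  \<open>f\<close> is continuously differentiable and its derivative is locally absolutely continuous with
  density \<open>h\<close>, where \<open>h \<in> L\<^sup>2(\<real>/2\<int>)\<close>; that is, \<open>f \<in> H\<^sup>2\<^sub>l\<^sub>o\<^sub>c\<close> with \<open>f'' = h\<close>.
\<close>

definition has_second_derivative :: "(real \<Rightarrow> complex) \<Rightarrow> (real \<Rightarrow> complex) \<Rightarrow> bool" where
  "has_second_derivative f h \<longleftrightarrow> h \<in> L2_per 2 \<and>
     (\<exists>f'. (\<forall>x. (f has_vector_derivative f' x) (at x)) \<and>
           (\<forall>a b. a \<le> b \<longrightarrow> f' b - f' a = (LINT x:{a..b}|lebesgue. h x)))"

text \<open>
  The graph of \<open>L = - d\<^sup>2/dx\<^sup>2 + q\<close> on functions of period 2: \<open>f\<close> lies in the domain \<open>H\<^sup>2(\<real>/2\<int>)\<close>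
  of \<open>L\<close>, and \<open>L f = g\<close> in \<open>L\<^sup>2\<close>. Period 2 covers the periodic and the anti-periodic boundary
  conditions on \<open>[0,1]\<close> simultaneously.
\<close>

definition hill_op :: "(real \<Rightarrow> complex) \<Rightarrow> (real \<Rightarrow> complex) \<Rightarrow> (real \<Rightarrow> complex) \<Rightarrow> bool" where
  "hill_op q f g \<longleftrightarrow> (\<forall>x. f (x + 2) = f x) \<and>
     (\<exists>h. has_second_derivative f h \<and> (AE x in lebesgue. - h x + q x * f x = g x))"

text \<open>
  \<open>root_space q \<mu> k\<close> is the kernel of \<open>(L - \<mu>)\<^sup>k\<close>. All its elements are continuous, so they are
  determined as functions by their classes in \<open>L\<^sup>2\<close>.
\<close>

primrec root_space :: "(real \<Rightarrow> complex) \<Rightarrow> complex \<Rightarrow> nat \<Rightarrow> (real \<Rightarrow> complex) set" where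
  "root_space q \<mu> 0 = {\<lambda>x. 0}"
| "root_space q \<mu> (Suc k) = {f. \<exists>g\<in>root_space q \<mu> k. hill_op q f (\<lambda>x. \<mu> * f x + g x)}"

definition cfun_scale :: "complex \<Rightarrow> (real \<Rightarrow> complex) \<Rightarrow> real \<Rightarrow> complex" where
  "cfun_scale c f = (\<lambda>x. c * f x)"

interpretation cfun: vector_space cfun_scale
  by unfold_locales (auto simp: cfun_scale_def fun_eq_iff algebra_simps)

text \<open>
  Complex dimension of the root space. It is positive exactly for the eigenvalues, since the
  resolvent of \<open>L\<close> is compact and hence all root spaces are finite-dimensional.
\<close>

definition alg_multiplicity :: "(real \<Rightarrow> complex) \<Rightarrow> complex \<Rightarrow> nat" where
  "alg_multiplicity q \<mu> = cfun.dim (\<Union>k. root_space q \<mu> k)"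

definition lex_le :: "complex \<Rightarrow> complex \<Rightarrow> bool" where
  "lex_le z z' \<longleftrightarrow> Re z < Re z' \<or> (Re z = Re z' \<and> Im z \<le> Im z')"

text \<open>
  \<open>l\<close> lists the periodic eigenvalues of \<open>q\<close> with algebraic multiplicity in lexicographic order;
  such an \<open>l\<close> is unique. The order is only required to be weak throughout: for non-real \<open>q\<close>,
  finitely many neighbouring pairs may coincide also across the indices \<open>n\<close>.
\<close>

definition lists_periodic_eigenvalues :: "(real \<Rightarrow> complex) \<Rightarrow> (nat \<Rightarrow> complex) \<Rightarrow> bool" where
  "lists_periodic_eigenvalues q l \<longleftrightarrow> (\<forall>k. lex_le (l k) (l (Suc k))) \<and>
     (\<forall>\<mu>. finite {k. l k = \<mu>} \<and> card {k. l k = \<mu>} = alg_multiplicity q \<mu>)"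

text \<open>
  The list is \<open>\<lambda>\<^sub>0, \<lambda>\<^sub>1\<^sup>-, \<lambda>\<^sub>1\<^sup>+, \<lambda>\<^sub>2\<^sup>-, \<lambda>\<^sub>2\<^sup>+, \<dots>\<close>, so \<open>\<lambda>\<^sub>n\<^sup>-\<close> and \<open>\<lambda>\<^sub>n\<^sup>+\<close> have positions \<open>2n - 1\<close> and \<open>2n\<close>.
  Only \<open>n \<ge> 1\<close> is meaningful.
\<close>

definition gap_length :: "(nat \<Rightarrow> complex) \<Rightarrow> nat \<Rightarrow> complex" where
  "gap_length l n = l (2 * n) - l (2 * n - 1)"

definition gap_potentials :: "(int \<Rightarrow> real) \<Rightarrow> nat \<Rightarrow> (real \<Rightarrow> complex) set" where
  "gap_potentials w N = {q \<in> weighted_space w.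
     \<exists>l. lists_periodic_eigenvalues q l \<and> (\<forall>n>N. gap_length l n = 0)}"

end

theory Submission
  imports Defs "Jordan_Normal_Form.Jordan_Normal_Form_Existence"
begin

text \<open>
  Approximate \<open>q\<close> by a trigonometric polynomial \<open>t\<close>. Since \<open>w n \<le> w 1 ^ \<bar>n\<bar>\<close> for \<open>n \<noteq> 0\<close>, it is enough to
  perturb \<open>t\<close> slightly in an exponentially weighted space. On the Fourier side of period 2, Hill's
  operator is \<open>D + P\<close> with \<open>D\<close> the diagonal matrix of the \<open>(\<pi> m)\<^sup>2\<close> and \<open>P\<close> the Toeplitz matrix of the
  potential. For large \<open>N\<close> the gaps of \<open>D\<close> are large, and a single contraction yields both a small
  correction of the Fourier coefficients of index \<open>\<bar>n\<bar> > N\<close> and a matrix \<open>X\<close> with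
  \<open>(D + P) (I + X) = (I + X) (D + B)\<close>, where \<open>B\<close> is diagonal apart from the finite block
  \<open>\<bar>m\<bar>, \<bar>n\<bar> \<le> N\<close>: the coefficient of index \<open>-n\<close> is chosen so as to kill the antidiagonal entry of the
  2 by 2 block of \<open>\<plusminus>n\<close>. The reflection symmetry of \<open>P\<close> makes the two eigenvalues for \<open>\<plusminus>n\<close> coincide, so
  all gaps of large index vanish, and the algebraic multiplicities are read off the similarity together
  with a Jordan basis of the finite block.
\<close>

section \<open>Convolution weights and matrices with off-diagonal decay\<close>

text \<open>A similarity removes an entry \<open>(m, n)\<close> by dividing by the difference of
  \<open>(pi m)^2\<close> and \<open>(pi n)^2\<close>, which is impossible for m = -n; hence some
  unknowns must be taken from the potential. The count is exact: outside the block, the entry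
  \<open>(n, -n)\<close> of a Toeplitz matrix is its coefficient of index 2 n, one free coefficient
  for each obstructed entry. The two kinds of equations contract for different reasons. Division by
  a gap of size at least N helps only the generic entries. The antidiagonal equation expresses a
  coefficient by \<open>P X\<close>, and P is as large as the trigonometric polynomial, so X has to
  be small against P. Hence the scale \<sigma>: it is chosen small against the size R of the
  polynomial, and N afterwards so large that dividing by \<sigma> N still gains. All estimates take
  place in one algebra of matrices bounded by the kernel \<open>kappa\<close>; its exponential
  factor pays for the weight w, its quadratic factor for summability. As q is complex, the finite
  block can have genuine Jordan chains; it may be arbitrary, because finitely many gaps are
  unrestricted.\<close>

definition omega :: "int \<Rightarrow> real" where "omega k = 1 / (1 + (of_int k)\<^sup>2)"

lemma omega_pos: "0 < omega k"
  unfolding omega_def by (auto intro!: divide_pos_pos add_pos_nonneg)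

lemma omega_nonneg [simp]: "0 \<le> omega k"
  using omega_pos[of k] by simp

lemma omega_le_1: "omega k \<le> 1"
  unfolding omega_def by (rule divide_le_eq_1_pos[THEN iffD2]) (auto intro: add_pos_nonneg)

lemma omega_0 [simp]: "omega 0 = 1"
  by (simp add: omega_def)

lemma omega_uminus [simp]: "omega (- k) = omega k"
  by (simp add: omega_def)

lemma omega_summable: "omega summable_on UNIV"
proof -
  have nat: "(\<lambda>n::nat. omega (int n)) summable_on UNIV"
  proof -
    have "summable (\<lambda>n::nat. omega (int n))"
    proof (rule summable_comparison_test')
      show "summable (\<lambda>n::nat. inverse (real n ^ 2))"
        using inverse_power_summable[of 2, where 'a=real] by simp
      show "norm (omega (int n)) \<le> inverse (real n ^ 2)" if "1 \<le> n" for n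
        using that by (auto simp: omega_def inverse_eq_divide intro!: divide_left_mono mult_pos_pos add_pos_nonneg)
    qed
    then show ?thesis
      by (subst summable_on_UNIV_nonneg_real_iff) auto
  qed
  have 1: "omega summable_on (range int)"
    by (subst summable_on_reindex) (use nat in \<open>auto simp: o_def\<close>)
  have 2: "omega summable_on (range (\<lambda>n. - int n))"
    by (subst summable_on_reindex) (use nat in \<open>auto simp: o_def inj_on_def\<close>)
  have "range int \<union> range (\<lambda>n. - int n) = UNIV"
  proof (intro equalityI subsetI)
    fix k :: int
    show "k \<in> range int \<union> range (\<lambda>n. - int n)"
      by (cases k rule: int_cases2) auto
  qed auto
  then show ?thesis
    using summable_on_union[OF 1 2] by simp
qed

text \<open>Write A, B for the denominators on the left and \<open>C = 1 + (a + b)^2\<close>. From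
  \<open>(a + b)^2 \<le> 2 a^2 + 2 b^2\<close> follows \<open>C \<le> 2 (A + B)\<close>, and
  dividing by \<open>A B C\<close> gives the claim. It splits off the value at the total distance
  and leaves summable factors.\<close>

lemma omega_split: "omega (m - k) * omega (k - n) \<le> 2 * omega (m - n) * (omega (m - k) + omega (k - n))"
proof -
  define a b where "a = real_of_int (m - k)" and "b = real_of_int (k - n)"
  have "(a + b)\<^sup>2 \<le> 2 * a\<^sup>2 + 2 * b\<^sup>2"
    using zero_le_power2[of "a - b"] by (simp add: power2_eq_square algebra_simps)
  then have le: "1 + (a + b)\<^sup>2 \<le> 2 * ((1 + b\<^sup>2) + (1 + a\<^sup>2))"
    by simp
  have pos: "0 < 1 + a\<^sup>2" "0 < 1 + b\<^sup>2" "0 < 1 + (a + b)\<^sup>2"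
    by (auto intro: add_pos_nonneg)
  have frac: "1 / A * (1 / B) = C * (1 / (A * B * C))" if "C \<noteq> 0" for A B C :: real
    using that by simp
  have "1 / (1 + a\<^sup>2) * (1 / (1 + b\<^sup>2)) = (1 + (a + b)\<^sup>2) * (1 / ((1 + a\<^sup>2) * (1 + b\<^sup>2) * (1 + (a + b)\<^sup>2)))"
    using frac[of "1 + (a + b)\<^sup>2"] pos by simp
  also have "\<dots> \<le> (2 * ((1 + b\<^sup>2) + (1 + a\<^sup>2))) * (1 / ((1 + a\<^sup>2) * (1 + b\<^sup>2) * (1 + (a + b)\<^sup>2)))"
    using le pos by (intro mult_right_mono) auto
  also have "\<dots> = 2 * (1 / (1 + (a + b)\<^sup>2)) * (1 / (1 + a\<^sup>2) + 1 / (1 + b\<^sup>2))"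
  proof -
    have "1 / (1 + a\<^sup>2) + 1 / (1 + b\<^sup>2) = ((1 + b\<^sup>2) + (1 + a\<^sup>2)) / ((1 + a\<^sup>2) * (1 + b\<^sup>2))"
      by (rule add_frac_eq[THEN trans]) (use pos in auto)
    then show ?thesis by simp
  qed
  finally show ?thesis
    by (simp add: omega_def a_def b_def)
qed

text \<open>The constant of the estimate that \<open>omega\<close> convolved with itself is at most
  \<open>omegaC\<close> times \<open>omega\<close>: a factor 2 from \<open>omega_split\<close>, and
  two translates with the same sum.\<close>

definition omegaC :: real where "omegaC = 4 * (\<Sum>\<^sub>\<infinity>k. omega k)"

lemma summable_on_reflect_int:
  fixes f :: "int \<Rightarrow> 'a::{t2_space,topological_comm_monoid_add}"
  shows "(\<lambda>k. f (m - k)) summable_on UNIV \<longleftrightarrow> f summable_on UNIV"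
  by (rule summable_on_reindex_bij_betw) (auto intro!: bij_betwI[where g="\<lambda>k. m - k"])

lemma summable_on_shift_int:
  fixes f :: "int \<Rightarrow> 'a::{t2_space,topological_comm_monoid_add}"
  shows "(\<lambda>k. f (k - n)) summable_on UNIV \<longleftrightarrow> f summable_on UNIV"
  by (rule summable_on_reindex_bij_betw) (auto intro!: bij_betwI[where g="\<lambda>k. k + n"])

lemma infsum_reflect_int:
  fixes f :: "int \<Rightarrow> 'a::{t2_space,topological_comm_monoid_add}"
  shows "(\<Sum>\<^sub>\<infinity>k. f (m - k)) = (\<Sum>\<^sub>\<infinity>k. f k)"
  by (rule infsum_reindex_bij_betw) (auto intro!: bij_betwI[where g="\<lambda>k. m - k"])

lemma infsum_shift_int:
  fixes f :: "int \<Rightarrow> 'a::{t2_space,topological_comm_monoid_add}"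
  shows "(\<Sum>\<^sub>\<infinity>k. f (k - n)) = (\<Sum>\<^sub>\<infinity>k. f k)"
  by (rule infsum_reindex_bij_betw) (auto intro!: bij_betwI[where g="\<lambda>k. k + n"])

lemma omegaC_ge: "4 \<le> omegaC"
proof -
  have "sum omega {0} \<le> (\<Sum>\<^sub>\<infinity>k. omega k)"
    by (rule finite_sum_le_infsum) (auto simp: omega_summable)
  then show ?thesis by (simp add: omegaC_def)
qed

lemma omega_conv:
  shows "(\<lambda>k. omega (m - k) * omega (k - n)) summable_on UNIV"
    and "(\<Sum>\<^sub>\<infinity>k. omega (m - k) * omega (k - n)) \<le> omegaC * omega (m - n)"
proof -
  have s: "((\<lambda>k. 2 * omega (m - n) * (omega (m - k) + omega (k - n))) has_sum
      2 * omega (m - n) * ((\<Sum>\<^sub>\<infinity>k. omega k) + (\<Sum>\<^sub>\<infinity>k. omega k))) UNIV"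
  proof (intro has_sum_cmult_right has_sum_add)
    show "((\<lambda>k. omega (m - k)) has_sum (\<Sum>\<^sub>\<infinity>k. omega k)) UNIV"
      using omega_summable by (simp add: has_sum_iff summable_on_reflect_int infsum_reflect_int)
    show "((\<lambda>k. omega (k - n)) has_sum (\<Sum>\<^sub>\<infinity>k. omega k)) UNIV"
      using omega_summable by (simp add: has_sum_iff summable_on_shift_int infsum_shift_int)
  qed
  show 1: "(\<lambda>k. omega (m - k) * omega (k - n)) summable_on UNIV"
    by (rule summable_on_comparison_test[OF has_sum_imp_summable[OF s]]) (auto simp: omega_split)
  have "(\<Sum>\<^sub>\<infinity>k. omega (m - k) * omega (k - n)) \<le> 2 * omega (m - n) * ((\<Sum>\<^sub>\<infinity>k. omega k) + (\<Sum>\<^sub>\<infinity>k. omega k))"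
    using infsum_mono[OF 1 has_sum_imp_summable[OF s]] infsumI[OF s] by (simp add: omega_split)
  then show "(\<Sum>\<^sub>\<infinity>k. omega (m - k) * omega (k - n)) \<le> omegaC * omega (m - n)"
    by (simp add: omegaC_def mult_ac)
qed

lemma infsum_diff:
  fixes f g :: "'b \<Rightarrow> 'a::{topological_ab_group_add,t2_space}"
  assumes "f summable_on A" "g summable_on A"
  shows "(\<Sum>\<^sub>\<infinity>x\<in>A. f x - g x) = infsum f A - infsum g A"
proof -
  have "(\<lambda>x. - g x) summable_on A"
    using assms(2) by (simp add: summable_on_uminus)
  from infsum_add[OF assms(1) this] show ?thesis
    by (simp add: infsum_uminus)
qed

section \<open>Infinite matrices with exponential off-diagonal decay\<close>

definition matvec :: "(int \<Rightarrow> int \<Rightarrow> complex) \<Rightarrow> (int \<Rightarrow> complex) \<Rightarrow> int \<Rightarrow> complex" where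
  "matvec A c m = (\<Sum>\<^sub>\<infinity>k. A m k * c k)"

lemma matvec_scale: "matvec A (\<lambda>k. a * c k) m = a * matvec A c m"
  unfolding matvec_def by (subst infsum_cmult_right'[symmetric]) (simp add: mult_ac)

definition matmat :: "(int \<Rightarrow> int \<Rightarrow> complex) \<Rightarrow> (int \<Rightarrow> int \<Rightarrow> complex) \<Rightarrow> int \<Rightarrow> int \<Rightarrow> complex" where
  "matmat A B m n = matvec A (\<lambda>k. B k n) m"

locale decay =
  fixes r :: real
  assumes r_ge_1: "1 \<le> r"
begin

text \<open>Dividing by \<open>omegaC\<close> makes the convolution of the kernel with itself at
  most the kernel; the exponential factor is compatible with this by the triangle inequality. Bounds
  of decaying matrices therefore multiply without an extra constant.\<close>

definition kappa :: "int \<Rightarrow> real" where "kappa k = omega k / (omegaC * r ^ nat \<bar>k\<bar>)"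

lemma r_pow_ge_1: "1 \<le> r ^ n"
  using r_ge_1 by simp

lemma r_pos: "0 < r" using r_ge_1 by simp

lemma kappa_pos: "0 < kappa k"
  unfolding kappa_def using omega_pos omegaC_ge r_pos by (intro divide_pos_pos mult_pos_pos) auto

lemma kappa_nonneg [simp]: "0 \<le> kappa k"
  using kappa_pos[of k] by simp

lemma kappa_0: "kappa 0 = 1 / omegaC"
  by (simp add: kappa_def)

lemma kappa_uminus [simp]: "kappa (- k) = kappa k"
  by (simp add: kappa_def)

lemma kappa_minus_commute: "kappa (m - n) = kappa (n - m)"
  using kappa_uminus[of "m - n"] by simp

lemma kappa_le_omega: "kappa k \<le> omega k / omegaC"
  unfolding kappa_def using omegaC_ge r_pow_ge_1[of "nat \<bar>k\<bar>"] omega_nonneg[of k]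
  by (intro divide_left_mono) (auto intro!: mult_pos_pos simp: r_pos)

lemma kappa_le: "kappa k \<le> omega k"
proof -
  have "omega k / omegaC \<le> omega k"
    using divide_left_mono[of 1 omegaC "omega k"] omegaC_ge by simp
  then show ?thesis using kappa_le_omega[of k] by linarith
qed

lemma kappa_le_1: "kappa k \<le> 1"
  using kappa_le[of k] omega_le_1[of k] by simp

text \<open>A weight \<open>v\<close> such that convolution with \<open>kappa\<close> contracts the \<open>v\<close>-weighted supremum norm.\<close>

definition admissible :: "(int \<Rightarrow> real) \<Rightarrow> bool" where
  "admissible v \<longleftrightarrow> (\<forall>m. 0 < v m) \<and>
     (\<forall>m. (\<lambda>k. kappa (m - k) * v k) summable_on UNIV \<and> (\<Sum>\<^sub>\<infinity>k. kappa (m - k) * v k) \<le> v m)"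

lemma admissible_pos: "admissible v \<Longrightarrow> 0 < v m"
  by (simp add: admissible_def)

lemma admissibleI:
  assumes "\<And>m. 0 < v m"
    and "\<And>m k. kappa (m - k) * v k \<le> u m k" "\<And>m. u m summable_on UNIV"
    and "\<And>m. (\<Sum>\<^sub>\<infinity>k. u m k) \<le> v m"
  shows "admissible v"
  unfolding admissible_def
proof (intro conjI allI)
  fix m
  show s: "(\<lambda>k. kappa (m - k) * v k) summable_on UNIV"
    by (rule summable_on_comparison_test[OF assms(3)[of m]])
      (auto simp: assms(2) less_imp_le[OF assms(1)])
  show "(\<Sum>\<^sub>\<infinity>k. kappa (m - k) * v k) \<le> v m"
    using infsum_mono[OF s assms(3)[of m]] assms(2) assms(4)[of m] by force
qed (rule assms)

text \<open>The weight for sequences in the domain of the operator.\<close>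

lemma admissible_omega: "admissible omega"
proof (rule admissibleI[where u="\<lambda>m k. 1 / omegaC * (omega (m - k) * omega (k - 0))"])
  show "(\<lambda>k. 1 / omegaC * (omega (m - k) * omega (k - 0))) summable_on UNIV" for m
    by (rule summable_on_cmult_right[OF omega_conv(1)])
  show "kappa (m - k) * omega k \<le> 1 / omegaC * (omega (m - k) * omega (k - 0))" for m k
    using mult_right_mono[OF kappa_le_omega[of "m - k"] omega_nonneg[of k]] by simp
  show "(\<Sum>\<^sub>\<infinity>k. 1 / omegaC * (omega (m - k) * omega (k - 0))) \<le> omega m" for m
    using omega_conv(2)[of m 0] omegaC_ge
    by (subst infsum_cmult_right[OF omega_conv(1)]) (simp add: divide_simps mult.commute)
qed (rule omega_pos)

text \<open>Plain boundedness is needed as well: for c bounded by a multiple of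
  \<open>omega\<close>, the sequence \<open>(pi m)^2 c m\<close> is in general only bounded.\<close>

lemma admissible_1: "admissible (\<lambda>_. 1)"
proof (rule admissibleI[where u="\<lambda>m k. 1 / omegaC * omega (m - k)"])
  have s: "(\<lambda>k. omega (m - k)) summable_on UNIV" for m
    using omega_summable by (simp add: summable_on_reflect_int)
  then show "(\<lambda>k. 1 / omegaC * omega (m - k)) summable_on UNIV" for m
    by (rule summable_on_cmult_right)
  show "kappa (m - k) * 1 \<le> 1 / omegaC * omega (m - k)" for m k
    using kappa_le_omega[of "m - k"] by simp
  show "(\<Sum>\<^sub>\<infinity>k. 1 / omegaC * omega (m - k)) \<le> 1" for m
    using omegaC_ge by (subst infsum_cmult_right[OF s]) (simp add: infsum_reflect_int omegaC_def)
qed simp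

text \<open>A column of a decaying matrix is a vector bounded by a translate of
  \<open>kappa\<close>, so this instance turns the bound for matrix-vector products into one for
  matrix products.\<close>

lemma admissible_kappa: "admissible (\<lambda>k. kappa (k - n))"
proof (rule admissibleI[where u="\<lambda>m k. 1 / (omegaC * omegaC * r ^ nat \<bar>m - n\<bar>) * (omega (m - k) * omega (k - n))"])
  fix m
  define c where "c = 1 / (omegaC * omegaC * r ^ nat \<bar>m - n\<bar>)"
  show "(\<lambda>k. c * (omega (m - k) * omega (k - n))) summable_on UNIV"
    by (rule summable_on_cmult_right[OF omega_conv(1)])
  have "(\<Sum>\<^sub>\<infinity>k. c * (omega (m - k) * omega (k - n))) = c * (\<Sum>\<^sub>\<infinity>k. omega (m - k) * omega (k - n))"
    by (rule infsum_cmult_right[OF omega_conv(1)])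
  also have "\<dots> \<le> c * (omegaC * omega (m - n))"
    using omega_conv(2) omegaC_ge r_pos by (intro mult_left_mono) (auto simp: c_def)
  also have "\<dots> = kappa (m - n)"
    using omegaC_ge r_pos by (simp add: c_def kappa_def)
  finally show "(\<Sum>\<^sub>\<infinity>k. c * (omega (m - k) * omega (k - n))) \<le> kappa (m - n)" .
  fix k
  have "r ^ nat \<bar>m - n\<bar> \<le> r ^ (nat \<bar>m - k\<bar> + nat \<bar>k - n\<bar>)"
    using r_ge_1 by (intro power_increasing) auto
  then have le: "omegaC * omegaC * r ^ nat \<bar>m - n\<bar> \<le> omegaC * omegaC * (r ^ nat \<bar>m - k\<bar> * r ^ nat \<bar>k - n\<bar>)"
    using omegaC_ge by (intro mult_left_mono) (auto simp: power_add)
  have "kappa (m - k) * kappa (k - n)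
      = omega (m - k) * omega (k - n) / (omegaC * omegaC * (r ^ nat \<bar>m - k\<bar> * r ^ nat \<bar>k - n\<bar>))"
    by (simp add: kappa_def)
  also have "\<dots> \<le> omega (m - k) * omega (k - n) / (omegaC * omegaC * r ^ nat \<bar>m - n\<bar>)"
    using le omegaC_ge r_pos by (intro divide_left_mono) auto
  finally show "kappa (m - k) * kappa (k - n) \<le> c * (omega (m - k) * omega (k - n))"
    by (simp add: c_def)
qed (rule kappa_pos)

definition decays :: "real \<Rightarrow> (int \<Rightarrow> int \<Rightarrow> complex) \<Rightarrow> bool" where
  "decays R A \<longleftrightarrow> (\<forall>m n. cmod (A m n) \<le> R * kappa (m - n))"

lemma decaysD: "decays R A \<Longrightarrow> cmod (A m n) \<le> R * kappa (m - n)"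
  by (simp add: decays_def)

lemma decays_nonneg:
  assumes "decays R A" shows "0 \<le> R"
proof -
  have "0 \<le> R * kappa (0 - 0)"
    using decaysD[OF assms, of 0 0] norm_ge_zero order_trans by blast
  then show ?thesis using kappa_pos[of 0] by (simp add: zero_le_mult_iff)
qed

lemma vec_bound_nonneg:
  assumes "admissible v" "\<And>k. cmod (c k) \<le> C * v k" shows "0 \<le> C"
proof -
  have "0 \<le> C * v 0"
    using assms(2)[of 0] norm_ge_zero order_trans by blast
  then show ?thesis using admissible_pos[OF assms(1), of 0] by (simp add: zero_le_mult_iff)
qed

lemma matvec_abs_summable:
  assumes "decays R A" "admissible v" "\<And>k. cmod (c k) \<le> C * v k"
  shows "(\<lambda>k. cmod (A m k * c k)) summable_on UNIV"
    and "(\<Sum>\<^sub>\<infinity>k. cmod (A m k * c k)) \<le> R * C * v m"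
proof -
  have s: "(\<lambda>k. (R * C) * (kappa (m - k) * v k)) summable_on UNIV"
    using assms(2) by (intro summable_on_cmult_right) (simp add: admissible_def)
  have le: "cmod (A m k * c k) \<le> (R * C) * (kappa (m - k) * v k)" for k
    using mult_mono[OF decaysD[OF assms(1), of m k] assms(3)[of k]] decays_nonneg[OF assms(1)]
    by (simp add: norm_mult mult_ac)
  show a: "(\<lambda>k. cmod (A m k * c k)) summable_on UNIV"
    by (rule summable_on_comparison_test[OF s]) (use le in auto)
  have "(\<Sum>\<^sub>\<infinity>k. cmod (A m k * c k)) \<le> (\<Sum>\<^sub>\<infinity>k. (R * C) * (kappa (m - k) * v k))"
    by (rule infsum_mono[OF a s]) (use le in auto)
  also have "\<dots> = R * C * (\<Sum>\<^sub>\<infinity>k. kappa (m - k) * v k)"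
    using assms(2) by (intro infsum_cmult_right) (simp add: admissible_def)
  also have "\<dots> \<le> R * C * v m"
    using assms(2) decays_nonneg[OF assms(1)] vec_bound_nonneg[OF assms(2,3)]
    by (intro mult_left_mono) (auto simp: admissible_def)
  finally show "(\<Sum>\<^sub>\<infinity>k. cmod (A m k * c k)) \<le> R * C * v m" .
qed

lemma matvec_summable:
  assumes "decays R A" "admissible v" "\<And>k. cmod (c k) \<le> C * v k"
  shows "(\<lambda>k. A m k * c k) summable_on UNIV"
  using matvec_abs_summable(1)[OF assms] by (rule abs_summable_summable)

lemma matvec_bound:
  assumes "decays R A" "admissible v" "\<And>k. cmod (c k) \<le> C * v k"
  shows "cmod (matvec A c m) \<le> R * C * v m"
  unfolding matvec_def using norm_infsum_bound[OF matvec_abs_summable(1)[OF assms]] matvec_abs_summable(2)[OF assms, of m]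
  by (rule order_trans)

lemma matmat_decays:
  assumes "decays R A" "decays S B"
  shows "decays (R * S) (matmat A B)"
  unfolding decays_def matmat_def
  using matvec_bound[OF assms(1) admissible_kappa decaysD[OF assms(2)]] by blast

lemma matvec_add:
  assumes "decays R A" "admissible v" "\<And>k. cmod (c k) \<le> C * v k" "\<And>k. cmod (d k) \<le> D * v k"
  shows "matvec A (\<lambda>k. c k + d k) m = matvec A c m + matvec A d m"
  unfolding matvec_def
  by (subst infsum_add[OF matvec_summable[OF assms(1-3)] matvec_summable[OF assms(1,2,4)], symmetric])
    (simp add: algebra_simps)

lemma matvec_diff:
  assumes "decays R A" "admissible v" "\<And>k. cmod (c k) \<le> C * v k" "\<And>k. cmod (d k) \<le> D * v k"
  shows "matvec A (\<lambda>k. c k - d k) m = matvec A c m - matvec A d m"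
  unfolding matvec_def
  by (subst infsum_diff[OF matvec_summable[OF assms(1-3)] matvec_summable[OF assms(1,2,4)], symmetric])
    (simp add: algebra_simps)

lemma matvec_diff_left:
  assumes "decays R A" "decays S B" "admissible v" "\<And>k. cmod (c k) \<le> C * v k"
  shows "matvec (\<lambda>m n. A m n - B m n) c m = matvec A c m - matvec B c m"
  unfolding matvec_def
  by (subst infsum_diff[OF matvec_summable[OF assms(1,3,4)] matvec_summable[OF assms(2,3,4)], symmetric])
    (simp add: algebra_simps)

lemma matvec_add_left:
  assumes "decays R A" "decays S B" "admissible v" "\<And>k. cmod (c k) \<le> C * v k"
  shows "matvec (\<lambda>m n. A m n + B m n) c m = matvec A c m + matvec B c m"
  unfolding matvec_def
  by (subst infsum_add[OF matvec_summable[OF assms(1,3,4)] matvec_summable[OF assms(2,3,4)], symmetric])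
    (simp add: algebra_simps)

text \<open>Associativity is an exchange of two infinite sums, justified by absolute summability of
  the double family.\<close>

lemma matvec_matvec:
  assumes "decays R A" "decays S B" "admissible v" "\<And>k. cmod (c k) \<le> C * v k"
  shows "matvec A (matvec B c) m = matvec (matmat A B) c m"
proof -
  have C: "0 \<le> C" using vec_bound_nonneg assms(3,4) by blast
  have RS: "0 \<le> R" "0 \<le> S" using decays_nonneg assms(1,2) by blast+
  have inner: "((\<lambda>n. cmod (A m k * (B k n * c n))) has_sum cmod (A m k) * (\<Sum>\<^sub>\<infinity>n. cmod (B k n * c n))) UNIV" for k
    using has_sum_cmult_right[OF has_sum_infsum[OF matvec_abs_summable(1)[OF assms(2-4), of k]], of "cmod (A m k)"]
    by (simp add: norm_mult mult_ac)
  have "(\<lambda>p. cmod ((\<lambda>(k, n). A m k * (B k n * c n)) p)) summable_on UNIV \<times> UNIV"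
  proof (rule summable_on_SigmaI[where g="\<lambda>k. cmod (A m k) * (\<Sum>\<^sub>\<infinity>n. cmod (B k n * c n))"])
    \<comment> \<open>The inner sums of absolute values are themselves a vector bounded by a
      multiple of v, so the estimate for A applies to them.\<close>
    have "(\<lambda>k. cmod (A m k * complex_of_real (\<Sum>\<^sub>\<infinity>n. cmod (B k n * c n)))) summable_on UNIV"
    proof (rule matvec_abs_summable(1)[OF assms(1,3)])
      show "cmod (complex_of_real (\<Sum>\<^sub>\<infinity>n. cmod (B k n * c n))) \<le> (S * C) * v k" for k
        using matvec_abs_summable(2)[OF assms(2-4), of k]
        by (simp add: abs_of_nonneg infsum_nonneg)
    qed
    then show "(\<lambda>k. cmod (A m k) * (\<Sum>\<^sub>\<infinity>n. cmod (B k n * c n))) summable_on UNIV"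
      by (simp add: norm_mult abs_of_nonneg infsum_nonneg)
  qed (use inner in auto)
  then have s: "(\<lambda>(k, n). A m k * (B k n * c n)) summable_on UNIV \<times> UNIV"
    by (rule abs_summable_summable)
  have "matvec A (matvec B c) m = (\<Sum>\<^sub>\<infinity>k. \<Sum>\<^sub>\<infinity>n. A m k * (B k n * c n))"
    unfolding matvec_def by (simp add: infsum_cmult_right')
  also have "\<dots> = (\<Sum>\<^sub>\<infinity>n. \<Sum>\<^sub>\<infinity>k. A m k * (B k n * c n))"
    by (rule infsum_swap_banach[OF s])
  also have "\<dots> = matvec (matmat A B) c m"
    unfolding matvec_def matmat_def by (simp add: infsum_cmult_left' mult.assoc[symmetric])
  finally show ?thesis .
qed

end

section \<open>Block diagonalization by a contraction\<close>

text \<open>Picard iteration from 0 on a ball of a weighted supremum norm, carried out entry by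
  entry. It serves for the nonlinear block equations, indexed by pairs, and for inverting
  \<open>I + X\<close>, indexed by integers.\<close>

lemma weighted_fixed_point:
  fixes \<omega> :: "'a \<Rightarrow> real" and \<Phi> :: "('a \<Rightarrow> complex) \<Rightarrow> 'a \<Rightarrow> complex"
  assumes \<rho>: "0 \<le> \<rho>"
    and self: "\<And>Y. (\<And>x. cmod (Y x) \<le> \<rho> * \<omega> x) \<Longrightarrow> (\<And>x. cmod (\<Phi> Y x) \<le> \<rho> * \<omega> x)"
    and contr: "\<And>Y Z \<delta>. (\<And>x. cmod (Y x) \<le> \<rho> * \<omega> x) \<Longrightarrow> (\<And>x. cmod (Z x) \<le> \<rho> * \<omega> x) \<Longrightarrow>
       (\<And>x. cmod (Y x - Z x) \<le> \<delta> * \<omega> x) \<Longrightarrow> (\<And>x. cmod (\<Phi> Y x - \<Phi> Z x) \<le> \<delta> / 2 * \<omega> x)"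
    and \<omega>: "\<And>x. 0 \<le> \<omega> x"
  obtains Y where "\<And>x. cmod (Y x) \<le> \<rho> * \<omega> x" "\<Phi> Y = Y"
proof -
  define U where "U k = (\<Phi> ^^ k) (\<lambda>_. 0)" for k
  have U_Suc: "U (Suc k) = \<Phi> (U k)" for k by (simp add: U_def)
  have U_le: "cmod (U k x) \<le> \<rho> * \<omega> x" for k x
    by (induction k arbitrary: x) (use \<rho> \<omega> self in \<open>auto simp: U_Suc, simp add: U_def\<close>)
  have step: "cmod (U (Suc k) x - U k x) \<le> \<rho> / 2 ^ k * \<omega> x" for k x
  proof (induction k arbitrary: x)
    case 0
    then show ?case using U_le[of 1 x] by (simp add: U_def)
  next
    case (Suc k)
    show ?case
      using contr[of "U (Suc k)" "U k" "\<rho> / 2 ^ k", OF U_le U_le Suc, of x] by (simp add: U_Suc mult.commute)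
  qed
  \<comment> \<open>The factor \<open>1 - 1 / 2 ^ j\<close> is the exact partial sum of the
    geometric series; it lets the induction on j close and is dropped in
    \<open>far'\<close>.\<close>
  have far: "cmod (U (k + j) x - U k x) \<le> 2 * \<rho> / 2 ^ k * \<omega> x * (1 - 1 / 2 ^ j)" for k j x
  proof (induction j)
    case (Suc j)
    have "cmod (U (k + Suc j) x - U k x) \<le> cmod (U (Suc (k + j)) x - U (k + j) x) + cmod (U (k + j) x - U k x)"
      using norm_triangle_ineq[of "U (Suc (k + j)) x - U (k + j) x" "U (k + j) x - U k x"] by simp
    also have "\<dots> \<le> \<rho> / 2 ^ (k + j) * \<omega> x + 2 * \<rho> / 2 ^ k * \<omega> x * (1 - 1 / 2 ^ j)"
      by (rule add_mono[OF step Suc])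
    also have "\<dots> = 2 * \<rho> / 2 ^ k * \<omega> x * (1 - 1 / 2 ^ Suc j)"
      by (simp add: power_add field_simps)
    finally show ?case .
  qed simp
  have far': "cmod (U (k + j) x - U k x) \<le> 2 * \<rho> * \<omega> x * (1 / 2) ^ k" for k j x
  proof -
    have "2 * \<rho> / 2 ^ k * \<omega> x * (1 - 1 / 2 ^ j) \<le> 2 * \<rho> / 2 ^ k * \<omega> x * 1"
      using \<rho> \<omega>[of x] by (intro mult_left_mono) auto
    then show ?thesis using far[of k j x] by (simp add: power_divide)
  qed
  have "convergent (\<lambda>k. U k x)" for x
  proof -
    have "summable (\<lambda>k. U (Suc k) x - U k x)"
    proof (rule summable_comparison_test')
      show "norm (U (Suc k) x - U k x) \<le> \<rho> * \<omega> x * (1 / 2) ^ k" for k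
        using step[of k x] by (simp add: power_divide)
      show "summable (\<lambda>k. \<rho> * \<omega> x * (1 / 2) ^ k)"
        by (intro summable_mult summable_geometric) simp
    qed
    then have "(\<lambda>n. \<Sum>k<n. U (Suc k) x - U k x) \<longlonglongrightarrow> (\<Sum>k. U (Suc k) x - U k x)"
      by (simp add: summable_LIMSEQ)
    then have "(\<lambda>n. U n x - U 0 x) \<longlonglongrightarrow> (\<Sum>k. U (Suc k) x - U k x)"
      by (simp add: sum_lessThan_telescope[of "\<lambda>k. U k x"])
    then have "(\<lambda>n. U n x - U 0 x + U 0 x) \<longlonglongrightarrow> (\<Sum>k. U (Suc k) x - U k x) + U 0 x"
      by (rule tendsto_add) simp
    then show ?thesis by (auto simp: convergent_def)
  qed
  then have lim: "(\<lambda>k. U k x) \<longlonglongrightarrow> lim (\<lambda>k. U k x)" for x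
    by (simp add: convergent_LIMSEQ_iff)
  define Y where "Y x = lim (\<lambda>k. U k x)" for x
  have lim: "(\<lambda>k. U k x) \<longlonglongrightarrow> Y x" for x
    using lim by (simp add: Y_def)
  have Y_le: "cmod (Y x) \<le> \<rho> * \<omega> x" for x
    by (rule tendsto_upperbound[OF tendsto_norm[OF lim]]) (auto simp: U_le)
  have dist: "cmod (Y x - U k x) \<le> (2 * \<rho> * (1 / 2) ^ k) * \<omega> x" for x k
  proof (rule tendsto_upperbound)
    show "(\<lambda>j. cmod (U (j + k) x - U k x)) \<longlonglongrightarrow> cmod (Y x - U k x)"
      by (intro tendsto_intros LIMSEQ_ignore_initial_segment lim)
    show "\<forall>\<^sub>F j in sequentially. cmod (U (j + k) x - U k x) \<le> 2 * \<rho> * (1 / 2) ^ k * \<omega> x"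
      using far'[of k _ x] by (auto simp: add.commute mult_ac)
  qed simp
  \<comment> \<open>Pointwise convergence would not pass through \<Phi>; the distance bound
    \<open>dist\<close>, uniform relative to the weight, does.\<close>
  have "(\<lambda>k. U (Suc k) x) \<longlonglongrightarrow> \<Phi> Y x" for x
  proof (rule Lim_null_comparison[THEN LIM_zero_cancel])
    show "\<forall>\<^sub>F k in sequentially. norm (U (Suc k) x - \<Phi> Y x) \<le> \<rho> * \<omega> x * (1 / 2) ^ k"
      using contr[OF Y_le U_le dist] by (auto simp: U_Suc norm_minus_commute mult_ac)
    show "(\<lambda>k. \<rho> * \<omega> x * (1 / 2) ^ k) \<longlonglongrightarrow> 0"
      by (intro tendsto_mult_right_zero LIMSEQ_power_zero) simp
  qed
  then have "\<Phi> Y x = Y x" for x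
    using LIMSEQ_unique[OF _ LIMSEQ_Suc[OF lim]] by blast
  then show ?thesis using that[of Y] Y_le by auto
qed

section \<open>Unknowns and equations of the block diagonalization\<close>

definition diag_pos :: "int \<Rightarrow> int \<Rightarrow> int \<Rightarrow> bool" where
  "diag_pos N m n \<longleftrightarrow> m = n \<or> (\<bar>m\<bar> \<le> N \<and> \<bar>n\<bar> \<le> N)"

definition toeplitz :: "(int \<Rightarrow> complex) \<Rightarrow> int \<Rightarrow> int \<Rightarrow> complex" where
  "toeplitz p m n = p (m - n)"

context decay
begin

text \<open>The unknown matrix \<open>Y\<close> carries the similarity in its generic entries, scaled by \<open>\<sigma>\<close>, and the
  high Fourier coefficients of the potential in its antidiagonal entries.\<close>

definition block_coeff :: "int \<Rightarrow> (int \<Rightarrow> complex) \<Rightarrow> (int \<Rightarrow> int \<Rightarrow> complex) \<Rightarrow> int \<Rightarrow> complex" where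
  "block_coeff N \<tau> Y k = (if even k \<and> 2 * N < \<bar>k\<bar> then Y (k div 2) (- (k div 2)) else \<tau> k)"

definition block_X :: "int \<Rightarrow> real \<Rightarrow> (int \<Rightarrow> int \<Rightarrow> complex) \<Rightarrow> int \<Rightarrow> int \<Rightarrow> complex" where
  "block_X N \<sigma> Y m n = (if diag_pos N m n \<or> m = - n then 0 else of_real \<sigma> * Y m n)"

definition block_PX where
  "block_PX N \<tau> \<sigma> Y = matmat (toeplitz (block_coeff N \<tau> Y)) (block_X N \<sigma> Y)"

text \<open>This is \<open>P (I + X)\<close> for the Toeplitz matrix P of the corrected
  potential.\<close>

definition block_W where
  "block_W N \<tau> \<sigma> Y m n = toeplitz (block_coeff N \<tau> Y) m n + block_PX N \<tau> \<sigma> Y m n"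

definition block_B where
  "block_B N \<tau> \<sigma> Y m n = (if diag_pos N m n then block_W N \<tau> \<sigma> Y m n else 0)"

definition block_XB where
  "block_XB N \<tau> \<sigma> Y = matmat (block_X N \<sigma> Y) (block_B N \<tau> \<sigma> Y)"

text \<open>A fixed point solves \<open>D X + P (I + X) = X D + B + X B\<close> entrywise. On the
  antidiagonal outside the block, \<open>Y m n\<close> is the coefficient of index
  \<open>m - n\<close>, and the equation says that \<open>P (I + X)\<close> vanishes there. At
  generic positions the equation is solved for X = \<sigma> Y. The allowed positions of B carry no
  unknown and get the value 0.\<close>

definition block_map where
  "block_map N \<tau> \<sigma> Y m n = (if diag_pos N m n then 0 else if m = - n then - block_PX N \<tau> \<sigma> Y m n
     else (block_XB N \<tau> \<sigma> Y m n - block_W N \<tau> \<sigma> Y m n) / of_real (\<sigma> * pi\<^sup>2 * (of_int m ^ 2 - of_int n ^ 2)))"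

lemma decays_mono: "decays R A \<Longrightarrow> R \<le> S \<Longrightarrow> decays S A"
  unfolding decays_def using mult_right_mono[of R S, OF _ kappa_nonneg] order_trans by blast

lemma decays_add: "decays R A \<Longrightarrow> decays S B \<Longrightarrow> decays (R + S) (\<lambda>m n. A m n + B m n)"
  unfolding decays_def by (metis (no_types, lifting) add_mono distrib_right norm_triangle_le)

lemma decays_diff: "decays R A \<Longrightarrow> decays S B \<Longrightarrow> decays (R + S) (\<lambda>m n. A m n - B m n)"
  unfolding decays_def by (metis (no_types, lifting) add_mono distrib_right norm_triangle_le_diff)

lemma decays_restrict:
  assumes "decays R A" shows "decays R (\<lambda>m n. if Q m n then A m n else 0)"
  using assms decays_nonneg[OF assms] unfolding decays_def by (auto simp: mult_nonneg_nonneg)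

lemma matmat_diff_matmat:
  assumes "decays R A" "decays R' A'" "decays S B" "decays S' B'"
  shows "matmat A B m n - matmat A' B' m n
    = matmat A (\<lambda>m n. B m n - B' m n) m n + matmat (\<lambda>m n. A m n - A' m n) B' m n"
proof -
  have 1: "matmat A (\<lambda>m n. B m n - B' m n) m n = matmat A B m n - matmat A B' m n"
    unfolding matmat_def
    by (rule matvec_diff[OF assms(1) admissible_kappa[of n] decaysD[OF assms(3)] decaysD[OF assms(4)]])
  have 2: "matmat (\<lambda>m n. A m n - A' m n) B' m n = matmat A B' m n - matmat A' B' m n"
    unfolding matmat_def
    by (rule matvec_diff_left[OF assms(1,2) admissible_kappa[of n] decaysD[OF assms(4)]])
  show ?thesis using 1 2 by simp
qed

text \<open>The larger of \<open>|m - n|\<close> and \<open>|m + n|\<close> is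
  \<open>|m| + |n|\<close>, which exceeds N because one index lies outside the block; the other
  factor is a nonzero integer in modulus.\<close>

lemma square_gap:
  assumes "\<not> diag_pos N m n" "m \<noteq> - n"
  shows "of_int N \<le> \<bar>(of_int m)\<^sup>2 - (of_int n)\<^sup>2 :: real\<bar>"
proof -
  have "1 \<le> \<bar>m - n\<bar>" "1 \<le> \<bar>m + n\<bar>" "N \<le> max \<bar>m - n\<bar> \<bar>m + n\<bar>"
    using assms by (auto simp: diag_pos_def)
  then have "N \<le> \<bar>m - n\<bar> * \<bar>m + n\<bar>"
    using mult_mono[of 1 "\<bar>m - n\<bar>" "\<bar>m + n\<bar>" "\<bar>m + n\<bar>"] mult_mono[of "\<bar>m - n\<bar>" "\<bar>m - n\<bar>" 1 "\<bar>m + n\<bar>"]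
    by (auto simp: max_def split: if_splits)
  also have "\<dots> = \<bar>m\<^sup>2 - n\<^sup>2\<bar>"
    by (simp add: abs_mult[symmetric] power2_eq_square algebra_simps)
  finally have "of_int N \<le> (of_int \<bar>m\<^sup>2 - n\<^sup>2\<bar> :: real)"
    by linarith
  then show ?thesis by simp
qed

lemma block_decays:
  assumes \<tau>: "\<And>k. cmod (\<tau> k) \<le> R * kappa k" and R: "0 \<le> R"
    and \<sigma>: "0 < \<sigma>" "\<sigma> \<le> 1" and \<rho>: "\<rho> \<le> 1" and Y: "decays \<rho> Y"
  shows "decays (R + 1) (toeplitz (block_coeff N \<tau> Y))"
    and "decays (\<sigma> * \<rho>) (block_X N \<sigma> Y)"
    and "decays ((R + 1) * (\<sigma> * \<rho>)) (block_PX N \<tau> \<sigma> Y)"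
    and "decays (2 * (R + 1)) (block_W N \<tau> \<sigma> Y)"
    and "decays (2 * (R + 1)) (block_B N \<tau> \<sigma> Y)"
    and "decays (2 * (R + 1)) (block_XB N \<tau> \<sigma> Y)"
proof -
  have \<rho>0: "0 \<le> \<rho>" by (rule decays_nonneg[OF Y])
  have \<sigma>\<rho>: "\<sigma> * \<rho> \<le> 1" "0 \<le> \<sigma> * \<rho>" using \<sigma> \<rho> \<rho>0 by (auto intro: mult_le_one)
  show P: "decays (R + 1) (toeplitz (block_coeff N \<tau> Y))"
    unfolding decays_def toeplitz_def
  proof (intro allI)
    fix m n
    show "cmod (block_coeff N \<tau> Y (m - n)) \<le> (R + 1) * kappa (m - n)"
    proof (cases "even (m - n) \<and> 2 * N < \<bar>m - n\<bar>")
      case True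
      have "cmod (block_coeff N \<tau> Y (m - n)) \<le> \<rho> * kappa ((m - n) div 2 - - ((m - n) div 2))"
      proof -
        have "block_coeff N \<tau> Y (m - n) = Y ((m - n) div 2) (- ((m - n) div 2))"
          using True by (simp add: block_coeff_def)
        then show ?thesis by (simp only: decaysD[OF Y])
      qed
      \<comment> \<open>The entry \<open>(j, -j)\<close> lies at distance \<open>2 j\<close> from
        the diagonal, and \<open>2 j\<close> is also the index of the coefficient stored there. The
        bound on Y is therefore a bound on the coefficient with the same weight.\<close>
      also have "(m - n) div 2 - - ((m - n) div 2) = m - n" using True by auto
      also have "\<rho> * kappa (m - n) \<le> (R + 1) * kappa (m - n)"
        using \<rho> R by (intro mult_right_mono) auto
      finally show ?thesis .
    next
      case False
      then have "cmod (block_coeff N \<tau> Y (m - n)) \<le> R * kappa (m - n)"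
        unfolding block_coeff_def using \<tau> by auto
      also have "\<dots> \<le> (R + 1) * kappa (m - n)"
        by (intro mult_right_mono) auto
      finally show ?thesis .
    qed
  qed
  show X: "decays (\<sigma> * \<rho>) (block_X N \<sigma> Y)"
    using decaysD[OF Y] \<sigma>(1) \<rho>0 unfolding decays_def block_X_def
    by (auto simp: norm_mult mult.assoc intro!: mult_nonneg_nonneg)
  show PX: "decays ((R + 1) * (\<sigma> * \<rho>)) (block_PX N \<tau> \<sigma> Y)"
    unfolding block_PX_def by (rule matmat_decays[OF P X])
  have h: "(R + 1) * (\<sigma> * \<rho>) \<le> R + 1"
    by (rule mult_left_le) (use \<sigma>\<rho> R in auto)
  show W: "decays (2 * (R + 1)) (block_W N \<tau> \<sigma> Y)"
    unfolding block_W_def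
    by (rule decays_mono[OF decays_add[OF P PX]])
      (rule order_trans[OF add_left_mono[OF h]], simp)
  show B: "decays (2 * (R + 1)) (block_B N \<tau> \<sigma> Y)"
    unfolding block_B_def by (rule decays_restrict[OF W])
  show "decays (2 * (R + 1)) (block_XB N \<tau> \<sigma> Y)"
    unfolding block_XB_def
    by (rule decays_mono[OF matmat_decays[OF X B]])
      (rule mult_left_le_one_le, use \<sigma>\<rho> R in auto)
qed

lemma block_map_entry_bound:
  assumes "\<not> diag_pos N m n" "m \<noteq> - n" "cmod z \<le> c * kappa (m - n)" "0 \<le> c" "0 < \<sigma>" "0 < N"
    and "c / (\<sigma> * of_int N) \<le> d"
  shows "cmod (z / of_real (\<sigma> * pi\<^sup>2 * (of_int m ^ 2 - of_int n ^ 2))) \<le> d * kappa (m - n)"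
proof -
  have pi1: "1 \<le> pi\<^sup>2" using pi_ge_two by (intro one_le_power) simp
  have "\<sigma> * 1 * of_int N \<le> \<sigma> * pi\<^sup>2 * \<bar>of_int m ^ 2 - of_int n ^ 2\<bar>"
    using square_gap[OF assms(1,2)] assms(5,6) pi1 by (intro mult_mono) auto
  then have den: "\<sigma> * of_int N \<le> \<bar>\<sigma> * pi\<^sup>2 * (of_int m ^ 2 - of_int n ^ 2)\<bar>"
    using assms(5) by (simp add: abs_mult)
  have "cmod (z / of_real (\<sigma> * pi\<^sup>2 * (of_int m ^ 2 - of_int n ^ 2)))
      = cmod z / \<bar>\<sigma> * pi\<^sup>2 * (of_int m ^ 2 - of_int n ^ 2)\<bar>"
    by (simp only: norm_divide norm_of_real)
  also have "\<dots> \<le> (c * kappa (m - n)) / (\<sigma> * of_int N)"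
    using den assms(3-6) by (intro frac_le) auto
  also have "\<dots> = c / (\<sigma> * of_int N) * kappa (m - n)" by simp
  also have "\<dots> \<le> d * kappa (m - n)"
    using assms(7) by (intro mult_right_mono) auto
  finally show ?thesis .
qed

text \<open>The antidiagonal entries stay in the ball because of the smallness of \<sigma> alone,
  the generic ones because N is large once \<sigma> is fixed.\<close>

lemma block_map_self:
  assumes \<tau>: "\<And>k. cmod (\<tau> k) \<le> R * kappa k" and R: "0 \<le> R"
    and \<sigma>: "0 < \<sigma>" "\<sigma> \<le> 1" "(R + 1) * \<sigma> \<le> 1" and \<rho>: "\<rho> \<le> 1" and Y: "decays \<rho> Y"
    and N: "0 < N" "4 * (R + 1) / (\<sigma> * of_int N) \<le> \<rho>"
  shows "decays \<rho> (block_map N \<tau> \<sigma> Y)"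
  unfolding decays_def
proof (intro allI)
  fix m n
  note d = block_decays[OF \<tau> R \<sigma>(1,2) \<rho> Y, of N]
  have \<rho>0: "0 \<le> \<rho>" by (rule decays_nonneg[OF Y])
  show "cmod (block_map N \<tau> \<sigma> Y m n) \<le> \<rho> * kappa (m - n)"
  proof (cases "diag_pos N m n \<or> m = - n")
    case True
    have "(R + 1) * (\<sigma> * \<rho>) \<le> \<rho>"
      using mult_right_mono[OF \<sigma>(3) \<rho>0] by (simp add: mult_ac)
    from decaysD[OF decays_mono[OF d(3) this], of m n] show ?thesis
      using True \<rho>0 by (auto simp: block_map_def mult_nonneg_nonneg)
  next
    case False
    have "cmod (block_XB N \<tau> \<sigma> Y m n - block_W N \<tau> \<sigma> Y m n) \<le> 4 * (R + 1) * kappa (m - n)"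
      using decaysD[OF decays_diff[OF d(6,4)], of m n] by simp
    from block_map_entry_bound[OF _ _ this _ \<sigma>(1) N(1,2)] False R show ?thesis
      by (auto simp: block_map_def)
  qed
qed

text \<open>Again \<sigma> takes care of the antidiagonal and N of the generic entries. In the
  constant \<open>R + 2\<close>, the part \<open>R + 1\<close> comes from varying X in the product
  \<open>P X\<close>, the remaining 1 from varying P.\<close>

lemma block_map_contraction:
  assumes \<tau>: "\<And>k. cmod (\<tau> k) \<le> R * kappa k" and R: "0 \<le> R"
    and \<sigma>: "0 < \<sigma>" "\<sigma> \<le> 1" "2 * (R + 2) * \<sigma> \<le> 1" and \<rho>: "\<rho> \<le> 1"
    and Y: "decays \<rho> Y" and Z: "decays \<rho> Z" and YZ: "decays \<delta> (\<lambda>m n. Y m n - Z m n)"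
    and N: "0 < N" "8 * (R + 2) / (\<sigma> * of_int N) \<le> 1"
  shows "decays (\<delta> / 2) (\<lambda>m n. block_map N \<tau> \<sigma> Y m n - block_map N \<tau> \<sigma> Z m n)"
proof -
  note y = block_decays[OF \<tau> R \<sigma>(1,2) \<rho> Y, of N] and z = block_decays[OF \<tau> R \<sigma>(1,2) \<rho> Z, of N]
  have \<rho>0: "0 \<le> \<rho>" by (rule decays_nonneg[OF Y])
  have \<delta>0: "0 \<le> \<delta>" by (rule decays_nonneg[OF YZ])
  have P: "decays \<delta> (\<lambda>m n. toeplitz (block_coeff N \<tau> Y) m n - toeplitz (block_coeff N \<tau> Z) m n)"
    unfolding decays_def toeplitz_def
  proof (intro allI)
    fix m n
    show "cmod (block_coeff N \<tau> Y (m - n) - block_coeff N \<tau> Z (m - n)) \<le> \<delta> * kappa (m - n)"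
    proof (cases "even (m - n) \<and> 2 * N < \<bar>m - n\<bar>")
      case True
      have "(m - n) div 2 - - ((m - n) div 2) = m - n" using True by auto
      then show ?thesis
        unfolding block_coeff_def using True decaysD[OF YZ, of "(m - n) div 2" "- ((m - n) div 2)"] by simp
    qed (auto simp: block_coeff_def \<delta>0)
  qed
  have X: "decays (\<sigma> * \<delta>) (\<lambda>m n. block_X N \<sigma> Y m n - block_X N \<sigma> Z m n)"
    unfolding decays_def
  proof (intro allI)
    fix m n
    show "cmod (block_X N \<sigma> Y m n - block_X N \<sigma> Z m n) \<le> \<sigma> * \<delta> * kappa (m - n)"
    proof (cases "diag_pos N m n \<or> m = - n")
      case False
      then have "cmod (block_X N \<sigma> Y m n - block_X N \<sigma> Z m n) = \<sigma> * cmod (Y m n - Z m n)"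
        using \<sigma>(1) by (simp add: block_X_def right_diff_distrib[symmetric] norm_mult)
      then show ?thesis
        using decaysD[OF YZ, of m n] \<sigma>(1) by (simp add: mult.assoc)
    qed (use \<sigma>(1) \<delta>0 in \<open>auto simp: block_X_def\<close>)
  qed
  have PX: "decays ((R + 2) * \<sigma> * \<delta>) (\<lambda>m n. block_PX N \<tau> \<sigma> Y m n - block_PX N \<tau> \<sigma> Z m n)"
    unfolding block_PX_def matmat_diff_matmat[OF y(1) z(1) y(2) z(2)]
  proof (rule decays_mono[OF decays_add[OF matmat_decays[OF y(1) X] matmat_decays[OF P z(2)]]])
    have "\<delta> * (\<sigma> * \<rho>) \<le> \<delta> * (\<sigma> * 1)"
      using \<rho> \<sigma>(1) \<delta>0 by (intro mult_left_mono) auto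
    then show "(R + 1) * (\<sigma> * \<delta>) + \<delta> * (\<sigma> * \<rho>) \<le> (R + 2) * \<sigma> * \<delta>"
      by (simp add: algebra_simps)
  qed
  have PX_half: "(R + 2) * \<sigma> * \<delta> \<le> \<delta> / 2"
  proof -
    have "2 * ((R + 2) * \<sigma> * \<delta>) \<le> \<delta>"
      using mult_right_mono[OF \<sigma>(3) \<delta>0] by (simp only: mult_1 mult.assoc)
    then show ?thesis by linarith
  qed
  have W: "decays (3 / 2 * \<delta>) (\<lambda>m n. block_W N \<tau> \<sigma> Y m n - block_W N \<tau> \<sigma> Z m n)"
    using decays_mono[OF decays_add[OF P PX], of "3 / 2 * \<delta>"] PX_half
    by (simp add: block_W_def algebra_simps)
  have B: "decays (3 / 2 * \<delta>) (\<lambda>m n. block_B N \<tau> \<sigma> Y m n - block_B N \<tau> \<sigma> Z m n)"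
  proof -
    have "(\<lambda>m n. block_B N \<tau> \<sigma> Y m n - block_B N \<tau> \<sigma> Z m n)
        = (\<lambda>m n. if diag_pos N m n then block_W N \<tau> \<sigma> Y m n - block_W N \<tau> \<sigma> Z m n else 0)"
      by (auto simp: block_B_def fun_eq_iff)
    then show ?thesis using decays_restrict[OF W, of "diag_pos N"] by simp
  qed
  have XB: "decays ((2 * R + 4) * \<delta>) (\<lambda>m n. block_XB N \<tau> \<sigma> Y m n - block_XB N \<tau> \<sigma> Z m n)"
    unfolding block_XB_def matmat_diff_matmat[OF y(2) z(2) y(5) z(5)]
  proof (rule decays_mono[OF decays_add[OF matmat_decays[OF y(2) B] matmat_decays[OF X z(5)]]])
    have "\<sigma> * \<rho> * (3 / 2 * \<delta>) \<le> 1 * (2 * \<delta>)"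
      using \<sigma> \<rho> \<delta>0 \<rho>0 by (intro mult_mono mult_le_one) auto
    moreover have "\<sigma> * \<delta> * (2 * (R + 1)) \<le> 1 * \<delta> * (2 * (R + 1))"
      using \<sigma> \<delta>0 R by (intro mult_right_mono) auto
    ultimately show "\<sigma> * \<rho> * (3 / 2 * \<delta>) + \<sigma> * \<delta> * (2 * (R + 1)) \<le> (2 * R + 4) * \<delta>"
      by (simp add: algebra_simps)
  qed
  show ?thesis
    unfolding decays_def
  proof (intro allI)
    fix m n
    show "cmod (block_map N \<tau> \<sigma> Y m n - block_map N \<tau> \<sigma> Z m n) \<le> \<delta> / 2 * kappa (m - n)"
    proof (cases "diag_pos N m n \<or> m = - n")
      case True
      then show ?thesis
        using decaysD[OF decays_mono[OF PX PX_half], of m n] \<delta>0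
        by (auto simp: block_map_def norm_minus_commute)
    next
      case False
      define z where "z = (block_XB N \<tau> \<sigma> Y m n - block_XB N \<tau> \<sigma> Z m n) - (block_W N \<tau> \<sigma> Y m n - block_W N \<tau> \<sigma> Z m n)"
      have "decays (4 * (R + 2) * \<delta>) (\<lambda>m n. (block_XB N \<tau> \<sigma> Y m n - block_XB N \<tau> \<sigma> Z m n)
          - (block_W N \<tau> \<sigma> Y m n - block_W N \<tau> \<sigma> Z m n))"
        by (rule decays_mono[OF decays_diff[OF XB W]]) (use R \<delta>0 in \<open>simp add: algebra_simps\<close>)
      from decaysD[OF this] have z: "cmod z \<le> 4 * (R + 2) * \<delta> * kappa (m - n)"
        unfolding z_def .
      have eq: "4 * a * \<delta> / x = 8 * a / x * (\<delta> / 2)" for a x :: real by simp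
      have "4 * (R + 2) * \<delta> / (\<sigma> * of_int N) = 8 * (R + 2) / (\<sigma> * of_int N) * (\<delta> / 2)"
        by (rule eq)
      also have "\<dots> \<le> 1 * (\<delta> / 2)" using N(2) \<delta>0 by (intro mult_right_mono) auto
      finally have le: "4 * (R + 2) * \<delta> / (\<sigma> * of_int N) \<le> \<delta> / 2" by simp
      have "block_map N \<tau> \<sigma> Y m n - block_map N \<tau> \<sigma> Z m n
          = z / of_real (\<sigma> * pi\<^sup>2 * (of_int m ^ 2 - of_int n ^ 2))"
        using False by (simp add: block_map_def z_def diff_divide_distrib)
      then show ?thesis
        using block_map_entry_bound[OF _ _ z _ \<sigma>(1) N(1) le] False R \<delta>0 by auto
    qed
  qed
qed

text \<open>The constants are fixed in the order R, \<sigma>, N, while \<rho> is the prescribed size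
  of the correction. The lower bound \<open>N0\<close> lets the support of \<tau> be placed inside
  the range of indices left unchanged. Odd coefficients vanish because the potential has period 1
  while the indices belong to period 2.\<close>

lemma block_diagonalization:
  assumes \<tau>: "\<And>k. cmod (\<tau> k) \<le> R * kappa k" and odd: "\<And>k. odd k \<Longrightarrow> \<tau> k = 0"
    and \<rho>: "0 < \<rho>" "\<rho> \<le> 1"
  obtains N p X B S where "N0 \<le> N" "0 < N" "0 \<le> S"
    "\<And>k. odd k \<Longrightarrow> p k = 0"
    "\<And>k. \<bar>k\<bar> \<le> 2 * N \<Longrightarrow> p k = \<tau> k"
    "\<And>k. even k \<Longrightarrow> 2 * N < \<bar>k\<bar> \<Longrightarrow> cmod (p k) \<le> \<rho> * kappa k"
    "decays S (toeplitz p)" "decays (1 / 2) X" "decays S B"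
    "\<And>m. X m m = 0" "\<And>m. X (- m) m = 0" "\<And>m n. \<not> diag_pos N m n \<Longrightarrow> B m n = 0"
    "\<And>m n. of_real ((pi * of_int m)\<^sup>2) * X m n + (toeplitz p m n + matmat (toeplitz p) X m n)
       = of_real ((pi * of_int n)\<^sup>2) * X m n + (B m n + matmat X B m n)"
proof -
  have R: "0 \<le> R"
    using order_trans[OF norm_ge_zero \<tau>[of 0]] kappa_pos[of 0] by (simp add: zero_le_mult_iff)
  \<comment> \<open>This gives \<open>(R + 2) * \<sigma> = 1 / 2\<close>, the contraction ratio on
    the antidiagonal.\<close>
  define \<sigma> where "\<sigma> = 1 / (2 * (R + 2))"
  have \<sigma>: "0 < \<sigma>" "\<sigma> \<le> 1 / 2" "2 * (R + 2) * \<sigma> \<le> 1" "(R + 1) * \<sigma> \<le> 1"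
    using R by (auto simp: \<sigma>_def divide_simps)
  \<comment> \<open>The quotient \<open>8 (R + 2) / (\<sigma> N)\<close> becomes at most \<rho>,
    hence also at most 1: one condition for both the self-map and the contraction estimate at
    generic entries.\<close>
  define N where "N = max (max N0 1) \<lceil>8 * (R + 2) / (\<sigma> * \<rho>)\<rceil>"
  have N: "0 < N" "N0 \<le> N" and N_ge: "8 * (R + 2) / (\<sigma> * \<rho>) \<le> of_int N"
    by (auto simp: N_def le_max_iff_disj) linarith
  have "8 * (R + 2) \<le> of_int N * (\<sigma> * \<rho>)"
    using N_ge \<sigma>(1) \<rho>(1) by (simp add: pos_divide_le_eq)
  then have N_le: "8 * (R + 2) / (\<sigma> * of_int N) \<le> \<rho>"
    using \<sigma>(1) N(1) by (simp add: pos_divide_le_eq mult_ac)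
  have N2: "4 * (R + 1) / (\<sigma> * of_int N) \<le> \<rho>"
  proof (rule order_trans[OF _ N_le])
    show "4 * (R + 1) / (\<sigma> * of_int N) \<le> 8 * (R + 2) / (\<sigma> * of_int N)"
      using R \<sigma>(1) N(1) by (intro divide_right_mono) auto
  qed
  obtain Yc where Yc: "\<And>x. cmod (Yc x) \<le> \<rho> * (\<lambda>(m, n). kappa (m - n)) x"
    and fixed: "(\<lambda>(m, n). block_map N \<tau> \<sigma> (curry Yc) m n) = Yc"
  proof (rule weighted_fixed_point[where \<rho>=\<rho> and \<omega>="\<lambda>(m, n). kappa (m - n)"
        and \<Phi>="\<lambda>U. \<lambda>(m, n). block_map N \<tau> \<sigma> (curry U) m n"])
    fix Y :: "int \<times> int \<Rightarrow> complex" and x :: "int \<times> int"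
    assume "\<And>x. cmod (Y x) \<le> \<rho> * (case x of (m, n) \<Rightarrow> kappa (m - n))"
    then have "decays \<rho> (curry Y)" by (auto simp: decays_def)
    from block_map_self[OF \<tau> R \<sigma>(1) _ \<sigma>(4) \<rho>(2) this N(1) N2] \<sigma>(2)
    show "cmod (case x of (m, n) \<Rightarrow> block_map N \<tau> \<sigma> (curry Y) m n) \<le> \<rho> * (case x of (m, n) \<Rightarrow> kappa (m - n))"
      by (cases x) (auto simp: decays_def curry_def)
  next
    fix Y Z :: "int \<times> int \<Rightarrow> complex" and x :: "int \<times> int" and \<delta> :: real
    assume "\<And>x. cmod (Y x) \<le> \<rho> * (case x of (m, n) \<Rightarrow> kappa (m - n))"
      "\<And>x. cmod (Z x) \<le> \<rho> * (case x of (m, n) \<Rightarrow> kappa (m - n))"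
      "\<And>x. cmod (Y x - Z x) \<le> \<delta> * (case x of (m, n) \<Rightarrow> kappa (m - n))"
    then have "decays \<rho> (curry Y)" "decays \<rho> (curry Z)" "decays \<delta> (\<lambda>m n. curry Y m n - curry Z m n)"
      by (auto simp: decays_def curry_def)
    from block_map_contraction[OF \<tau> R \<sigma>(1) _ \<sigma>(3) \<rho>(2) this N(1)] \<sigma>(2) N_le \<rho>(2)
    show "cmod ((case x of (m, n) \<Rightarrow> block_map N \<tau> \<sigma> (curry Y) m n) - (case x of (m, n) \<Rightarrow> block_map N \<tau> \<sigma> (curry Z) m n))
        \<le> \<delta> / 2 * (case x of (m, n) \<Rightarrow> kappa (m - n))"
      by (cases x) (auto simp: decays_def curry_def)
  qed (use \<rho> in auto)
  define Y where "Y = curry Yc"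
  have Y: "decays \<rho> Y" using Yc by (auto simp: decays_def Y_def)
  have fixY: "block_map N \<tau> \<sigma> Y m n = Y m n" for m n
    using fun_cong[OF fixed, of "(m, n)"] by (simp add: Y_def)
  define p where "p = block_coeff N \<tau> Y"
  define X where "X = block_X N \<sigma> Y"
  define B where "B = block_B N \<tau> \<sigma> Y"
  have \<sigma>1: "\<sigma> \<le> 1" using \<sigma>(2) by simp
  note d = block_decays[OF \<tau> R \<sigma>(1) \<sigma>1 \<rho>(2) Y, of N]
  have W: "block_W N \<tau> \<sigma> Y m n = toeplitz p m n + matmat (toeplitz p) X m n" for m n
    by (simp add: block_W_def block_PX_def p_def X_def)
  \<comment> \<open>A nonzero \<open>B k n\<close> needs k = n or both indices in the block, while X
    vanishes on the diagonal, on the antidiagonal and in the block. So \<open>X B\<close>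
    contributes nothing at the positions where X is zero by construction.\<close>
  have XB0: "matmat X B m n = 0" if "diag_pos N m n \<or> m = - n" for m n
  proof -
    have "X m k * B k n = 0" for k
      using that by (auto simp: X_def B_def block_X_def block_B_def diag_pos_def)
    then have "(\<lambda>k. X m k * B k n) = (\<lambda>k. 0)" by blast
    then show ?thesis by (simp add: matmat_def matvec_def del: mult_eq_0_iff)
  qed
  show ?thesis
  proof (rule that[of N "2 * (R + 1)" p X B])
    show "p k = 0" if "odd k" for k
      using that odd by (simp add: p_def block_coeff_def)
    show "p k = \<tau> k" if "\<bar>k\<bar> \<le> 2 * N" for k
      using that by (simp add: p_def block_coeff_def)
    show "cmod (p k) \<le> \<rho> * kappa k" if "even k" "2 * N < \<bar>k\<bar>" for k
    proof -
      have "k div 2 - - (k div 2) = k" using that by auto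
      then show ?thesis
        using that decaysD[OF Y, of "k div 2" "- (k div 2)"] by (simp add: p_def block_coeff_def)
    qed
    show "decays (2 * (R + 1)) (toeplitz p)"
      unfolding p_def using d(1) by (rule decays_mono) (use R in simp)
    show "decays (1 / 2) X"
      unfolding X_def using d(2)
      by (rule decays_mono) (use mult_mono[OF \<sigma>(2) \<rho>(2)] \<rho>(1) in auto)
    show "decays (2 * (R + 1)) B" unfolding B_def by (rule d(5))
    show "X m m = 0" "X (- m) m = 0" for m
      by (simp_all add: X_def block_X_def diag_pos_def)
    show "B m n = 0" if "\<not> diag_pos N m n" for m n
      using that by (simp add: B_def block_B_def)
    fix m n
    consider "diag_pos N m n" | "\<not> diag_pos N m n" "m = - n" | "\<not> diag_pos N m n" "m \<noteq> - n" by blast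
    then show "of_real ((pi * of_int m)\<^sup>2) * X m n + (toeplitz p m n + matmat (toeplitz p) X m n)
       = of_real ((pi * of_int n)\<^sup>2) * X m n + (B m n + matmat X B m n)"
    proof cases
      case 1
      then have "X m n = 0" by (simp add: X_def block_X_def)
      then show ?thesis using 1 XB0[of m n] W[of m n] by (simp add: B_def block_B_def)
    next
      case 2
      then have "X m n = 0" "B m n = 0" by (simp_all add: X_def block_X_def B_def block_B_def)
      moreover have "toeplitz p m n + matmat (toeplitz p) X m n = 0"
      proof -
        have "N < \<bar>n\<bar>" using 2 by (auto simp: diag_pos_def)
        moreover have "m - n = 2 * m" "n = - m" using 2 by auto
        ultimately have "toeplitz p m n = Y m n"
          unfolding toeplitz_def p_def block_coeff_def by (simp add: abs_mult)
        moreover have "Y m n = - matmat (toeplitz p) X m n"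
          using fixY[of m n] 2 by (simp add: block_map_def block_PX_def p_def X_def)
        ultimately show ?thesis by simp
      qed
      ultimately show ?thesis using 2 XB0[of m n] by simp
    next
      case 3
      define D where "D = pi\<^sup>2 * ((of_int m)\<^sup>2 - (of_int n)\<^sup>2 :: real)"
      have "D \<noteq> 0" using square_gap[OF 3] N(1) by (auto simp: D_def)
      have "X m n = of_real \<sigma> * Y m n" using 3 by (simp add: X_def block_X_def)
      also have "Y m n = (matmat X B m n - (toeplitz p m n + matmat (toeplitz p) X m n)) / of_real (\<sigma> * D)"
        using fixY[of m n] 3 by (simp add: block_map_def block_XB_def W[unfolded X_def] X_def B_def D_def mult.assoc)
      finally have XV: "X m n = of_real \<sigma> * ((matmat X B m n - (toeplitz p m n + matmat (toeplitz p) X m n)) / of_real (\<sigma> * D))" .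
      have "of_real D * (of_real \<sigma> * (V / of_real (\<sigma> * D))) = V" for V :: complex
        using \<open>D \<noteq> 0\<close> \<sigma>(1) by simp
      then have "of_real D * X m n = matmat X B m n - (toeplitz p m n + matmat (toeplitz p) X m n)"
        by (subst XV)
      moreover have "of_real D = (of_real ((pi * of_int m)\<^sup>2) - of_real ((pi * of_int n)\<^sup>2) :: complex)"
        by (simp add: D_def power_mult_distrib right_diff_distrib)
      moreover have "B m n = 0" using 3 by (simp add: B_def block_B_def)
      ultimately show ?thesis by (simp add: algebra_simps)
    qed
  qed (use R N in auto)
qed

end

section \<open>Jordan bases\<close>

text \<open>Recording only the diagonal and the superdiagonal hides the block sizes. What matters
  later is that a nonzero superdiagonal entry joins equal eigenvalues.\<close>

lemma jordan_matrix_bidiagonal: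
  fixes n_as :: "(nat \<times> 'a::comm_ring_1) list"
  defines "n \<equiv> sum_list (map fst n_as)"
  shows "\<exists>\<nu> e. (\<forall>i<n. \<forall>j<n. jordan_matrix n_as $$ (i, j)
      = (if i = j then \<nu> j else if Suc i = j then e j else 0))
    \<and> (\<forall>j. Suc j < n \<longrightarrow> e (Suc j) \<noteq> 0 \<longrightarrow> \<nu> j = \<nu> (Suc j))"
  unfolding n_def
proof (induction n_as)
  case (Cons x n_as)
  obtain k a where x: "x = (k, a)" by fastforce
  define n where "n = sum_list (map fst n_as)"
  obtain \<nu> e where J: "\<And>i j. i < n \<Longrightarrow> j < n \<Longrightarrow> jordan_matrix n_as $$ (i, j)
      = (if i = j then \<nu> j else if Suc i = j then e j else 0)"
    and \<nu>: "\<And>j. Suc j < n \<Longrightarrow> e (Suc j) \<noteq> 0 \<Longrightarrow> \<nu> j = \<nu> (Suc j)"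
    using Cons.IH unfolding n_def by blast
  define \<nu>' where "\<nu>' j = (if j < k then a else \<nu> (j - k))" for j
  \<comment> \<open>The value 0 at j = k marks the boundary between the first Jordan block and the
    rest.\<close>
  define e' where "e' j = (if j < k then 1 else if j = k then 0 else e (j - k))" for j
  have "jordan_matrix (x # n_as) $$ (i, j) = (if i = j then \<nu>' j else if Suc i = j then e' j else 0)"
    if "i < k + n" "j < k + n" for i j
  proof -
    have "jordan_matrix (x # n_as) $$ (i, j)
        = (if i < k then if j < k then jordan_block k a $$ (i, j) else 0\<^sub>m k n $$ (i, j - k)
           else if j < k then 0\<^sub>m n k $$ (i - k, j) else jordan_matrix n_as $$ (i - k, j - k))"
      unfolding x jordan_matrix_Cons n_def[symmetric]
      by (subst index_mat_four_block) (use that in \<open>auto simp: n_def\<close>)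
    then show ?thesis
      using that J[of "i - k" "j - k"] by (auto simp: \<nu>'_def e'_def Suc_diff_le)
  qed
  moreover have "\<nu>' j = \<nu>' (Suc j)" if "Suc j < k + n" "e' (Suc j) \<noteq> 0" for j
    using that \<nu>[of "j - k"] by (auto simp: \<nu>'_def e'_def Suc_diff_le split: if_splits)
  ultimately show ?case 
    by (intro exI[of _ \<nu>'] exI[of _ e'] conjI allI impI) (simp_all add: x n_def)
qed simp

text \<open>The column-wise form of \<open>A P = P J\<close>; the Jordan form exists because the
  characteristic polynomial splits over the complex numbers.\<close>

lemma jordan_basis:
  fixes F :: "nat \<Rightarrow> nat \<Rightarrow> complex" and n :: nat
  obtains Q Q' \<nu> e where
    "\<And>i j. i < n \<Longrightarrow> j < n \<Longrightarrow> (\<Sum>k<n. Q i k * Q' k j) = (if i = j then 1 else 0)"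
    "\<And>i j. i < n \<Longrightarrow> j < n \<Longrightarrow> (\<Sum>k<n. Q' i k * Q k j) = (if i = j then 1 else 0)"
    "\<And>i j. i < n \<Longrightarrow> j < n \<Longrightarrow>
       (\<Sum>k<n. F i k * Q k j) = \<nu> j * Q i j + (if j = 0 then 0 else e j * Q i (j - 1))"
    "\<And>j. Suc j < n \<Longrightarrow> e (Suc j) \<noteq> 0 \<Longrightarrow> \<nu> j = \<nu> (Suc j)"
proof -
  define A where "A = mat n n (\<lambda>(i, j). F i j)"
  have A: "A \<in> carrier_mat n n" by (simp add: A_def)
  obtain as where "char_poly A = (\<Prod>a\<leftarrow>as. [:- a, 1:])"
    using char_poly_factorized[OF A] by blast
  from jordan_nf_exists[OF A this] obtain n_as where "jordan_nf A n_as" by blast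
  then obtain P P' where "similar_mat_wit A (jordan_matrix n_as) P P'"
    by (auto simp: jordan_nf_def similar_mat_def)
  define J where "J = jordan_matrix n_as"
  have J: "J \<in> carrier_mat n n" and P: "P \<in> carrier_mat n n" and P': "P' \<in> carrier_mat n n"
    and PP': "P * P' = 1\<^sub>m n" "P' * P = 1\<^sub>m n" and APJ: "A = P * J * P'"
    using \<open>similar_mat_wit A (jordan_matrix n_as) P P'\<close> A
    by (auto simp: similar_mat_wit_def Let_def J_def)
  have AP: "A * P = P * J"
  proof -
    have "A * P = P * J * (P' * P)"
      unfolding APJ by (rule assoc_mult_mat[OF mult_carrier_mat[OF P J] P' P])
    then show ?thesis using PP' right_mult_one_mat[OF mult_carrier_mat[OF P J]] by simp
  qed
  have "n = sum_list (map fst n_as)"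
    using carrier_matD(1)[OF J] by (simp add: J_def)
  then obtain \<nu> e where Jij: "\<And>i j. i < n \<Longrightarrow> j < n \<Longrightarrow> J $$ (i, j)
      = (if i = j then \<nu> j else if Suc i = j then e j else 0)"
    and \<nu>: "\<And>j. Suc j < n \<Longrightarrow> e (Suc j) \<noteq> 0 \<Longrightarrow> \<nu> j = \<nu> (Suc j)"
    using jordan_matrix_bidiagonal[of n_as] unfolding J_def by blast
  have mult: "(\<Sum>k<n. U $$ (i, k) * V $$ (k, j)) = (U * V) $$ (i, j)"
    if "U \<in> carrier_mat n n" "V \<in> carrier_mat n n" "i < n" "j < n" for U V :: "complex mat" and i j
    using that by (simp add: scalar_prod_def atLeast0LessThan)
  show ?thesis
  proof (rule that[of "\<lambda>i j. P $$ (i, j)" "\<lambda>i j. P' $$ (i, j)" \<nu> e])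
    fix i j assume ij: "i < n" "j < n"
    show "(\<Sum>k<n. P $$ (i, k) * P' $$ (k, j)) = (if i = j then 1 else 0)"
      using mult[OF P P' ij] PP'(1) ij by simp
    show "(\<Sum>k<n. P' $$ (i, k) * P $$ (k, j)) = (if i = j then 1 else 0)"
      using mult[OF P' P ij] PP'(2) ij by simp
    have "(\<Sum>k<n. F i k * P $$ (k, j)) = (\<Sum>k<n. A $$ (i, k) * P $$ (k, j))"
      using ij by (intro sum.cong) (auto simp: A_def)
    also have "\<dots> = (\<Sum>k<n. P $$ (i, k) * J $$ (k, j))"
      using mult[OF A P ij] mult[OF P J ij] AP by simp
    also have "\<dots> = (\<Sum>k<n. (if k = j then \<nu> j * P $$ (i, j) else 0)
        + (if Suc k = j then e j * P $$ (i, k) else 0))"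
      using ij by (intro sum.cong) (auto simp: Jij)
    also have "\<dots> = \<nu> j * P $$ (i, j) + (\<Sum>k<n. if Suc k = j then e j * P $$ (i, k) else 0)"
      using ij by (simp add: sum.distrib)
    also have "(\<Sum>k<n. if Suc k = j then e j * P $$ (i, k) else 0)
        = (if j = 0 then 0 else e j * P $$ (i, j - 1))"
      using ij by (cases j) auto
    finally show "(\<Sum>k<n. F i k * P $$ (k, j))
        = \<nu> j * P $$ (i, j) + (if j = 0 then 0 else e j * P $$ (i, j - 1))" .
  qed (use \<nu> in auto)
qed

lemma jordan_basis_int:
  fixes F :: "int \<Rightarrow> int \<Rightarrow> complex" and N :: int
  assumes N: "0 \<le> N"
  obtains Q Q' \<nu> e where
    "\<And>i j. \<bar>i\<bar> \<le> N \<Longrightarrow> \<bar>j\<bar> \<le> N \<Longrightarrow> (\<Sum>k\<in>{-N..N}. Q i k * Q' k j) = (if i = j then 1 else 0)"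
    "\<And>i j. \<bar>i\<bar> \<le> N \<Longrightarrow> \<bar>j\<bar> \<le> N \<Longrightarrow> (\<Sum>k\<in>{-N..N}. Q' i k * Q k j) = (if i = j then 1 else 0)"
    "\<And>i j. \<bar>i\<bar> \<le> N \<Longrightarrow> \<bar>j\<bar> \<le> N \<Longrightarrow>
       (\<Sum>k\<in>{-N..N}. F i k * Q k j) = \<nu> j * Q i j + e j * Q i (j - 1)"
    "\<And>j. \<bar>j\<bar> \<le> N \<Longrightarrow> e j \<noteq> 0 \<Longrightarrow> - N < j \<and> \<nu> (j - 1) = \<nu> j"
proof -
  define n where "n = nat (2 * N + 1)"
  define G where "G i j = F (int i - N) (int j - N)" for i j
  obtain Q Q' \<nu> e where Q:
    "\<And>i j. i < n \<Longrightarrow> j < n \<Longrightarrow> (\<Sum>k<n. Q i k * Q' k j) = (if i = j then 1 else 0)"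
    "\<And>i j. i < n \<Longrightarrow> j < n \<Longrightarrow> (\<Sum>k<n. Q' i k * Q k j) = (if i = j then 1 else 0)"
    "\<And>i j. i < n \<Longrightarrow> j < n \<Longrightarrow>
       (\<Sum>k<n. G i k * Q k j) = \<nu> j * Q i j + (if j = 0 then 0 else e j * Q i (j - 1))"
    "\<And>j. Suc j < n \<Longrightarrow> e (Suc j) \<noteq> 0 \<Longrightarrow> \<nu> j = \<nu> (Suc j)"
    using jordan_basis[of n G] by blast
  define h where "h i = nat (i + N)" for i
  have h: "h i < n" "int (h i) - N = i" if "\<bar>i\<bar> \<le> N" for i
    using that by (auto simp: h_def n_def)
  have h_eq: "h i = h j \<longleftrightarrow> i = j" if "\<bar>i\<bar> \<le> N" "\<bar>j\<bar> \<le> N" for i j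
    using that by (auto simp: h_def)
  have sum_h: "(\<Sum>k\<in>{-N..N}. f (h k)) = (\<Sum>k<n. f k)" for f :: "nat \<Rightarrow> complex"
    by (rule sum.reindex_bij_betw[of h], rule bij_betwI[where g="\<lambda>k. int k - N"])
      (auto simp: h_def n_def)
  \<comment> \<open>At the left end -N there is no preceding column, so e is set to 0 there; this
    makes the column \<open>j - 1\<close> meaningful wherever e is nonzero.\<close>
  show ?thesis
  proof (rule that[of "\<lambda>i j. Q (h i) (h j)" "\<lambda>i j. Q' (h i) (h j)" "\<lambda>j. \<nu> (h j)"
        "\<lambda>j. if j = - N then 0 else e (h j)"])
    fix i j assume ij: "\<bar>i\<bar> \<le> N" "\<bar>j\<bar> \<le> N"
    show "(\<Sum>k\<in>{-N..N}. Q (h i) (h k) * Q' (h k) (h j)) = (if i = j then 1 else 0)"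
      using sum_h[of "\<lambda>k. Q (h i) k * Q' k (h j)"] Q(1) h(1) ij h_eq by simp
    show "(\<Sum>k\<in>{-N..N}. Q' (h i) (h k) * Q (h k) (h j)) = (if i = j then 1 else 0)"
      using sum_h[of "\<lambda>k. Q' (h i) k * Q k (h j)"] Q(2) h(1) ij h_eq by simp
    have "(\<Sum>k\<in>{-N..N}. F i k * Q (h k) (h j)) = (\<Sum>k\<in>{-N..N}. G (h i) (h k) * Q (h k) (h j))"
      using ij h(2) by (intro sum.cong) (auto simp: G_def abs_le_iff)
    also have "\<dots> = \<nu> (h j) * Q (h i) (h j) + (if h j = 0 then 0 else e (h j) * Q (h i) (h j - 1))"
      using sum_h[of "\<lambda>k. G (h i) k * Q k (h j)"] Q(3) h(1) ij by simp
    also have "(if h j = 0 then 0 else e (h j) * Q (h i) (h j - 1))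
        = (if j = - N then 0 else e (h j)) * Q (h i) (h (j - 1))"
      using ij by (auto simp: h_def nat_diff_distrib' algebra_simps)
    finally show "(\<Sum>k\<in>{-N..N}. F i k * Q (h k) (h j))
        = \<nu> (h j) * Q (h i) (h j) + (if j = - N then 0 else e (h j)) * Q (h i) (h (j - 1))" .
  next
    fix j assume j: "\<bar>j\<bar> \<le> N" "(if j = - N then 0 else e (h j)) \<noteq> 0"
    then have "- N < j" "e (h j) \<noteq> 0" by (auto split: if_splits)
    moreover have "h j = Suc (h (j - 1))" using \<open>- N < j\<close> by (auto simp: h_def)
    ultimately show "- N < j \<and> \<nu> (h (j - 1)) = \<nu> (h j)"
      using Q(4)[of "h (j - 1)"] h(1)[OF j(1)] by auto
  qed
qed

section \<open>Root spaces on the Fourier side\<close>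

definition hill_seq :: "(int \<Rightarrow> complex) \<Rightarrow> (int \<Rightarrow> complex) \<Rightarrow> int \<Rightarrow> complex" where
  "hill_seq p c m = of_real ((pi * of_int m)\<^sup>2) * c m + matvec (toeplitz p) c m"

text \<open>The domain of the operator on the Fourier side. Root functions turn out to have a
  continuous second derivative, so \<open>(pi m)^2 c m\<close> is bounded; a condition of supremum
  type also fits the weighted contraction estimates.\<close>

definition omega_bounded :: "(int \<Rightarrow> complex) \<Rightarrow> bool" where
  "omega_bounded c \<longleftrightarrow> (\<exists>C. \<forall>m. cmod (c m) \<le> C * omega m)"

primrec root_seq :: "(int \<Rightarrow> complex) \<Rightarrow> complex \<Rightarrow> nat \<Rightarrow> (int \<Rightarrow> complex) set" where
  "root_seq p \<mu> 0 = {\<lambda>m. 0}"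
| "root_seq p \<mu> (Suc k) =
    {c. omega_bounded c \<and> (\<exists>g\<in>root_seq p \<mu> k. \<forall>m. hill_seq p c m = \<mu> * c m + g m)}"

lemma omega_boundedE:
  assumes "omega_bounded c"
  obtains C where "0 \<le> C" "\<And>m. cmod (c m) \<le> C * omega m"
proof -
  from assms obtain C where C: "\<And>m. cmod (c m) \<le> C * omega m"
    by (auto simp: omega_bounded_def)
  have "0 \<le> C" using order_trans[OF norm_ge_zero C[of 0]] by simp
  then show ?thesis using C that by blast
qed

lemma omega_bounded_add:
  assumes "omega_bounded a" "omega_bounded b" shows "omega_bounded (\<lambda>m. a m + b m)"
proof -
  obtain C D where "\<And>m. cmod (a m) \<le> C * omega m" "\<And>m. cmod (b m) \<le> D * omega m"
    using assms by (meson omega_boundedE)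
  then have "cmod (a m + b m) \<le> (C + D) * omega m" for m
    by (metis add_mono distrib_right norm_triangle_le)
  then show ?thesis by (auto simp: omega_bounded_def)
qed

lemma omega_bounded_scale:
  assumes "omega_bounded a" shows "omega_bounded (\<lambda>m. z * a m)"
proof -
  obtain C where "\<And>m. cmod (a m) \<le> C * omega m"
    using assms by (meson omega_boundedE)
  then have "cmod (z * a m) \<le> (cmod z * C) * omega m" for m
    by (simp add: norm_mult mult_left_mono mult.assoc)
  then show ?thesis by (auto simp: omega_bounded_def)
qed

lemma omega_bounded_diff:
  assumes "omega_bounded a" "omega_bounded b" shows "omega_bounded (\<lambda>m. a m - b m)"
  using omega_bounded_add[OF assms(1) omega_bounded_scale[OF assms(2), of "-1"]] by simp

lemma omega_bounded_sum:
  assumes "\<And>j. j \<in> J \<Longrightarrow> omega_bounded (f j)" shows "omega_bounded (\<lambda>m. \<Sum>j\<in>J. f j m)"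
  using assms
proof (induction J rule: infinite_finite_induct)
  case (insert j J)
  then show ?case using omega_bounded_add[of "f j" "\<lambda>m. \<Sum>j\<in>J. f j m"] by simp
qed (auto simp: omega_bounded_def intro!: exI[of _ 0])

lemma omega_bounded_change_finite:
  assumes "omega_bounded a" "finite F" "\<And>m. m \<notin> F \<Longrightarrow> b m = a m"
  shows "omega_bounded b"
proof -
  obtain C where C: "0 \<le> C" "\<And>m. cmod (a m) \<le> C * omega m"
    using assms(1) by (meson omega_boundedE)
  define D where "D = (\<Sum>m\<in>F. cmod (b m) / omega m)"
  have "0 \<le> D" by (auto simp: D_def intro!: sum_nonneg)
  have "cmod (b m) \<le> (C + D) * omega m" for m
  proof (cases "m \<in> F")
    case True
    have "cmod (b m) / omega m \<le> D"
      unfolding D_def using True assms(2) by (intro member_le_sum) auto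
    then have "cmod (b m) \<le> D * omega m" using omega_pos[of m] by (simp add: pos_divide_le_eq)
    also have "\<dots> \<le> (C + D) * omega m" using C(1) by (intro mult_right_mono) auto
    finally show ?thesis .
  next
    case False
    then have "cmod (b m) \<le> C * omega m" using C(2) assms(3) by simp
    also have "\<dots> \<le> (C + D) * omega m" using \<open>0 \<le> D\<close> by (intro mult_right_mono) auto
    finally show ?thesis .
  qed
  then show ?thesis by (auto simp: omega_bounded_def)
qed

lemma hill_seq_scale: "hill_seq p (\<lambda>m. z * c m) m = z * hill_seq p c m"
  by (simp add: hill_seq_def matvec_scale algebra_simps)

lemma root_seq_omega_bounded: "c \<in> root_seq p \<mu> k \<Longrightarrow> omega_bounded c"
  by (cases k) (auto simp: omega_bounded_def intro!: exI[of _ 0])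

lemma root_seq_scale: "c \<in> root_seq p \<mu> k \<Longrightarrow> (\<lambda>m. z * c m) \<in> root_seq p \<mu> k"
proof (induction k arbitrary: c)
  case (Suc k)
  then obtain g where g: "g \<in> root_seq p \<mu> k" "\<And>m. hill_seq p c m = \<mu> * c m + g m"
    and c: "omega_bounded c" by auto
  have "(\<lambda>m. z * g m) \<in> root_seq p \<mu> k" by (rule Suc.IH[OF g(1)])
  then show ?case
    using omega_bounded_scale[OF c] g(2)
    by (auto simp: hill_seq_scale algebra_simps intro!: bexI[of _ "\<lambda>m. z * g m"])
qed auto

definition unit_seq :: "int \<Rightarrow> int \<Rightarrow> complex" where
  "unit_seq n m = (if m = n then 1 else 0)"

lemma omega_bounded_finite_support:
  assumes "finite J" shows "omega_bounded (\<lambda>m. if m \<in> J then a m else 0)"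
proof (rule omega_bounded_change_finite[OF _ assms])
  show "omega_bounded (\<lambda>_. 0)" by (auto simp: omega_bounded_def intro!: exI[of _ 0])
qed simp

lemma omega_bounded_unit: "omega_bounded (unit_seq n)"
  by (rule omega_bounded_change_finite[of "\<lambda>_. 0" "{n}"])
    (auto simp: unit_seq_def omega_bounded_def intro!: exI[of _ 0])

lemma matvec_finite:
  assumes "finite J" "\<And>k. k \<notin> J \<Longrightarrow> A m k * c k = 0"
  shows "matvec A c m = (\<Sum>k\<in>J. A m k * c k)"
proof -
  have "matvec A c m = (\<Sum>\<^sub>\<infinity>k\<in>J. A m k * c k)"
    unfolding matvec_def using assms(2) by (intro infsum_cong_neutral) auto
  then show ?thesis using assms(1) by simp
qed

lemma matvec_unit: "matvec A (unit_seq n) m = A m n"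
  by (subst matvec_finite[of "{n}"]) (auto simp: unit_seq_def)

section \<open>The similarity I + X between Hill's operator and D + B\<close>

locale diagonalized = decay +
  fixes N :: int and p :: "int \<Rightarrow> complex" and X B :: "int \<Rightarrow> int \<Rightarrow> complex" and S :: real
  assumes N_pos: "0 < N"
    and P_decays: "decays S (toeplitz p)" and X_decays: "decays (1 / 2) X" and B_decays: "decays S B"
    and X_diag: "X m m = 0" and X_antidiag: "X (- m) m = 0"
    and B_off: "\<not> diag_pos N m n \<Longrightarrow> B m n = 0"
    and intertwine: "of_real ((pi * of_int m)\<^sup>2) * X m n + (toeplitz p m n + matmat (toeplitz p) X m n)
       = of_real ((pi * of_int n)\<^sup>2) * X m n + (B m n + matmat X B m n)"
begin

definition sim :: "(int \<Rightarrow> complex) \<Rightarrow> int \<Rightarrow> complex" where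
  "sim a m = a m + matvec X a m"

text \<open>The equation \<open>a = c - X a\<close> contracts with ratio 1/2, and the radius
  \<open>2 C\<close> is preserved because \<open>C + (1 / 2) (2 C) = 2 C\<close>.\<close>

lemma sim_surj:
  assumes "omega_bounded c" obtains a where "omega_bounded a" "sim a = c"
proof -
  obtain C where C: "0 \<le> C" "\<And>m. cmod (c m) \<le> C * omega m"
    using assms by (meson omega_boundedE)
  obtain a where a: "\<And>m. cmod (a m) \<le> 2 * C * omega m" "(\<lambda>m. c m - matvec X a m) = a"
  proof (rule weighted_fixed_point[where \<rho>="2 * C" and \<omega>=omega and \<Phi>="\<lambda>a m. c m - matvec X a m"])
    fix Y :: "int \<Rightarrow> complex" and m
    assume "\<And>m. cmod (Y m) \<le> 2 * C * omega m"
    then have "cmod (matvec X Y m) \<le> C * omega m"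
      using matvec_bound[OF X_decays admissible_omega, of Y "2 * C"] by simp
    then show "cmod (c m - matvec X Y m) \<le> 2 * C * omega m"
      using norm_triangle_ineq4[of "c m" "matvec X Y m"] C(2)[of m] by simp
  next
    fix Y Z :: "int \<Rightarrow> complex" and m \<delta>
    assume *: "\<And>m. cmod (Y m) \<le> 2 * C * omega m" "\<And>m. cmod (Z m) \<le> 2 * C * omega m"
      "\<And>m. cmod (Y m - Z m) \<le> \<delta> * omega m"
    have "cmod (matvec X (\<lambda>m. Y m - Z m) m) \<le> \<delta> / 2 * omega m"
      using matvec_bound[OF X_decays admissible_omega *(3), of m] by simp
    then show "cmod (c m - matvec X Y m - (c m - matvec X Z m)) \<le> \<delta> / 2 * omega m"
      using matvec_diff[OF X_decays admissible_omega *(1,2), of m] by (simp add: norm_minus_commute)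
  qed (use C in auto)
  have "sim a m = c m" for m
    using fun_cong[OF a(2), of m] by (simp add: sim_def algebra_simps)
  then show ?thesis using a(1) that[of a] by (auto simp: omega_bounded_def)
qed

text \<open>From \<open>u = - X u\<close> every bound for u can be halved. Injectivity is stated for
  all bounded sequences because \<open>D a\<close> is only bounded when a lies in the
  domain.\<close>

lemma sim_inj:
  assumes "\<And>m. cmod (u m) \<le> C" "\<And>m. sim u m = 0" shows "u m = 0"
proof -
  have bd: "cmod (u m) \<le> C * (1 / 2) ^ k" for k m
  proof (induction k arbitrary: m)
    case (Suc k)
    have "cmod (u m) = cmod (matvec X u m)"
      using assms(2)[of m] by (simp add: sim_def add_eq_0_iff norm_minus_commute)
    also have "\<dots> \<le> 1 / 2 * (C * (1 / 2) ^ k) * 1"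
      by (rule matvec_bound[OF X_decays admissible_1]) (use Suc in simp)
    finally show ?case by simp
  qed (use assms(1) in simp)
  have "(\<lambda>k. C * (1 / 2) ^ k) \<longlonglongrightarrow> 0"
    by (intro tendsto_mult_right_zero LIMSEQ_power_zero) simp
  then have "cmod (u m) \<le> 0"
    by (rule tendsto_lowerbound) (auto simp: bd)
  then show ?thesis by simp
qed

definition blop :: "(int \<Rightarrow> complex) \<Rightarrow> int \<Rightarrow> complex" where
  "blop a m = of_real ((pi * of_int m)\<^sup>2) * a m + matvec B a m"

lemma square_omega_le: "(of_int m)\<^sup>2 * omega m \<le> 1"
  by (simp add: omega_def divide_le_eq_1 add_pos_nonneg)

lemma square_mult_bounded:
  assumes "0 \<le> C" "\<And>m. cmod (a m) \<le> C * omega m"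
  shows "cmod (of_real ((pi * of_int m)\<^sup>2) * a m) \<le> pi\<^sup>2 * C"
proof -
  have "cmod (of_real ((pi * of_int m)\<^sup>2) * a m) = (pi * of_int m)\<^sup>2 * cmod (a m)"
    by (simp only: norm_mult norm_of_real abs_power2)
  also have "\<dots> \<le> (pi * of_int m)\<^sup>2 * (C * omega m)"
    by (intro mult_left_mono assms) auto
  also have "\<dots> = pi\<^sup>2 * C * ((of_int m)\<^sup>2 * omega m)" by (simp add: power_mult_distrib)
  also have "\<dots> \<le> pi\<^sup>2 * C * 1"
    using square_omega_le assms(1) by (intro mult_left_mono) auto
  finally show ?thesis by simp
qed

lemma omega_bound_le: "0 \<le> C \<Longrightarrow> cmod z \<le> C * omega m \<Longrightarrow> cmod z \<le> C * 1"
  using mult_left_mono[OF omega_le_1[of m], of C] by simp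

text \<open>The identity \<open>intertwine\<close> is summed against a. The unbounded D never has to
  map the sequence \<open>X a\<close> to a bounded one: on the left it multiplies row m as a scalar,
  on the right it acts on a, where the result is bounded.\<close>

lemma hill_sim:
  assumes "omega_bounded a" shows "hill_seq p (sim a) m = sim (blop a) m"
proof -
  obtain C where C: "0 \<le> C" "\<And>m. cmod (a m) \<le> C * omega m"
    using assms by (meson omega_boundedE)
  have C1: "cmod (a m) \<le> C * 1" for m by (rule omega_bound_le[OF C])
  define D where "D n = of_real ((pi * of_int n)\<^sup>2) * a n" for n
  have D: "cmod (D n) \<le> pi\<^sup>2 * C * 1" for n
    unfolding D_def using square_mult_bounded[OF C] by simp
  have Xa: "cmod (matvec X a k) \<le> 1 / 2 * C * 1" for k
    by (rule matvec_bound[OF X_decays admissible_1 C1])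
  have Ba: "cmod (matvec B a k) \<le> S * C * 1" for k
    by (rule matvec_bound[OF B_decays admissible_1 C1])
  have PX: "decays (S * (1 / 2)) (matmat (toeplitz p) X)" by (rule matmat_decays[OF P_decays X_decays])
  have XB: "decays (1 / 2 * S) (matmat X B)" by (rule matmat_decays[OF X_decays B_decays])
  have matvec_left: "of_real ((pi * of_int m)\<^sup>2) * matvec X a m + (matvec (toeplitz p) a m + matvec (matmat (toeplitz p) X) a m)
      = (\<Sum>\<^sub>\<infinity>n. (of_real ((pi * of_int m)\<^sup>2) * X m n + (toeplitz p m n + matmat (toeplitz p) X m n)) * a n)"
  proof -
    have s: "(\<lambda>n. X m n * a n) summable_on UNIV" by (rule matvec_summable[OF X_decays admissible_1 C1])
    have t: "(\<lambda>n. (toeplitz p m n + matmat (toeplitz p) X m n) * a n) summable_on UNIV"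
      by (rule matvec_summable[OF decays_add[OF P_decays PX] admissible_1 C1])
    have "matvec (toeplitz p) a m + matvec (matmat (toeplitz p) X) a m = (\<Sum>\<^sub>\<infinity>n. (toeplitz p m n + matmat (toeplitz p) X m n) * a n)"
      using matvec_add_left[OF P_decays PX admissible_1 C1, where m=m] by (simp add: matvec_def)
    moreover have "of_real ((pi * of_int m)\<^sup>2) * matvec X a m = (\<Sum>\<^sub>\<infinity>n. of_real ((pi * of_int m)\<^sup>2) * (X m n * a n))"
      unfolding matvec_def by (rule infsum_cmult_right'[symmetric])
    ultimately show ?thesis
      using infsum_add[OF summable_on_cmult_right[OF s] t, of "of_real ((pi * of_int m)\<^sup>2)"]
      by (simp add: algebra_simps)
  qed
  have matvec_right: "matvec X D m + (matvec B a m + matvec (matmat X B) a m)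
      = (\<Sum>\<^sub>\<infinity>n. (of_real ((pi * of_int n)\<^sup>2) * X m n + (B m n + matmat X B m n)) * a n)"
  proof -
    have s: "(\<lambda>n. X m n * D n) summable_on UNIV" by (rule matvec_summable[OF X_decays admissible_1 D])
    have t: "(\<lambda>n. (B m n + matmat X B m n) * a n) summable_on UNIV"
      by (rule matvec_summable[OF decays_add[OF B_decays XB] admissible_1 C1])
    have "matvec B a m + matvec (matmat X B) a m = (\<Sum>\<^sub>\<infinity>n. (B m n + matmat X B m n) * a n)"
      using matvec_add_left[OF B_decays XB admissible_1 C1, where m=m] by (simp add: matvec_def)
    then show ?thesis
      using infsum_add[OF s t] unfolding matvec_def D_def by (simp add: algebra_simps)
  qed
  have "hill_seq p (sim a) m = D m
      + (of_real ((pi * of_int m)\<^sup>2) * matvec X a m + (matvec (toeplitz p) a m + matvec (matmat (toeplitz p) X) a m))"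
    unfolding hill_seq_def sim_def matvec_add[OF P_decays admissible_1 C1 Xa]
      matvec_matvec[OF P_decays X_decays admissible_1 C1] by (simp add: D_def algebra_simps)
  also have "\<dots> = D m + (matvec X D m + (matvec B a m + matvec (matmat X B) a m))"
    unfolding matvec_left matvec_right intertwine ..
  also have "\<dots> = (D m + matvec B a m) + matvec X (\<lambda>k. D k + matvec B a k) m"
    unfolding matvec_add[OF X_decays admissible_1 D Ba] matvec_matvec[OF X_decays B_decays admissible_1 C1]
    by (simp add: algebra_simps)
  also have "(\<lambda>k. D k + matvec B a k) = blop a"
    by (simp add: fun_eq_iff blop_def D_def)
  finally show ?thesis unfolding sim_def .
qed

lemma blop_high:
  assumes "N < \<bar>m\<bar>" shows "blop a m = (of_real ((pi * of_int m)\<^sup>2) + B m m) * a m"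
proof -
  have "matvec B a m = B m m * a m"
    by (subst matvec_finite[of "{m}"]) (use assms B_off in \<open>auto simp: diag_pos_def\<close>)
  then show ?thesis by (simp add: blop_def algebra_simps)
qed

lemma blop_low:
  assumes "\<bar>m\<bar> \<le> N"
  shows "blop a m = (\<Sum>k\<in>{-N..N}. ((if m = k then of_real ((pi * of_int m)\<^sup>2) else 0) + B m k) * a k)"
proof -
  have "matvec B a m = (\<Sum>k\<in>{-N..N}. B m k * a k)"
    using assms B_off by (intro matvec_finite) (auto simp: diag_pos_def)
  moreover have "(\<Sum>k\<in>{-N..N}. (if m = k then of_real ((pi * of_int m)\<^sup>2) else 0) * a k)
      = of_real ((pi * of_int m)\<^sup>2) * a m"
    using assms by (subst sum.mono_neutral_right[of _ "{m}"]) auto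
  ultimately show ?thesis
    by (simp add: blop_def distrib_right sum.distrib)
qed

lemma low_jordan:
  obtains Q Q' \<nu> e where
    "\<And>i j. \<bar>i\<bar> \<le> N \<Longrightarrow> \<bar>j\<bar> \<le> N \<Longrightarrow> (\<Sum>k\<in>{-N..N}. Q i k * Q' k j) = (if i = j then 1 else 0)"
    "\<And>i j. \<bar>i\<bar> \<le> N \<Longrightarrow> \<bar>j\<bar> \<le> N \<Longrightarrow> (\<Sum>k\<in>{-N..N}. Q' i k * Q k j) = (if i = j then 1 else 0)"
    "\<And>i j. \<bar>i\<bar> \<le> N \<Longrightarrow> \<bar>j\<bar> \<le> N \<Longrightarrow>
       (\<Sum>k\<in>{-N..N}. ((if i = k then of_real ((pi * of_int i)\<^sup>2) else 0) + B i k) * Q k j)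
       = \<nu> j * Q i j + e j * Q i (j - 1)"
    "\<And>j. \<bar>j\<bar> \<le> N \<Longrightarrow> e j \<noteq> 0 \<Longrightarrow> - N < j \<and> \<nu> (j - 1) = \<nu> j"
    "\<And>j. N < \<bar>j\<bar> \<Longrightarrow> \<nu> j = of_real ((pi * of_int j)\<^sup>2) + B j j"
    "\<And>j. N < \<bar>j\<bar> \<Longrightarrow> e j = 0"
proof -
  define F where "F i k = (if i = k then of_real ((pi * of_int i)\<^sup>2) else 0) + B i k" for i k
  obtain Q Q' \<nu> e where Q:
    "\<And>i j. \<bar>i\<bar> \<le> N \<Longrightarrow> \<bar>j\<bar> \<le> N \<Longrightarrow> (\<Sum>k\<in>{-N..N}. Q i k * Q' k j) = (if i = j then 1 else 0)"
    "\<And>i j. \<bar>i\<bar> \<le> N \<Longrightarrow> \<bar>j\<bar> \<le> N \<Longrightarrow> (\<Sum>k\<in>{-N..N}. Q' i k * Q k j) = (if i = j then 1 else 0)"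
    "\<And>i j. \<bar>i\<bar> \<le> N \<Longrightarrow> \<bar>j\<bar> \<le> N \<Longrightarrow> (\<Sum>k\<in>{-N..N}. F i k * Q k j) = \<nu> j * Q i j + e j * Q i (j - 1)"
    "\<And>j. \<bar>j\<bar> \<le> N \<Longrightarrow> e j \<noteq> 0 \<Longrightarrow> - N < j \<and> \<nu> (j - 1) = \<nu> j"
    using jordan_basis_int[OF less_imp_le[OF N_pos], of F] by blast
  show ?thesis
  proof (rule that[of Q Q' "\<lambda>j. if \<bar>j\<bar> \<le> N then \<nu> j else of_real ((pi * of_int j)\<^sup>2) + B j j"
          "\<lambda>j. if \<bar>j\<bar> \<le> N then e j else 0"])
    fix i j assume ij: "\<bar>i\<bar> \<le> N" "\<bar>j\<bar> \<le> N"
    show "(\<Sum>k\<in>{-N..N}. Q i k * Q' k j) = (if i = j then 1 else 0)" using ij by (rule Q(1))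
    show "(\<Sum>k\<in>{-N..N}. Q' i k * Q k j) = (if i = j then 1 else 0)" using ij by (rule Q(2))
    show "(\<Sum>k\<in>{-N..N}. ((if i = k then of_real ((pi * of_int i)\<^sup>2) else 0) + B i k) * Q k j)
       = (if \<bar>j\<bar> \<le> N then \<nu> j else of_real ((pi * of_int j)\<^sup>2) + B j j) * Q i j
         + (if \<bar>j\<bar> \<le> N then e j else 0) * Q i (j - 1)"
      using Q(3)[OF ij] ij(2) by (simp only: F_def if_True)
  next
    fix j assume j: "\<bar>j\<bar> \<le> N" "(if \<bar>j\<bar> \<le> N then e j else 0) \<noteq> 0"
    then have "- N < j \<and> \<nu> (j - 1) = \<nu> j" using Q(4)[of j] by simp
    moreover have "\<bar>j - 1\<bar> \<le> N" using calculation j(1) by linarith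
    ultimately show "- N < j \<and> (if \<bar>j - 1\<bar> \<le> N then \<nu> (j - 1) else of_real ((pi * of_int (j - 1))\<^sup>2) + B (j - 1) (j - 1))
        = (if \<bar>j\<bar> \<le> N then \<nu> j else of_real ((pi * of_int j)\<^sup>2) + B j j)"
      using j(1) by (simp only: if_True)
  qed auto
qed

end

section \<open>Jordan coordinates for Hill's operator\<close>

locale jordan_diagonalized = diagonalized +
  fixes Q Q' :: "int \<Rightarrow> int \<Rightarrow> complex" and \<nu> e :: "int \<Rightarrow> complex"
  assumes QQ': "\<bar>i\<bar> \<le> N \<Longrightarrow> \<bar>j\<bar> \<le> N \<Longrightarrow> (\<Sum>k\<in>{-N..N}. Q i k * Q' k j) = (if i = j then 1 else 0)"
    and Q'Q: "\<bar>i\<bar> \<le> N \<Longrightarrow> \<bar>j\<bar> \<le> N \<Longrightarrow> (\<Sum>k\<in>{-N..N}. Q' i k * Q k j) = (if i = j then 1 else 0)"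
    and FQ: "\<bar>i\<bar> \<le> N \<Longrightarrow> \<bar>j\<bar> \<le> N \<Longrightarrow>
       (\<Sum>k\<in>{-N..N}. ((if i = k then of_real ((pi * of_int i)\<^sup>2) else 0) + B i k) * Q k j)
       = \<nu> j * Q i j + e j * Q i (j - 1)"
    and e_low: "\<bar>j\<bar> \<le> N \<Longrightarrow> e j \<noteq> 0 \<Longrightarrow> - N < j \<and> \<nu> (j - 1) = \<nu> j"
    and \<nu>_high: "N < \<bar>j\<bar> \<Longrightarrow> \<nu> j = of_real ((pi * of_int j)\<^sup>2) + B j j"
    and e_high: "N < \<bar>j\<bar> \<Longrightarrow> e j = 0"
begin

definition low_op :: "(int \<Rightarrow> int \<Rightarrow> complex) \<Rightarrow> (int \<Rightarrow> complex) \<Rightarrow> int \<Rightarrow> complex" where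
  "low_op U a m = (if \<bar>m\<bar> \<le> N then \<Sum>k\<in>{-N..N}. U m k * a k else a m)"

lemma low_op_inverse:
  assumes "\<And>i j. \<bar>i\<bar> \<le> N \<Longrightarrow> \<bar>j\<bar> \<le> N \<Longrightarrow> (\<Sum>k\<in>{-N..N}. U i k * V k j) = (if i = j then 1 else 0)"
  shows "low_op U (low_op V a) = a"
proof
  fix m
  show "low_op U (low_op V a) m = a m"
  proof (cases "\<bar>m\<bar> \<le> N")
    case True
    have "low_op U (low_op V a) m = (\<Sum>k\<in>{-N..N}. U m k * (\<Sum>j\<in>{-N..N}. V k j * a j))"
      using True by (auto simp: low_op_def intro!: sum.cong)
    also have "\<dots> = (\<Sum>j\<in>{-N..N}. (\<Sum>k\<in>{-N..N}. U m k * V k j) * a j)"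
      unfolding sum_distrib_left sum_distrib_right by (subst sum.swap) (simp add: mult.assoc)
    also have "\<dots> = (\<Sum>j\<in>{-N..N}. (if m = j then 1 else 0) * a j)"
      using True assms by (intro sum.cong) auto
    also have "\<dots> = a m"
      using True by (subst sum.mono_neutral_right[of _ "{m}"]) auto
    finally show ?thesis .
  qed (auto simp: low_op_def)
qed

lemma low_op_QQ': "low_op Q (low_op Q' a) = a"
  by (rule low_op_inverse) (rule QQ')

lemma low_op_Q'Q: "low_op Q' (low_op Q a) = a"
  by (rule low_op_inverse) (rule Q'Q)

lemma omega_bounded_low_op: "omega_bounded a \<Longrightarrow> omega_bounded (low_op U a)"
  by (rule omega_bounded_change_finite[of a "{-N..N}"]) (auto simp: low_op_def)

definition jtrans :: "(int \<Rightarrow> complex) \<Rightarrow> int \<Rightarrow> complex" where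
  "jtrans a = sim (low_op Q a)"

text \<open>The Jordan form of \<open>D + B\<close>, acting on coordinate sequences.\<close>

definition jop :: "(int \<Rightarrow> complex) \<Rightarrow> int \<Rightarrow> complex" where
  "jop a m = \<nu> m * a m + e (m + 1) * a (m + 1)"

lemma blop_low_op: "blop (low_op Q a) = low_op Q (jop a)"
proof
  fix m
  show "blop (low_op Q a) m = low_op Q (jop a) m"
  proof (cases "\<bar>m\<bar> \<le> N")
    case True
    define F where "F k = (if m = k then of_real ((pi * of_int m)\<^sup>2) else 0) + B m k" for k
    have "blop (low_op Q a) m = (\<Sum>k\<in>{-N..N}. F k * (\<Sum>j\<in>{-N..N}. Q k j * a j))"
      unfolding blop_low[OF True] F_def by (auto simp: low_op_def intro!: sum.cong)
    also have "\<dots> = (\<Sum>j\<in>{-N..N}. (\<Sum>k\<in>{-N..N}. F k * Q k j) * a j)"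
      unfolding sum_distrib_left sum_distrib_right by (subst sum.swap) (simp add: mult.assoc)
    also have "\<dots> = (\<Sum>j\<in>{-N..N}. \<nu> j * Q m j * a j + e j * Q m (j - 1) * a j)"
    proof (intro sum.cong refl)
      fix j assume "j \<in> {-N..N}"
      then have "\<bar>j\<bar> \<le> N" by auto
      from FQ[OF True this] show "(\<Sum>k\<in>{-N..N}. F k * Q k j) * a j = \<nu> j * Q m j * a j + e j * Q m (j - 1) * a j"
        unfolding F_def by (simp only: distrib_right)
    qed
    also have "\<dots> = (\<Sum>j\<in>{-N..N}. \<nu> j * Q m j * a j) + (\<Sum>j\<in>{-N..N}. e j * Q m (j - 1) * a j)"
      by (rule sum.distrib)
    \<comment> \<open>The range is shifted so that \<open>Q m (j - 1)\<close> can be reindexed to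
      \<open>Q m j\<close>. The term lost and the term gained vanish, since
      \<open>e (- N) = 0\<close> by \<open>e_low\<close> and \<open>e (N + 1) = 0\<close> by
      \<open>e_high\<close>.\<close>
    also have "(\<Sum>j\<in>{-N..N}. e j * Q m (j - 1) * a j) = (\<Sum>j\<in>{-N+1..N+1}. e j * Q m (j - 1) * a j)"
    proof (rule sum.mono_neutral_cong)
      fix i assume "i \<in> {- N..N} - {- N + 1..N + 1}"
      then have "i = - N" "\<bar>i\<bar> \<le> N" using N_pos by auto
      then have "e i = 0" using e_low[of i] by auto
      then show "e i * Q m (i - 1) * a i = 0" by simp
    next
      fix i assume "i \<in> {- N + 1..N + 1} - {- N..N}"
      then show "e i * Q m (i - 1) * a i = 0" using e_high[of i] by auto
    qed auto
    also have "\<dots> = (\<Sum>j\<in>{-N..N}. e (j + 1) * Q m j * a (j + 1))"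
      by (rule sum.reindex_bij_witness[of _ "\<lambda>j. j + 1" "\<lambda>j. j - 1"]) auto
    finally have "blop (low_op Q a) m = (\<Sum>j\<in>{-N..N}. Q m j * jop a j)"
      by (simp add: jop_def sum.distrib algebra_simps)
    then show ?thesis using True by (simp add: low_op_def[of Q "jop a"])
  next
    case False
    \<comment> \<open>Outside the block only m = -N - 1 has its successor in the block, and
      \<open>e_low\<close> excludes a coupling at the first index of the block.\<close>
    have "e (m + 1) = 0"
    proof (rule ccontr)
      assume "e (m + 1) \<noteq> 0"
      moreover from this have "\<bar>m + 1\<bar> \<le> N" using e_high[of "m + 1"] by linarith
      ultimately show False using e_low[of "m + 1"] False by linarith
    qed
    then show ?thesis
      using False blop_high[of m] \<nu>_high[of m] by (simp add: low_op_def jop_def)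
  qed
qed

lemma hill_jtrans: "omega_bounded a \<Longrightarrow> hill_seq p (jtrans a) m = jtrans (jop a) m"
  unfolding jtrans_def using hill_sim[OF omega_bounded_low_op] by (simp add: blop_low_op)

lemma omega_bounded_jtrans:
  assumes "omega_bounded a" shows "omega_bounded (jtrans a)"
proof -
  obtain C where "0 \<le> C" "\<And>m. cmod (low_op Q a m) \<le> C * omega m"
    using omega_bounded_low_op[OF assms] by (meson omega_boundedE)
  then have "cmod (matvec X (low_op Q a) m) \<le> (1 / 2 * C) * omega m" for m
    by (intro matvec_bound[OF X_decays admissible_omega]) auto
  then have "omega_bounded (matvec X (low_op Q a))" unfolding omega_bounded_def by blast
  then show ?thesis
    unfolding jtrans_def sim_def by (intro omega_bounded_add omega_bounded_low_op assms)
qed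

lemma jtrans_surj:
  assumes "omega_bounded c" obtains a where "omega_bounded a" "jtrans a = c"
proof -
  obtain b where b: "omega_bounded b" "sim b = c"
    using assms by (meson sim_surj)
  have "jtrans (low_op Q' b) = c"
    unfolding jtrans_def using b low_op_QQ' by simp
  then show ?thesis using that omega_bounded_low_op[OF b(1)] by blast
qed

definition seq_bounded :: "(int \<Rightarrow> complex) \<Rightarrow> bool" where
  "seq_bounded a \<longleftrightarrow> (\<exists>C. \<forall>m. cmod (a m) \<le> C * 1)"

lemma seq_bounded_omega:
  assumes "omega_bounded a" shows "seq_bounded a"
proof -
  obtain C where C: "0 \<le> C" "\<And>m. cmod (a m) \<le> C * omega m"
    using assms by (meson omega_boundedE)
  then have "cmod (a m) \<le> C * 1" for m by (rule omega_bound_le)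
  then show ?thesis by (auto simp: seq_bounded_def)
qed

lemma seq_bounded_diff:
  assumes "seq_bounded a" "seq_bounded b" shows "seq_bounded (\<lambda>m. a m - b m)"
proof -
  obtain C D where "\<And>m. cmod (a m) \<le> C * 1" "\<And>m. cmod (b m) \<le> D * 1"
    using assms by (auto simp: seq_bounded_def)
  then have "cmod (a m - b m) \<le> (C + D) * 1" for m
    by (metis add_mono distrib_right norm_triangle_le_diff)
  then show ?thesis by (auto simp: seq_bounded_def)
qed

lemma low_op_diff: "low_op U (\<lambda>m. a m - b m) m = low_op U a m - low_op U b m"
  by (simp add: low_op_def right_diff_distrib sum_subtractf)

lemma seq_bounded_low_op:
  assumes "seq_bounded a" shows "seq_bounded (low_op U a)"
proof -
  obtain C where C: "\<And>m. cmod (a m) \<le> C * 1"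
    using assms by (auto simp: seq_bounded_def)
  define D where "D = (\<Sum>m\<in>{-N..N}. cmod (low_op U a m))"
  have "0 \<le> D" "0 \<le> C" using order_trans[OF norm_ge_zero C[of 0]] by (auto simp: D_def intro: sum_nonneg)
  have "cmod (low_op U a m) \<le> (C + D) * 1" for m
  proof (cases "\<bar>m\<bar> \<le> N")
    case True
    then have "cmod (low_op U a m) \<le> D"
      unfolding D_def by (intro member_le_sum) auto
    then show ?thesis using \<open>0 \<le> C\<close> by simp
  next
    case False
    then show ?thesis using C[of m] \<open>0 \<le> D\<close> by (simp add: low_op_def)
  qed
  then show ?thesis by (auto simp: seq_bounded_def)
qed

lemma jtrans_diff:
  assumes "seq_bounded a" "seq_bounded b"
  shows "jtrans (\<lambda>m. a m - b m) m = jtrans a m - jtrans b m"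
proof -
  obtain C D where *: "\<And>m. cmod (low_op Q a m) \<le> C * 1" "\<And>m. cmod (low_op Q b m) \<le> D * 1"
    using assms[THEN seq_bounded_low_op[where U=Q]] by (auto simp: seq_bounded_def)
  show ?thesis
    using matvec_diff[OF X_decays admissible_1 *, where m=m] by (simp add: jtrans_def sim_def low_op_diff[abs_def])
qed

lemma jtrans_scale: "jtrans (\<lambda>m. z * a m) m = z * jtrans a m"
proof -
  have "low_op Q (\<lambda>m. z * a m) = (\<lambda>m. z * low_op Q a m)"
    by (auto simp: low_op_def fun_eq_iff sum_distrib_left mult_ac intro!: sum.cong)
  then show ?thesis by (simp add: jtrans_def sim_def matvec_scale distrib_left)
qed

lemma jtrans_add:
  assumes "omega_bounded a" "omega_bounded b"
  shows "jtrans (\<lambda>m. a m + b m) m = jtrans a m + jtrans b m"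
  using jtrans_diff[OF seq_bounded_omega[OF assms(1)] seq_bounded_omega[OF omega_bounded_scale[OF assms(2), of "-1"]], of m]
    jtrans_scale[of "-1" b m] by simp

lemma jtrans_inj:
  assumes "seq_bounded a" "\<And>m. jtrans a m = 0" shows "a m = 0"
proof -
  obtain C where "\<And>m. cmod (low_op Q a m) \<le> C * 1"
    using seq_bounded_low_op[OF assms(1)] by (auto simp: seq_bounded_def)
  then have "low_op Q a m = 0" for m
    using sim_inj[of "low_op Q a" C m] assms(2) by (simp add: jtrans_def)
  then have "low_op Q a = (\<lambda>_. 0)" by blast
  then have "low_op Q' (low_op Q a) m = 0" by (simp add: low_op_def)
  then show ?thesis using low_op_Q'Q by simp
qed

text \<open>The bound is easy for \<open>blop (low_op Q a)\<close>, which equals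
  \<open>low_op Q (jop a)\<close>; applying \<open>Q'\<close> transfers it to
  \<open>jop a\<close>.\<close>

lemma seq_bounded_jop:
  assumes "omega_bounded a" shows "seq_bounded (jop a)"
proof -
  obtain C where C: "0 \<le> C" "\<And>m. cmod (low_op Q a m) \<le> C * omega m"
    using omega_bounded_low_op[OF assms] by (meson omega_boundedE)
  have C1: "cmod (low_op Q a m) \<le> C * 1" for m by (rule omega_bound_le[OF C])
  have "cmod (blop (low_op Q a) m) \<le> (pi\<^sup>2 * C + S * C) * 1" for m
    unfolding blop_def using square_mult_bounded[OF C, of m] matvec_bound[where c="low_op Q a" and m=m, OF B_decays admissible_1 C1]
    by (intro norm_triangle_le) auto
  then have "seq_bounded (blop (low_op Q a))" by (auto simp: seq_bounded_def)
  then have "seq_bounded (low_op Q' (low_op Q (jop a)))"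
    by (subst blop_low_op[symmetric]) (rule seq_bounded_low_op)
  then show ?thesis unfolding low_op_Q'Q .
qed

text \<open>In Jordan coordinates the root equation reads
  \<open>(\<nu> m - \<mu>) a m = b m - e (m + 1) a (m + 1)\<close>, where b belongs to the next
  lower power. If \<nu> m differs from \<mu>, then \<open>b m = 0\<close> by induction on k, and a
  coordinate coupled through e has the same eigenvalue \<nu> m, so it vanishes by descending
  induction on m.\<close>

lemma root_seq_coords:
  assumes "c \<in> root_seq p \<mu> k"
  obtains a where "omega_bounded a" "jtrans a = c" "\<And>m. \<nu> m \<noteq> \<mu> \<Longrightarrow> a m = 0"
  using assms
proof (induction k arbitrary: c thesis)
  case 0
  have z: "omega_bounded (\<lambda>_. 0)" by (auto simp: omega_bounded_def intro!: exI[of _ 0])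
  have "jtrans (\<lambda>_. 0) = c"
    using 0(2) jtrans_scale[of 0 "\<lambda>_. 0"] by auto
  then show ?case using 0(1) z by blast
next
  case (Suc k)
  then obtain g where g: "g \<in> root_seq p \<mu> k" "\<And>m. hill_seq p c m = \<mu> * c m + g m"
    and c: "omega_bounded c" by auto
  obtain b where b: "omega_bounded b" "jtrans b = g" "\<And>m. \<nu> m \<noteq> \<mu> \<Longrightarrow> b m = 0"
    using Suc.IH[OF _ g(1)] by blast
  obtain a where a: "omega_bounded a" "jtrans a = c" using c by (meson jtrans_surj)
  have ab: "seq_bounded (\<lambda>m. \<mu> * a m)" "seq_bounded b"
    by (intro seq_bounded_omega omega_bounded_scale a b)+
  have "jtrans (\<lambda>m. (jop a m - \<mu> * a m) - b m) m = 0" for m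
    using g(2)[of m] hill_jtrans[OF a(1), of m] jtrans_scale[of \<mu> a m] a(2) b(2)
    by (simp add: jtrans_diff[OF seq_bounded_diff[OF seq_bounded_jop[OF a(1)] ab(1)] ab(2)]
        jtrans_diff[OF seq_bounded_jop[OF a(1)] ab(1)] diff_eq_eq add.commute)
  then have z: "(jop a m - \<mu> * a m) - b m = 0" for m
    using jtrans_inj[OF seq_bounded_diff[OF seq_bounded_diff[OF seq_bounded_jop[OF a(1)] ab(1)] ab(2)]] by blast
  have rec: "(\<nu> m - \<mu>) * a m = b m - e (m + 1) * a (m + 1)" for m
  proof -
    have "(\<nu> m - \<mu>) * a m = ((jop a m - \<mu> * a m) - b m) + (b m - e (m + 1) * a (m + 1))"
      by (simp add: jop_def algebra_simps)
    then show ?thesis using z[of m] by simp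
  qed
  have "a m = 0" if "\<nu> m \<noteq> \<mu>" for m
    using that
  \<comment> \<open>The measure decreases from m to m + 1 as long as m + 1 is at most N; beyond
    that, \<open>e (m + 1)\<close> is 0 and the recursion ends.\<close>
  proof (induction "nat (N - m)" arbitrary: m rule: less_induct)
    case less
    have "e (m + 1) * a (m + 1) = 0"
    proof (cases "e (m + 1) = 0")
      case False
      then have "\<bar>m + 1\<bar> \<le> N" using e_high[of "m + 1"] by linarith
      then have "\<nu> (m + 1) \<noteq> \<mu>" "m + 1 \<le> N" using e_low[of "m + 1"] False less.prems by auto
      then show ?thesis using less.hyps[of "m + 1"] by auto
    qed simp
    then have "(\<nu> m - \<mu>) * a m = 0" using rec[of m] b(3)[OF less.prems] by simp
    then show ?case using less.prems by simp
  qed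
  then show ?case using Suc.prems(1) a by blast
qed

section \<open>The basis of root vectors\<close>

definition \<psi> :: "int \<Rightarrow> int \<Rightarrow> complex" where
  "\<psi> j = jtrans (unit_seq j)"

lemma omega_bounded_\<psi>: "omega_bounded (\<psi> j)"
  unfolding \<psi>_def by (rule omega_bounded_jtrans[OF omega_bounded_unit])

lemma jtrans_finite:
  assumes "finite J"
  shows "jtrans (\<lambda>m. if m \<in> J then a m else 0) m = (\<Sum>j\<in>J. a j * \<psi> j m)"
  using assms
proof (induction J)
  case empty
  then show ?case using jtrans_scale[of 0 "\<lambda>_. 0"] by auto
next
  case (insert j J)
  have fin: "omega_bounded (\<lambda>m. if m \<in> J then a m else 0)"
    by (rule omega_bounded_finite_support[OF insert(1)])
  have "(\<lambda>m. if m \<in> insert j J then a m else 0)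
      = (\<lambda>m. a j * unit_seq j m + (if m \<in> J then a m else 0))"
    using insert(2) by (auto simp: unit_seq_def fun_eq_iff)
  then show ?case
    using jtrans_add[OF omega_bounded_scale[OF omega_bounded_unit] fin, of "a j" j m] insert
    by (simp add: jtrans_scale \<psi>_def)
qed

lemma \<psi>_independent:
  assumes "finite J" "\<And>m. (\<Sum>j\<in>J. a j * \<psi> j m) = 0" "j \<in> J"
  shows "a j = 0"
proof -
  have "omega_bounded (\<lambda>m. if m \<in> J then a m else 0)"
    by (rule omega_bounded_finite_support[OF assms(1)])
  from jtrans_inj[OF seq_bounded_omega[OF this], of j] jtrans_finite[OF assms(1), of a] assms(2,3)
  show ?thesis by simp
qed

lemma hill_\<psi>: "hill_seq p (\<psi> j) m = \<nu> j * \<psi> j m + e j * \<psi> (j - 1) m"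
proof -
  have "jop (unit_seq j) = (\<lambda>m. \<nu> j * unit_seq j m + e j * unit_seq (j - 1) m)"
    by (auto simp: jop_def unit_seq_def fun_eq_iff)
  then show ?thesis
    using hill_jtrans[OF omega_bounded_unit, of j m]
      jtrans_add[OF omega_bounded_scale[OF omega_bounded_unit] omega_bounded_scale[OF omega_bounded_unit], of "\<nu> j" j "e j" "j - 1" m]
    by (simp add: \<psi>_def jtrans_scale)
qed

text \<open>The Jordan chain descends through j - 1 as long as e is nonzero, keeps its eigenvalue by
  \<open>e_low\<close>, and ends at -N at the latest.\<close>

lemma \<psi>_root: "\<exists>k. \<psi> j \<in> root_seq p (\<nu> j) k"
proof (induction "nat (j + N)" arbitrary: j rule: less_induct)
  case less
  have "\<exists>k. (\<lambda>m. e j * \<psi> (j - 1) m) \<in> root_seq p (\<nu> j) k"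
  proof (cases "e j = 0")
    case True
    then show ?thesis by (auto intro!: exI[of _ 0])
  next
    case False
    then have "\<bar>j\<bar> \<le> N" using e_high[of j] by linarith
    then have *: "- N < j" "\<nu> (j - 1) = \<nu> j" using e_low False by auto
    then obtain k where "\<psi> (j - 1) \<in> root_seq p (\<nu> j) k" using less[of "j - 1"] by auto
    from root_seq_scale[OF this] show ?thesis by blast
  qed
  then obtain k where "(\<lambda>m. e j * \<psi> (j - 1) m) \<in> root_seq p (\<nu> j) k" by blast
  then have "\<psi> j \<in> root_seq p (\<nu> j) (Suc k)"
    using omega_bounded_\<psi> hill_\<psi> by auto
  then show ?case by blast
qed

lemma \<nu>_asymp:
  assumes "N < \<bar>j\<bar>" shows "cmod (\<nu> j - of_real ((pi * of_int j)\<^sup>2)) \<le> S"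
proof -
  have "cmod (B j j) \<le> S * kappa 0" using decaysD[OF B_decays, of j j] by simp
  also have "\<dots> \<le> S * 1" using kappa_le_1[of 0] decays_nonneg[OF B_decays] by (intro mult_left_mono) auto
  finally show ?thesis using \<nu>_high[OF assms] by simp
qed

text \<open>Outside the block, \<open>|j| \<le> (pi j)^2\<close>, and by the asymptotics the latter
  is at most \<open>|\<mu>| + S\<close> when \<nu> j = \<mu>.\<close>

lemma finite_\<nu>: "finite {j. \<nu> j = \<mu>}"
proof -
  define M where "M = max N \<lceil>cmod \<mu> + S\<rceil>"
  have "\<bar>j\<bar> \<le> max N \<lceil>cmod \<mu> + S\<rceil>" if "\<nu> j = \<mu>" for j
  proof (cases "N < \<bar>j\<bar>")
    case True
    have "(of_int \<bar>j\<bar> :: real) * 1 \<le> of_int \<bar>j\<bar> * of_int \<bar>j\<bar>"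
      using True N_pos by (intro mult_left_mono) auto
    also have "\<dots> = 1 * (of_int j)\<^sup>2" by (simp add: power2_eq_square)
    also have "\<dots> \<le> pi\<^sup>2 * (of_int j)\<^sup>2"
      using pi_ge_two by (intro mult_right_mono one_le_power) auto
    also have "\<dots> = cmod (of_real ((pi * of_int j)\<^sup>2))"
      unfolding norm_of_real by (simp add: power_mult_distrib)
    also have "\<dots> \<le> cmod \<mu> + S"
      using \<nu>_asymp[OF True] that norm_triangle_ineq4[of \<mu> "\<mu> - of_real ((pi * of_int j)\<^sup>2)"] by simp
    finally show ?thesis by (simp add: le_max_iff_disj) linarith
  qed simp
  then have "{j. \<nu> j = \<mu>} \<subseteq> {- M..M}"
    unfolding M_def[symmetric] by (force simp: abs_le_iff)
  then show ?thesis using finite_subset finite_atLeastAtMost_int by blast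
qed

lemma root_seq_span:
  assumes "c \<in> root_seq p \<mu> k"
  obtains a where "c = (\<lambda>m. \<Sum>j | \<nu> j = \<mu>. a j * \<psi> j m)"
proof -
  obtain a where a: "omega_bounded a" "jtrans a = c" "\<And>m. \<nu> m \<noteq> \<mu> \<Longrightarrow> a m = 0"
    using assms by (meson root_seq_coords)
  have "a = (\<lambda>m. if m \<in> {j. \<nu> j = \<mu>} then a m else 0)" using a(3) by auto
  then have "c m = (\<Sum>j | \<nu> j = \<mu>. a j * \<psi> j m)" for m
    using jtrans_finite[OF finite_\<nu>, of \<mu> a m] a(2) by metis
  then show ?thesis using that[of a] by blast
qed

lemma low_op_unit_high: "N < \<bar>n\<bar> \<Longrightarrow> low_op U (unit_seq n) = unit_seq n"
  by (auto simp: low_op_def unit_seq_def fun_eq_iff intro!: sum.neutral)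

lemma \<psi>_high:
  assumes "N < \<bar>n\<bar>" shows "\<psi> n m = unit_seq n m + X m n"
  by (simp add: \<psi>_def jtrans_def sim_def low_op_unit_high[OF assms] matvec_unit)

lemma \<psi>_high_bound:
  assumes "N < \<bar>n\<bar>" shows "cmod (\<psi> n m) \<le> (omegaC + 1 / 2) * kappa (m - n)"
proof -
  have "cmod (unit_seq n m) \<le> omegaC * kappa (m - n)"
    using omegaC_ge by (auto simp: unit_seq_def kappa_0)
  then show ?thesis
    using norm_triangle_ineq[of "unit_seq n m" "X m n"] decaysD[OF X_decays, of m n]
    by (simp add: \<psi>_high[OF assms] distrib_right)
qed

text \<open>The operator is symmetric with respect to the bilinear form \<open>\<Sum>m. u m * v (- m)\<close>, and this form
  does not vanish on the pair \<open>\<psi> n\<close>, \<open>\<psi> (- n)\<close>.\<close>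

lemma \<nu>_double:
  assumes n: "N < \<bar>n\<bar>" shows "\<nu> n = \<nu> (- n)"
proof -
  have n': "N < \<bar>- n\<bar>" using n by simp
  define u v where "u = \<psi> n" and "v m = \<psi> (- n) (- m)" for m
  \<comment> \<open>The reflected vector v is stored as row n of an otherwise zero matrix, so that
    moving P across the bilinear form becomes an instance of \<open>matvec_matvec\<close>.\<close>
  define A where "A k m = (if k = n then v m else 0)" for k m
  have u_bd: "cmod (u m) \<le> (omegaC + 1 / 2) * kappa (m - n)" for m
    unfolding u_def by (rule \<psi>_high_bound[OF n])
  have A: "decays (omegaC + 1 / 2) A"
    unfolding decays_def
  proof (intro allI)
    fix k m
    show "cmod (A k m) \<le> (omegaC + 1 / 2) * kappa (k - m)"
      using \<psi>_high_bound[OF n', of "- m"] omegaC_ge by (auto simp: A_def v_def)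
  qed
  define pv where "pv m = matvec (toeplitz p) (\<psi> (- n)) (- m)" for m
  have AP: "matmat A (toeplitz p) n k = pv k" for k
  proof -
    have "matmat A (toeplitz p) n k = (\<Sum>\<^sub>\<infinity>m. \<psi> (- n) (- m) * p (m - k))"
      by (simp add: matmat_def matvec_def A_def v_def toeplitz_def)
    also have "\<dots> = (\<Sum>\<^sub>\<infinity>m. p (- k - m) * \<psi> (- n) m)"
      using infsum_reflect_int[where f="\<lambda>m. p (- k - m) * \<psi> (- n) m" and m=0]
      by (simp add: mult.commute add.commute)
    finally show ?thesis by (simp add: pv_def matvec_def toeplitz_def)
  qed
  have Pu_bd: "cmod (matvec (toeplitz p) u m) \<le> S * (omegaC + 1 / 2) * kappa (m - n)" for m
    by (rule matvec_bound[OF P_decays admissible_kappa u_bd])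
  have eq: "(\<Sum>\<^sub>\<infinity>m. v m * matvec (toeplitz p) u m) = (\<Sum>\<^sub>\<infinity>m. pv m * u m)"
  proof -
    have "matvec A (matvec (toeplitz p) u) n = matvec (matmat A (toeplitz p)) u n"
      by (rule matvec_matvec[OF A P_decays admissible_kappa u_bd])
    then show ?thesis by (simp add: matvec_def[of A] matvec_def[of "matmat A (toeplitz p)"] AP) (simp add: A_def)
  qed
  have s1: "(\<lambda>m. v m * matvec (toeplitz p) u m) summable_on UNIV"
    using matvec_summable[OF A admissible_kappa Pu_bd, of n] by (simp add: A_def)
  have s2: "(\<lambda>m. pv m * u m) summable_on UNIV"
    using matvec_summable[OF matmat_decays[OF A P_decays] admissible_kappa u_bd, of n] by (simp add: AP)
  have e0: "e n = 0" "e (- n) = 0" using e_high n n' by auto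
  \<comment> \<open>The two eigenvalue equations are multiplied crosswise. The terms with D cancel
    because \<open>(pi m)^2\<close> is even in m, and the remaining terms with P have equal sums by
    \<open>eq\<close>.\<close>
  have pt: "v m * matvec (toeplitz p) u m - pv m * u m = (\<nu> n - \<nu> (- n)) * (u m * v m)" for m
  proof -
    define d :: complex where "d = of_real ((pi * of_int m)\<^sup>2)"
    have 1: "d * u m + matvec (toeplitz p) u m = \<nu> n * u m"
      using hill_\<psi>[of n m] e0 by (simp add: hill_seq_def u_def d_def)
    have 2: "d * v m + pv m = \<nu> (- n) * v m"
      using hill_\<psi>[of "- n" "- m"] e0 by (simp add: hill_seq_def v_def pv_def d_def)
    have "v m * (d * u m + matvec (toeplitz p) u m) - (d * v m + pv m) * u m
        = (\<nu> n - \<nu> (- n)) * (u m * v m)"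
      unfolding 1 2 by (simp add: algebra_simps)
    then show ?thesis by (simp add: algebra_simps)
  qed
  have zero: "(\<nu> n - \<nu> (- n)) * (\<Sum>\<^sub>\<infinity>m. u m * v m) = 0"
    using infsum_diff[OF s1 s2] eq unfolding pt infsum_cmult_right' by simp
  have "n \<noteq> - n" using n N_pos by auto
  define c where "c k = X (- k) (- n)" for k
  have c_bd: "cmod (c k) \<le> 1 / 2 * 1" for k
    using decaysD[OF X_decays, of "- k" "- n"] kappa_le_1[of "- k - - n"] by (simp add: c_def)
  define A' where "A' k m = (if k = n then X m n else 0)" for k m
  have A': "decays (1 / 2) A'"
    using X_decays kappa_minus_commute by (auto simp: decays_def A'_def)
  \<comment> \<open>At m = n both factors are 1, as the diagonal of X is zero. Elsewhere only
    products of two entries of X occur, whose sum has modulus at most 1/4, so the total differs from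
    0.\<close>
  have uv: "u m * v m = unit_seq n m + A' n m * c m" for m
    using X_diag[of n] X_diag[of "- n"] X_antidiag[of n] X_antidiag[of "- n"] \<open>n \<noteq> - n\<close>
    by (auto simp: u_def v_def \<psi>_high[OF n] \<psi>_high[OF n'] unit_seq_def A'_def c_def)
  have "(unit_seq n has_sum 1) UNIV"
    using has_sum_finite_neutralI[of "{n}" UNIV "unit_seq n"] by (auto simp: unit_seq_def)
  moreover have "((\<lambda>m. A' n m * c m) has_sum matvec A' c n) UNIV"
    unfolding matvec_def by (rule has_sum_infsum[OF matvec_summable[OF A' admissible_1 c_bd]])
  ultimately have "(\<Sum>\<^sub>\<infinity>m. u m * v m) = 1 + matvec A' c n"
    unfolding uv by (intro infsumI has_sum_add)
  moreover have "cmod (matvec A' c n) \<le> 1 / 2 * (1 / 2) * 1"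
    by (rule matvec_bound[OF A' admissible_1 c_bd])
  then have "matvec A' c n \<noteq> - 1" by auto
  ultimately have "(\<Sum>\<^sub>\<infinity>m. u m * v m) \<noteq> 0"
    by (metis add_eq_0_iff)
  then show ?thesis using zero by simp
qed

end

section \<open>Fourier series of period 2\<close>

definition fexp :: "int \<Rightarrow> real \<Rightarrow> complex" where "fexp m x = cis (pi * of_int m * x)"

definition fser :: "(int \<Rightarrow> complex) \<Rightarrow> real \<Rightarrow> complex" where
  "fser c x = (\<Sum>\<^sub>\<infinity>m. c m * fexp m x)"

definition fcoeff :: "(real \<Rightarrow> complex) \<Rightarrow> int \<Rightarrow> complex" where
  "fcoeff f m = integral {0..2} (\<lambda>x. f x * fexp (- m) x) / 2"

lemma norm_fexp [simp]: "cmod (fexp m x) = 1"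
  by (simp add: fexp_def)

lemma fexp_0 [simp]: "fexp 0 x = 1"
  by (simp add: fexp_def)

lemma fexp_mult: "fexp m x * fexp n x = fexp (m + n) x"
  by (simp add: fexp_def cis_mult algebra_simps)

lemma cnj_fexp [simp]: "cnj (fexp m x) = fexp (- m) x"
  by (simp add: fexp_def cis_cnj)

lemma cis_even_pi: "even n \<Longrightarrow> cis (pi * of_int n) = 1"
  by (auto elim!: evenE simp: complex_eq_iff)

lemma fexp_periodic: "fexp m (x + 2) = fexp m x"
proof -
  have "fexp m (x + 2) = cis (pi * of_int m * x) * cis (pi * of_int (2 * m))"
    by (simp add: fexp_def cis_mult algebra_simps)
  then show ?thesis using cis_even_pi[of "2 * m"] by (simp add: fexp_def)
qed

lemma fexp_periodic_even: "even m \<Longrightarrow> fexp m (x + 1) = fexp m x"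
proof -
  assume "even m"
  moreover have "fexp m (x + 1) = cis (pi * of_int m * x) * cis (pi * of_int m)"
    by (simp add: fexp_def cis_mult algebra_simps)
  ultimately show ?thesis using cis_even_pi[of "m"] by (simp add: fexp_def)
qed

lemma continuous_on_fexp [continuous_intros]: "continuous_on A (fexp m)"
  unfolding fexp_def[abs_def] by (intro continuous_intros)

lemma fexp_has_vector_derivative:
  "(fexp m has_vector_derivative (\<i> * of_real (pi * of_int m)) * fexp m x) (at x within A)"
proof -
  let ?z = "\<i> * of_real (pi * of_int m)"
  have "((\<lambda>w. exp (?z * w)) has_field_derivative ?z * exp (?z * of_real x)) (at (of_real x))"
    by (auto intro!: derivative_eq_intros)
  from has_vector_derivative_real_field[OF this] show ?thesis
    by (simp add: fexp_def[abs_def] cis_conv_exp mult_ac)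
qed

lemma omega_bounded_summable:
  assumes "omega_bounded c" shows "(\<lambda>m. cmod (c m)) summable_on UNIV"
proof -
  obtain C where C: "0 \<le> C" "\<And>m. cmod (c m) \<le> C * omega m"
    using assms by (meson omega_boundedE)
  show ?thesis
    by (rule summable_on_comparison_test[OF summable_on_cmult_right[OF omega_summable, of C]]) (use C in auto)
qed

lemma fser_uniform_limit:
  assumes "omega_bounded c"
  shows "uniform_limit A (\<lambda>M x. \<Sum>m\<in>M. c m * fexp m x) (fser c) (finite_subsets_at_top UNIV)"
  unfolding fser_def[abs_def]
  by (rule Weierstrass_m_test_general[OF _ omega_bounded_summable[OF assms]]) (simp add: norm_mult)

lemma continuous_on_fser:
  assumes "omega_bounded c" shows "continuous_on A (fser c)"
  by (rule uniform_limit_theorem[OF _ fser_uniform_limit[OF assms]])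
    (auto intro!: always_eventually continuous_intros)

lemma fser_summable: "omega_bounded c \<Longrightarrow> (\<lambda>m. c m * fexp m x) summable_on UNIV"
  by (rule abs_summable_summable) (simp add: norm_mult omega_bounded_summable)

lemma fser_periodic: "fser c (x + 2) = fser c x"
  by (simp add: fser_def fexp_periodic)

lemma fser_periodic_even:
  assumes "\<And>k. odd k \<Longrightarrow> c k = 0" shows "fser c (x + 1) = fser c x"
proof -
  have "c k * fexp k (x + 1) = c k * fexp k x" for k
    using assms[of k] fexp_periodic_even[of k x] by (cases "even k") auto
  then show ?thesis unfolding fser_def by (rule infsum_cong)
qed

lemma fser_add: "omega_bounded c \<Longrightarrow> omega_bounded d \<Longrightarrow> fser (\<lambda>m. c m + d m) x = fser c x + fser d x"
  unfolding fser_def by (subst infsum_add[OF fser_summable fser_summable, symmetric]) (simp_all add: distrib_right)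

lemma fser_scale: "fser (\<lambda>m. z * c m) x = z * fser c x"
  unfolding fser_def by (subst infsum_cmult_right'[symmetric]) (simp add: mult.assoc)

lemma fser_diff: "omega_bounded c \<Longrightarrow> omega_bounded d \<Longrightarrow> fser (\<lambda>m. c m - d m) x = fser c x - fser d x"
  using fser_add[of c "\<lambda>m. (-1) * d m" x] omega_bounded_scale[of d "-1"] fser_scale[of "-1" d x] by simp

lemma fser_zero [simp]: "fser (\<lambda>m. 0) = (\<lambda>x. 0)"
  by (simp add: fser_def fun_eq_iff)

text \<open>Termwise integration by uniform convergence. The continuous factor g covers Fourier
  coefficients, integrals over intervals and Fourier coefficients of products alike.\<close>

lemma integral_fser_mult:
  assumes c: "omega_bounded c" and g: "continuous_on {a..b} g"
  shows "((\<lambda>m. c m * integral {a..b} (\<lambda>x. fexp m x * g x)) has_sum integral {a..b} (\<lambda>x. fser c x * g x)) UNIV"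
proof -
  obtain G where G: "\<forall>x\<in>{a..b}. cmod (g x) \<le> G"
    using compact_imp_bounded[OF compact_continuous_image[OF g compact_Icc]] unfolding bounded_iff by blast
  have "uniform_limit {a..b} (\<lambda>M x. \<Sum>m\<in>M. c m * fexp m x * g x) (\<lambda>x. \<Sum>\<^sub>\<infinity>m. c m * fexp m x * g x)
      (finite_subsets_at_top UNIV)"
  proof (rule Weierstrass_m_test_general[where M="\<lambda>m. cmod (c m) * G"])
    show "(\<lambda>m. cmod (c m) * G) summable_on UNIV"
      by (rule summable_on_cmult_left[OF omega_bounded_summable[OF c]])
    show "norm (c m * fexp m x * g x) \<le> cmod (c m) * G" if "x \<in> {a..b}" for m x
      using bspec[OF G that] by (simp add: norm_mult mult_left_mono)
  qed
  moreover have "(\<Sum>\<^sub>\<infinity>m. c m * fexp m x * g x) = fser c x * g x" for x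
    by (simp add: fser_def infsum_cmult_left')
  ultimately have u: "uniform_limit {a..b} (\<lambda>M x. \<Sum>m\<in>M. c m * fexp m x * g x) (\<lambda>x. fser c x * g x)
      (finite_subsets_at_top UNIV)"
    by simp
  obtain I J where I: "\<And>M. ((\<lambda>x. \<Sum>m\<in>M. c m * fexp m x * g x) has_integral I M) {a..b}"
    and J: "((\<lambda>x. fser c x * g x) has_integral J) {a..b}" and IJ: "(I \<longlongrightarrow> J) (finite_subsets_at_top UNIV)"
    by (rule uniform_limit_integral[OF u]) (auto intro!: continuous_intros g)
  have "I M = (\<Sum>m\<in>M. c m * integral {a..b} (\<lambda>x. fexp m x * g x))" for M
  proof -
    have int: "(\<lambda>x. c m * (fexp m x * g x)) integrable_on {a..b}" for m
      by (intro integrable_continuous_real continuous_intros g)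
    show ?thesis
    proof (cases "finite M")
      case True
      have "I M = integral {a..b} (\<lambda>x. \<Sum>m\<in>M. c m * (fexp m x * g x))"
        using integral_unique[OF I[of M]] by (simp add: mult.assoc)
      also have "\<dots> = (\<Sum>m\<in>M. integral {a..b} (\<lambda>x. c m * (fexp m x * g x)))"
        by (rule integral_sum[OF True int])
      finally show ?thesis by simp
    next
      \<comment> \<open>Sums over infinite index sets are 0 by convention, so \<open>I M\<close> is
        the integral of 0.\<close>
      case False
      then show ?thesis using I[of M] by (simp add: has_integral_0_eq)
    qed
  qed
  then have "I = (\<lambda>M. \<Sum>m\<in>M. c m * integral {a..b} (\<lambda>x. fexp m x * g x))" by blast
  then show ?thesis
    using IJ integral_unique[OF J] by (simp add: has_sum_def)
qed

lemma integral_fexp_period: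
  "integral {0..2} (fexp k) = (if k = 0 then 2 else 0)"
proof (cases "k = 0")
  case True
  have "fexp 0 = (\<lambda>x. 1)" by (simp add: fun_eq_iff)
  then show ?thesis using True by (simp add: scaleR_conv_of_real)
next
  case False
  define z where "z = \<i> * of_real (pi * of_int k)"
  have z: "z \<noteq> 0" using False by (simp add: z_def)
  have "((\<lambda>x. z * fexp k x) has_integral (fexp k 2 - fexp k 0)) {0..2}"
    unfolding z_def by (rule fundamental_theorem_of_calculus) (simp, rule fexp_has_vector_derivative)
  moreover have "fexp k 2 = fexp k 0" using fexp_periodic[of k 0] by simp
  ultimately have "((\<lambda>x. z * fexp k x) has_integral 0) {0..2}" by simp
  from integral_unique[OF this] show ?thesis using z False by simp
qed

lemma fcoeff_fser:
  assumes "omega_bounded c" shows "fcoeff (fser c) m = c m"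
proof -
  have "((\<lambda>k. c k * integral {0..2} (\<lambda>x. fexp k x * fexp (- m) x)) has_sum
      integral {0..2} (\<lambda>x. fser c x * fexp (- m) x)) UNIV"
    by (rule integral_fser_mult[OF assms]) (intro continuous_intros)
  moreover have "c k * integral {0..2} (\<lambda>x. fexp k x * fexp (- m) x) = (if k = m then 2 * c m else 0)" for k
    unfolding fexp_mult using integral_fexp_period[of "k + - m"] by auto
  moreover have "((\<lambda>k. if k = m then 2 * c m else 0) has_sum (2 * c m)) UNIV"
    using has_sum_finite_neutralI[of "{m}" UNIV "\<lambda>k. if k = m then 2 * c m else 0"] by auto
  ultimately have "integral {0..2} (\<lambda>x. fser c x * fexp (- m) x) = 2 * c m"
    using has_sum_unique by force
  then show ?thesis by (simp add: fcoeff_def)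
qed

section \<open>Derivatives of Fourier series\<close>

lemma continuous_derivative_of_integral:
  fixes F G :: "real \<Rightarrow> complex"
  assumes G: "continuous_on UNIV G" and FG: "\<And>a b. a \<le> b \<Longrightarrow> F b - F a = integral {a..b} G"
  shows "(F has_vector_derivative G x) (at x)"
proof -
  have "((\<lambda>u. integral {x - 1..u} G) has_vector_derivative G x) (at x within {x - 1..x + 1})"
    by (rule integral_has_vector_derivative[OF continuous_on_subset[OF G]]) auto
  then have "((\<lambda>u. integral {x - 1..u} G) has_vector_derivative G x) (at x)"
    using at_within_Icc_at[of "x - 1" x "x + 1"] by simp
  then have "((\<lambda>u. F (x - 1) + integral {x - 1..u} G) has_vector_derivative 0 + G x) (at x)"
    by (intro has_vector_derivative_add has_vector_derivative_const)
  then show ?thesis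
    unfolding add_0
  proof (rule has_vector_derivative_transform_within_open[of _ _ _ "{x - 1<..<x + 1}"])
    fix u assume "u \<in> {x - 1<..<x + 1}"
    then show "F (x - 1) + integral {x - 1..u} G = F u" using FG[of "x - 1" u] by (simp add: algebra_simps)
  qed auto
qed

text \<open>The inequality \<open>|t| \<le> 1 + t^2\<close> bounds the coefficients of the first
  derivative by those of order zero and two.\<close>

lemma omega_bounded_derivative:
  assumes "omega_bounded c" "omega_bounded (\<lambda>m. of_real ((pi * of_int m)\<^sup>2) * c m)"
  shows "omega_bounded (\<lambda>m. (\<i> * of_real (pi * of_int m)) * c m)"
proof -
  obtain C D where C: "\<And>m. cmod (c m) \<le> C * omega m"
    and D: "\<And>m. cmod (of_real ((pi * of_int m)\<^sup>2) * c m) \<le> D * omega m"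
    using assms by (meson omega_boundedE)
  have "cmod ((\<i> * of_real (pi * of_int m)) * c m) \<le> (C + D) * omega m" for m
  proof -
    define t where "t = pi * of_int m"
    have t: "\<bar>t\<bar> \<le> 1 + t\<^sup>2"
    proof -
      have "0 \<le> (\<bar>t\<bar> - 1 / 2)\<^sup>2" by simp
      then show ?thesis by (simp add: power2_eq_square algebra_simps flip: abs_mult)
    qed
    have "cmod ((\<i> * of_real t) * c m) = \<bar>t\<bar> * cmod (c m)" by (simp add: norm_mult)
    also have "\<dots> \<le> (1 + t\<^sup>2) * cmod (c m)" by (rule mult_right_mono[OF t norm_ge_zero])
    also have "\<dots> = cmod (c m) + cmod (of_real (t\<^sup>2) * c m)"
      unfolding norm_mult norm_of_real by (simp add: distrib_right)
    also have "\<dots> \<le> C * omega m + D * omega m" using C D by (intro add_mono) (auto simp: t_def)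
    finally show ?thesis by (simp add: t_def distrib_right)
  qed
  then show ?thesis unfolding omega_bounded_def by blast
qed

text \<open>The differentiated series is continuous and is integrated termwise; this gives the
  increments of the original series.\<close>

lemma fser_has_vector_derivative:
  assumes c: "omega_bounded c" and c1: "omega_bounded (\<lambda>m. (\<i> * of_real (pi * of_int m)) * c m)"
  shows "(fser c has_vector_derivative fser (\<lambda>m. (\<i> * of_real (pi * of_int m)) * c m) x) (at x)"
proof (rule continuous_derivative_of_integral[OF continuous_on_fser[OF c1]])
  fix a b :: real assume ab: "a \<le> b"
  let ?z = "\<lambda>m. \<i> * of_real (pi * of_int m)"
  have "((\<lambda>m. ?z m * c m * integral {a..b} (\<lambda>x. fexp m x * 1)) has_sum
      integral {a..b} (\<lambda>x. fser (\<lambda>m. ?z m * c m) x * 1)) UNIV"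
    by (rule integral_fser_mult[OF c1]) (intro continuous_intros)
  moreover have "?z m * c m * integral {a..b} (\<lambda>x. fexp m x * 1) = c m * fexp m b - c m * fexp m a" for m
  proof -
    have "((\<lambda>x. ?z m * fexp m x) has_integral (fexp m b - fexp m a)) {a..b}"
      by (rule fundamental_theorem_of_calculus[OF ab]) (rule fexp_has_vector_derivative)
    then have "?z m * integral {a..b} (fexp m) = fexp m b - fexp m a"
      by (simp add: integral_unique flip: integral_mult_right)
    then have "c m * (?z m * integral {a..b} (fexp m)) = c m * (fexp m b - fexp m a)" by simp
    then show ?thesis by (simp add: algebra_simps)
  qed
  moreover have "((\<lambda>m. c m * fexp m b - c m * fexp m a) has_sum (fser c b - fser c a)) UNIV"
    unfolding fser_def diff_conv_add_uminus
    by (intro has_sum_add has_sum_uminusI has_sum_infsum fser_summable c)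
  ultimately show "fser c b - fser c a = integral {a..b} (fser (\<lambda>m. ?z m * c m))"
    using has_sum_unique by force
qed

lemma fcoeff_derivative:
  assumes F: "\<And>x. (F has_vector_derivative F' x) (at x)" and F': "continuous_on UNIV F'"
    and per: "\<And>x. F (x + 2) = F x"
  shows "fcoeff F' m = (\<i> * of_real (pi * of_int m)) * fcoeff F m"
proof -
  let ?z = "\<i> * of_real (pi * of_int m)"
  have Fc: "continuous_on {0..2} F"
    by (meson F continuous_at_imp_continuous_on has_vector_derivative_continuous)
  have "((\<lambda>x. F x * ((\<i> * of_real (pi * of_int (- m))) * fexp (- m) x) + F' x * fexp (- m) x)
      has_integral (F 2 * fexp (- m) 2 - F 0 * fexp (- m) 0)) {0..2}"
    by (rule fundamental_theorem_of_calculus)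
      (simp, rule has_vector_derivative_mult[OF has_vector_derivative_at_within[OF F] fexp_has_vector_derivative])
  moreover have "F 2 * fexp (- m) 2 - F 0 * fexp (- m) 0 = 0"
    using per[of 0] fexp_periodic[of "- m" 0] by simp
  ultimately have "integral {0..2} (\<lambda>x. F' x * fexp (- m) x - ?z * (F x * fexp (- m) x)) = 0"
    by (simp add: integral_unique algebra_simps)
  moreover have "integral {0..2} (\<lambda>x. F' x * fexp (- m) x - ?z * (F x * fexp (- m) x))
      = integral {0..2} (\<lambda>x. F' x * fexp (- m) x) - integral {0..2} (\<lambda>x. ?z * (F x * fexp (- m) x))"
    by (intro integral_diff integrable_continuous_real continuous_intros Fc continuous_on_subset[OF F']) auto
  ultimately show ?thesis by (simp add: fcoeff_def)
qed

lemma fcoeff_bound: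
  assumes "continuous_on {0..2} f" obtains K where "\<And>m. cmod (fcoeff f m) \<le> K"
proof -
  have "cmod (fcoeff f m) \<le> integral {0..2} (\<lambda>x. cmod (f x))" for m
  proof -
    have "cmod (integral {0..2} (\<lambda>x. f x * fexp (- m) x)) \<le> integral {0..2} (\<lambda>x. cmod (f x))"
      by (intro integral_norm_bound_integral integrable_continuous_real continuous_intros assms)
        (simp add: norm_mult)
    moreover have "0 \<le> integral {0..2} (\<lambda>x. cmod (f x))"
      by (intro integral_nonneg integrable_continuous_real continuous_intros assms) simp
    ultimately show ?thesis by (simp add: fcoeff_def norm_divide)
  qed
  then show ?thesis by (rule that)
qed

lemma fcoeff_lincomb:
  assumes "continuous_on {0..2} f" "continuous_on {0..2} g"
  shows "fcoeff (\<lambda>x. f x - z * g x) m = fcoeff f m - z * fcoeff g m"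
proof -
  have "integral {0..2} (\<lambda>x. f x * fexp (- m) x - z * (g x * fexp (- m) x))
      = integral {0..2} (\<lambda>x. f x * fexp (- m) x) - integral {0..2} (\<lambda>x. z * (g x * fexp (- m) x))"
    by (intro integral_diff integrable_continuous_real continuous_intros assms)
  then show ?thesis by (simp add: fcoeff_def algebra_simps diff_divide_distrib)
qed

lemma integral_of_real_complex:
  assumes "h integrable_on S"
  shows "integral S (\<lambda>x. of_real (h x) :: complex) = of_real (integral S h)"
  using integral_linear[OF assms bounded_linear_of_real[where 'a=complex]] by (simp add: o_def)

section \<open>Bessel's inequality and uniqueness of Fourier coefficients\<close>

text \<open>For the partial sum s, the remainder g - s is orthogonal to s. Hence the integral of
  \<open>|g - s|^2\<close> is that of \<open>|g|^2\<close> minus that of \<open>s * cnj g\<close>,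
  and it is nonnegative.\<close>

lemma bessel:
  assumes g: "continuous_on {0..2} g" and "finite M"
  shows "(\<Sum>m\<in>M. (cmod (fcoeff g m))\<^sup>2) \<le> integral {0..2} (\<lambda>x. (cmod (g x))\<^sup>2) / 2"
proof -
  define s where "s x = (\<Sum>m\<in>M. fcoeff g m * fexp m x)" for x
  have s: "continuous_on {0..2} s" unfolding s_def[abs_def] by (intro continuous_intros)
  note int = integrable_continuous_real
  have s_fexp: "integral {0..2} (\<lambda>x. s x * fexp (- m) x) = 2 * fcoeff g m" if "m \<in> M" for m
  proof -
    have "integral {0..2} (\<lambda>x. s x * fexp (- m) x) = integral {0..2} (\<lambda>x. \<Sum>k\<in>M. fcoeff g k * fexp (k - m) x)"
      by (simp add: s_def sum_distrib_right mult.assoc fexp_mult)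
    also have "\<dots> = (\<Sum>k\<in>M. fcoeff g k * integral {0..2} (fexp (k - m)))"
      using \<open>finite M\<close> by (subst integral_sum) (auto intro!: int continuous_intros)
    also have "\<dots> = (\<Sum>k\<in>M. if k = m then 2 * fcoeff g m else 0)"
      by (intro sum.cong) (auto simp: integral_fexp_period)
    finally show ?thesis using that \<open>finite M\<close> by simp
  qed
  have orth: "integral {0..2} (\<lambda>x. (g x - s x) * cnj (s x)) = 0"
  proof -
    have cs: "cnj (s x) = (\<Sum>m\<in>M. cnj (fcoeff g m) * fexp (- m) x)" for x
      by (simp add: s_def)
    have "integral {0..2} (\<lambda>x. (g x - s x) * cnj (s x))
        = integral {0..2} (\<lambda>x. \<Sum>m\<in>M. cnj (fcoeff g m) * ((g x - s x) * fexp (- m) x))"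
      by (simp add: cs sum_distrib_left mult_ac)
    also have "\<dots> = (\<Sum>m\<in>M. cnj (fcoeff g m) * integral {0..2} (\<lambda>x. (g x - s x) * fexp (- m) x))"
      using \<open>finite M\<close> by (subst integral_sum) (auto intro!: int continuous_intros g s)
    also have "\<dots> = 0"
    proof (intro sum.neutral ballI)
      fix m assume "m \<in> M"
      have "integral {0..2} (\<lambda>x. (g x - s x) * fexp (- m) x)
          = integral {0..2} (\<lambda>x. g x * fexp (- m) x) - integral {0..2} (\<lambda>x. s x * fexp (- m) x)"
        unfolding left_diff_distrib by (intro integral_diff int continuous_intros g s)
      then show "cnj (fcoeff g m) * integral {0..2} (\<lambda>x. (g x - s x) * fexp (- m) x) = 0"
        using s_fexp[OF \<open>m \<in> M\<close>] by (simp add: fcoeff_def)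
    qed
    finally show ?thesis .
  qed
  have sg: "integral {0..2} (\<lambda>x. s x * cnj (g x)) = of_real (2 * (\<Sum>m\<in>M. (cmod (fcoeff g m))\<^sup>2))"
  proof -
    have "integral {0..2} (\<lambda>x. s x * cnj (g x)) = integral {0..2} (\<lambda>x. \<Sum>m\<in>M. fcoeff g m * (fexp m x * cnj (g x)))"
      by (simp add: s_def[abs_def] sum_distrib_right mult.assoc)
    also have "\<dots> = (\<Sum>m\<in>M. fcoeff g m * integral {0..2} (\<lambda>x. fexp m x * cnj (g x)))"
      using \<open>finite M\<close> by (subst integral_sum) (auto intro!: int continuous_intros g)
    also have "\<dots> = (\<Sum>m\<in>M. fcoeff g m * (2 * cnj (fcoeff g m)))"
    proof (intro sum.cong refl)
      fix m
      have "integral {0..2} (\<lambda>x. fexp m x * cnj (g x)) = integral {0..2} (\<lambda>x. cnj (g x * fexp (- m) x))"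
        by (simp add: mult.commute)
      also have "\<dots> = 2 * cnj (fcoeff g m)"
        by (simp add: fcoeff_def Henstock_Kurzweil_Integration.integral_cnj)
      finally show "fcoeff g m * integral {0..2} (\<lambda>x. fexp m x * cnj (g x)) = fcoeff g m * (2 * cnj (fcoeff g m))" by simp
    qed
    also have "\<dots> = of_real (2 * (\<Sum>m\<in>M. (cmod (fcoeff g m))\<^sup>2))"
    proof -
      have "fcoeff g m * (2 * cnj (fcoeff g m)) = of_real (2 * (cmod (fcoeff g m))\<^sup>2)" for m
        by (simp only: of_real_mult complex_norm_square of_real_numeral mult.left_commute)
      then show ?thesis by (simp only: of_real_sum sum_distrib_left)
    qed
    finally show ?thesis .
  qed
  have "integral {0..2} (\<lambda>x. of_real ((cmod (g x - s x))\<^sup>2) :: complex)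
      = integral {0..2} (\<lambda>x. (of_real ((cmod (g x))\<^sup>2) - s x * cnj (g x)) - (g x - s x) * cnj (s x))"
    by (rule integral_cong) (simp add: complex_norm_square algebra_simps del: of_real_power)
  also have "\<dots> = integral {0..2} (\<lambda>x. of_real ((cmod (g x))\<^sup>2)) - integral {0..2} (\<lambda>x. s x * cnj (g x))
      - integral {0..2} (\<lambda>x. (g x - s x) * cnj (s x))"
    by (subst integral_diff, (intro int continuous_intros g s)+)+ simp
  finally have eq: "integral {0..2} (\<lambda>x. of_real ((cmod (g x - s x))\<^sup>2) :: complex)
      = integral {0..2} (\<lambda>x. of_real ((cmod (g x))\<^sup>2)) - integral {0..2} (\<lambda>x. s x * cnj (g x))
        - integral {0..2} (\<lambda>x. (g x - s x) * cnj (s x))" .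
  have int_gs: "(\<lambda>x. (cmod (g x - s x))\<^sup>2) integrable_on {0..2}"
    and int_g: "(\<lambda>x. (cmod (g x))\<^sup>2) integrable_on {0..2}"
    by (intro int continuous_intros g s)+
  from eq have "of_real (integral {0..2} (\<lambda>x. (cmod (g x - s x))\<^sup>2))
      = (of_real (integral {0..2} (\<lambda>x. (cmod (g x))\<^sup>2) - 2 * (\<Sum>m\<in>M. (cmod (fcoeff g m))\<^sup>2)) :: complex)"
    unfolding orth sg
      integral_of_real_complex[OF int_gs] integral_of_real_complex[OF int_g]
    by (simp only: of_real_diff diff_zero)
  then have "integral {0..2} (\<lambda>x. (cmod (g x - s x))\<^sup>2)
      = integral {0..2} (\<lambda>x. (cmod (g x))\<^sup>2) - 2 * (\<Sum>m\<in>M. (cmod (fcoeff g m))\<^sup>2)"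
    by (simp only: of_real_eq_iff)
  moreover have "0 \<le> integral {0..2} (\<lambda>x. (cmod (g x - s x))\<^sup>2)"
    by (intro integral_nonneg int continuous_intros g s) simp
  ultimately show ?thesis by simp
qed

lemma bounded_constant_sums_imp_zero:
  fixes A :: real
  assumes "infinite I" "\<And>M. finite M \<Longrightarrow> M \<subseteq> I \<Longrightarrow> (\<Sum>m\<in>M. A\<^sup>2) \<le> K"
  shows "A = 0"
proof (rule ccontr)
  assume "A \<noteq> 0"
  obtain n where n: "K / A\<^sup>2 < of_nat n" using reals_Archimedean2 by blast
  obtain M where M: "finite M" "card M = n" "M \<subseteq> I"
    using infinite_arbitrarily_large[OF assms(1)] by blast
  have "of_nat n * A\<^sup>2 \<le> K" using assms(2)[OF M(1,3)] M(2) by simp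
  then show False using n \<open>A \<noteq> 0\<close> by (simp add: pos_divide_less_eq)
qed

lemma fcoeff_const: "fcoeff (\<lambda>x. z) m = (if m = 0 then z else 0)"
proof -
  have "fcoeff (\<lambda>x. z) m = z * integral {0..2} (fexp (- m)) / 2" by (simp add: fcoeff_def)
  then show ?thesis unfolding integral_fexp_period by auto
qed

text \<open>Dividing \<open>u - u x0\<close> by \<open>fexp 1 - fexp 1 x0\<close> turns the vanishing of the Fourier coefficients of \<open>u\<close> into
  the constancy of the moduli of those of the quotient on both half-lines.\<close>

lemma fourier_unique_at:
  assumes u: "\<And>x. (u has_vector_derivative u' x) (at x)" and zero: "\<And>m. fcoeff u m = 0" and x0: "0 < x0" "x0 < 2"
  shows "u x0 = 0"
proof -
  \<comment> \<open>The value at x0 is the quotient of the derivatives of numerator and denominator,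
    which makes g continuous.\<close>
  define g where "g x = (if x = x0 then u' x0 / (\<i> * of_real pi * fexp 1 x0) else (u x - u x0) / (fexp 1 x - fexp 1 x0))" for x
  \<comment> \<open>The denominator has no other zero on the closed period because x0 is an interior
    point; for x0 at one end, the opposite end would be a second zero.\<close>
  have ee1: "fexp 1 x \<noteq> fexp 1 x0" if "x \<in> {0..2}" "x \<noteq> x0" for x
  proof
    assume "fexp 1 x = fexp 1 x0"
    then have "exp (\<i> * of_real (pi * x)) = exp (\<i> * of_real (pi * x0))"
      by (simp add: fexp_def cis_conv_exp)
    then obtain n :: int where "\<i> * of_real (pi * x) = \<i> * of_real (pi * x0) + (of_int (2 * n) * pi) * \<i>"
      unfolding exp_eq by auto
    then have "Im (\<i> * of_real (pi * x)) = Im (\<i> * of_real (pi * x0) + (of_int (2 * n) * pi) * \<i>)" by simp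
    then have "pi * x = pi * (x0 + 2 * of_int n)" by (simp add: algebra_simps)
    then have x: "x = x0 + 2 * of_int n" by simp
    then have "- 2 < 2 * real_of_int n" "2 * real_of_int n < 2"
      using that x0 by auto
    then have "n = 0" by linarith
    then show False using x that by simp
  qed
  have uc: "continuous_on A u" for A
    by (meson u continuous_at_imp_continuous_on has_vector_derivative_continuous)
  have quot: "((\<lambda>x. (f x - f x0) / of_real (x - x0)) \<longlongrightarrow> d) (at x0)"
    if "(f has_vector_derivative d) (at x0)" for f :: "real \<Rightarrow> complex" and d
  proof -
    have "((\<lambda>y. norm ((f y - f x0) - (y - x0) *\<^sub>R d) / norm (y - x0)) \<longlongrightarrow> 0) (at x0)"
      using that by (simp add: has_vector_derivative_def has_derivative_iff_norm)
    moreover have "\<forall>\<^sub>F y in at x0. norm ((f y - f x0) - (y - x0) *\<^sub>R d) / norm (y - x0)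
        = norm ((f y - f x0) / of_real (y - x0) - d)"
    proof (rule eventually_at_filter[THEN iffD2], intro always_eventually allI impI)
      fix y assume "y \<noteq> x0"
      then have "(f y - f x0) / of_real (y - x0) - d = ((f y - f x0) - (y - x0) *\<^sub>R d) / of_real (y - x0)"
        by (simp add: scaleR_conv_of_real diff_divide_distrib)
      then show "norm ((f y - f x0) - (y - x0) *\<^sub>R d) / norm (y - x0)
          = norm ((f y - f x0) / of_real (y - x0) - d)"
        by (simp only: norm_divide norm_of_real real_norm_def)
    qed
    ultimately have "((\<lambda>y. norm ((f y - f x0) / of_real (y - x0) - d)) \<longlongrightarrow> 0) (at x0)"
      by (rule Lim_transform_eventually)
    then show ?thesis by (rule tendsto_norm_zero_cancel[THEN LIM_zero_cancel])
  qed
  have "continuous_on {0..2} g"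
  proof (rule continuous_at_imp_continuous_on, rule ballI)
    fix x :: real assume x: "x \<in> {0..2}"
    show "isCont g x"
    proof (cases "x = x0")
      case True
      have d: "\<i> * of_real pi * fexp 1 x0 \<noteq> 0" by (simp add: fexp_def)
      have "((\<lambda>x. ((u x - u x0) / of_real (x - x0)) / ((fexp 1 x - fexp 1 x0) / of_real (x - x0)))
          \<longlongrightarrow> u' x0 / (\<i> * of_real pi * fexp 1 x0)) (at x0)"
        using quot[OF u] quot[OF fexp_has_vector_derivative[of 1 x0 UNIV]] d
        by (intro tendsto_divide) auto
      moreover have "\<forall>\<^sub>F x in at x0. ((u x - u x0) / of_real (x - x0)) / ((fexp 1 x - fexp 1 x0) / of_real (x - x0)) = g x"
        unfolding eventually_at by (intro exI[of _ 1]) (auto simp: g_def)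
      ultimately have "(g \<longlongrightarrow> u' x0 / (\<i> * of_real pi * fexp 1 x0)) (at x0)"
        by (rule Lim_transform_eventually)
      then show ?thesis using True by (simp add: isCont_def g_def)
    next
      case False
      have "isCont (\<lambda>x. (u x - u x0) / (fexp 1 x - fexp 1 x0)) x"
        using ee1[OF x False] uc[of UNIV] continuous_on_fexp[of UNIV 1]
        by (intro continuous_intros) (auto simp: continuous_on_eq_continuous_at)
      moreover have "\<forall>\<^sub>F y in nhds x. (u y - u x0) / (fexp 1 y - fexp 1 x0) = g y"
        using t1_space_nhds[OF False] by eventually_elim (simp add: g_def)
      ultimately show ?thesis using isCont_cong by force
    qed
  qed
  note gc = this
  have ug: "u x - u x0 = fexp 1 x * g x - fexp 1 x0 * g x" if "x \<in> {0..2}" for x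
  proof (cases "x = x0")
    case False
    then have "(fexp 1 x - fexp 1 x0) * g x = u x - u x0"
      using ee1[OF that False] by (simp add: g_def)
    then show ?thesis by (simp only: left_diff_distrib)
  qed simp
  define c where "c m = fcoeff g m" for m
  define z where "z = fexp 1 x0"
  have "cmod z = 1" by (simp add: z_def)
  \<comment> \<open>Multiplying by \<open>fexp 1\<close> shifts the coefficients by one, and the
    function \<open>u x - u x0\<close> has only the coefficient \<open>- u x0\<close>, at index 0.
    Once Bessel's inequality has removed both half-lines, the equation at m = 0 is the
    claim.\<close>
  have rec: "(if m = 0 then - u x0 else 0) = c (m - 1) - z * c m" for m
  proof -
    have "fcoeff (\<lambda>x. u x - 1 * (\<lambda>x. u x0) x) m = fcoeff u m - 1 * fcoeff (\<lambda>x. u x0) m"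
      by (rule fcoeff_lincomb) (auto intro: uc)
    then have "fcoeff (\<lambda>x. u x - u x0) m = (if m = 0 then - u x0 else 0)"
      by (simp add: zero fcoeff_const)
    moreover have "fcoeff (\<lambda>x. u x - u x0) m = fcoeff (\<lambda>x. fexp 1 x * g x - z * g x) m"
      unfolding fcoeff_def z_def using ug by (auto intro!: arg_cong[where f="\<lambda>t. t / 2"] integral_cong)
    moreover have "\<dots> = fcoeff (\<lambda>x. fexp 1 x * g x) m - z * c m"
      unfolding c_def by (rule fcoeff_lincomb) (intro continuous_intros gc)+
    moreover have "fcoeff (\<lambda>x. fexp 1 x * g x) m = c (m - 1)"
    proof -
      have "fexp 1 x * g x * fexp (- m) x = g x * fexp (- (m - 1)) x" for x
        using fexp_mult[of 1 x "- m"] by (simp add: mult_ac)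
      then show ?thesis by (simp only: c_def fcoeff_def)
    qed
    ultimately show ?thesis by simp
  qed
  have step: "cmod (c (m - 1)) = cmod (c m)" if "m \<noteq> 0" for m
  proof -
    have "c (m - 1) = z * c m" using rec[of m] that by simp
    then show ?thesis using \<open>cmod z = 1\<close> by (simp add: norm_mult)
  qed
  have pos: "cmod (c (int k)) = cmod (c 0)" for k
  proof (induction k)
    case (Suc k) then show ?case using step[of "int (Suc k)"] by simp
  qed simp
  have neg: "cmod (c (- 1 - int k)) = cmod (c (- 1))" for k
  proof (induction k)
    case (Suc k) then show ?case using step[of "- 1 - int k"] by (simp add: algebra_simps)
  qed simp
  let ?K = "integral {0..2} (\<lambda>x. (cmod (g x))\<^sup>2) / 2"
  have "cmod (c 0) = 0"
  proof (rule bounded_constant_sums_imp_zero)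
    show "infinite (range int)" by (simp add: range_inj_infinite)
    fix M assume M: "finite M" "M \<subseteq> range int"
    have "(\<Sum>m\<in>M. (cmod (c 0))\<^sup>2) = (\<Sum>m\<in>M. (cmod (fcoeff g m))\<^sup>2)"
      using M(2) pos by (intro sum.cong) (auto simp: c_def)
    then show "(\<Sum>m\<in>M. (cmod (c 0))\<^sup>2) \<le> ?K" using bessel[OF gc M(1)] by simp
  qed
  moreover have "cmod (c (- 1)) = 0"
  proof (rule bounded_constant_sums_imp_zero)
    show "infinite (range (\<lambda>k. - 1 - int k))" by (rule range_inj_infinite) (auto simp: inj_def)
    fix M assume M: "finite M" "M \<subseteq> range (\<lambda>k. - 1 - int k)"
    have "(\<Sum>m\<in>M. (cmod (c (- 1)))\<^sup>2) = (\<Sum>m\<in>M. (cmod (fcoeff g m))\<^sup>2)"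
      using M(2) neg by (intro sum.cong) (auto simp: c_def)
    then show "(\<Sum>m\<in>M. (cmod (c (- 1)))\<^sup>2) \<le> ?K" using bessel[OF gc M(1)] by simp
  qed
  ultimately show ?thesis using rec[of 0] by simp
qed

text \<open>Interior points of the period come from \<open>fourier_unique_at\<close>, its two ends
  from continuity, all other points from periodicity.\<close>

lemma fourier_unique:
  assumes u: "\<And>x. (u has_vector_derivative u' x) (at x)" and zero: "\<And>m. fcoeff u m = 0"
    and per: "\<And>x. u (x + 2) = u x"
  shows "u x = 0"
proof -
  have uc: "continuous_on A u" for A
    by (meson u continuous_at_imp_continuous_on has_vector_derivative_continuous)
  have in_period: "u x = 0" if "x \<in> {0..2}" for x
  proof (rule continuous_constant_on_closure[OF uc])
    show "x \<in> closure {0<..<2}" using that by simp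
    show "u x = 0" if "x \<in> {0<..<2}" for x
      using fourier_unique_at[OF u zero] that by simp
  qed
  have per_nat: "u (x + 2 * of_nat n) = u x" for x n
  proof (induction n)
    case (Suc n)
    then show ?case using per[of "x + 2 * of_nat n"] by (simp add: algebra_simps)
  qed simp
  have per_int: "u (x + 2 * of_int n) = u x" for n
  proof (cases n rule: int_cases2)
    case (nonneg k) then show ?thesis using per_nat[of x k] by simp
  next
    case (nonpos k) then show ?thesis using per_nat[of "x - 2 * of_nat k" k] by simp
  qed
  define n where "n = - \<lfloor>x / 2\<rfloor>"
  have "x + 2 * of_int n \<in> {0..2}" unfolding n_def by (simp; linarith)
  then show ?thesis using in_period per_int[of n] by metis
qed

section \<open>Root spaces of functions\<close>

lemma continuous_borel_measurable_lebesgue: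
  fixes f :: "real \<Rightarrow> complex"
  shows "continuous_on UNIV f \<Longrightarrow> f \<in> borel_measurable lebesgue"
  by (intro measurable_completion) (simp add: borel_measurable_continuous_onI)

lemma continuous_L2_per:
  assumes "continuous_on UNIV f" "\<And>x. f (x + T) = f x" shows "f \<in> L2_per T"
  unfolding L2_per_def
  by (auto intro!: assms continuous_borel_measurable_lebesgue absolutely_integrable_continuous_real
      continuous_intros continuous_on_subset[OF assms(1)])

lemma LINT_continuous:
  fixes h :: "real \<Rightarrow> complex"
  assumes "continuous_on UNIV h"
  shows "(LINT x:{a..b}|lebesgue. h x) = integral {a..b} h"
  by (rule set_lebesgue_integral_eq_integral(2)[OF absolutely_integrable_continuous_real])
    (rule continuous_on_subset[OF assms subset_UNIV])

lemma toeplitz_decays: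
  assumes "omega_bounded p" obtains S where "decay.decays 1 S (toeplitz p)"
proof -
  interpret decay 1 by unfold_locales simp
  obtain C where C: "\<And>m. cmod (p m) \<le> C * omega m" using assms by (meson omega_boundedE)
  have "decays (C * omegaC) (toeplitz p)"
    unfolding decays_def toeplitz_def kappa_def using C omegaC_ge by simp
  then show ?thesis by (rule that)
qed

lemma omega_bounded_matvec:
  assumes "omega_bounded p" "omega_bounded c" shows "omega_bounded (matvec (toeplitz p) c)"
proof -
  interpret decay 1 by unfold_locales simp
  obtain S where S: "decays S (toeplitz p)" using toeplitz_decays[OF assms(1)] .
  obtain C where C: "\<And>m. cmod (c m) \<le> C * omega m" using assms(2) by (meson omega_boundedE)
  show ?thesis unfolding omega_bounded_def using matvec_bound[OF S admissible_omega C] by blast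
qed

text \<open>The convolution theorem; absolute summability of p and c justifies exchanging the
  sums.\<close>

lemma fser_mult:
  assumes p: "omega_bounded p" and c: "omega_bounded c"
  shows "fser (matvec (toeplitz p) c) x = fser p x * fser c x"
proof -
  define P where "P = (\<Sum>\<^sub>\<infinity>m. cmod (p m))"
  have hs: "((\<lambda>m. cmod (p (m - k))) has_sum P) UNIV" for k
    unfolding P_def using omega_bounded_summable[OF p]
    by (simp add: has_sum_iff summable_on_shift_int[where f="\<lambda>m. cmod (p m)"] infsum_shift_int[where f="\<lambda>m. cmod (p m)"])
  have "(\<lambda>q. cmod ((\<lambda>(k, m). p (m - k) * c k * fexp m x) q)) summable_on UNIV \<times> UNIV"
  proof (rule summable_on_SigmaI[where g="\<lambda>k. P * cmod (c k)"])
    show "((\<lambda>m. cmod (case (k, m) of (k, m) \<Rightarrow> p (m - k) * c k * fexp m x)) has_sum P * cmod (c k)) UNIV" for k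
      using has_sum_cmult_left[OF hs[of k], of "cmod (c k)"] by (simp add: norm_mult)
    show "(\<lambda>k. P * cmod (c k)) summable_on UNIV"
      by (rule summable_on_cmult_right[OF omega_bounded_summable[OF c]])
  qed auto
  then have s: "(\<lambda>(k, m). p (m - k) * c k * fexp m x) summable_on UNIV \<times> UNIV"
    by (rule abs_summable_summable)
  have "fser (matvec (toeplitz p) c) x = (\<Sum>\<^sub>\<infinity>m. \<Sum>\<^sub>\<infinity>k. p (m - k) * c k * fexp m x)"
    by (simp add: fser_def matvec_def toeplitz_def infsum_cmult_left')
  also have "\<dots> = (\<Sum>\<^sub>\<infinity>k. \<Sum>\<^sub>\<infinity>m. p (m - k) * c k * fexp m x)"
    by (rule infsum_swap_banach[OF s, symmetric])
  also have "\<dots> = (\<Sum>\<^sub>\<infinity>k. fser p x * (c k * fexp k x))"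
  proof (rule infsum_cong)
    fix k
    have "(\<Sum>\<^sub>\<infinity>m. p (m - k) * c k * fexp m x) = (\<Sum>\<^sub>\<infinity>m. (p (m - k) * fexp (m - k) x) * (c k * fexp k x))"
    proof (rule infsum_cong)
      fix m show "p (m - k) * c k * fexp m x = (p (m - k) * fexp (m - k) x) * (c k * fexp k x)"
        using fexp_mult[of "m - k" x k] by (simp add: mult_ac)
    qed
    also have "\<dots> = (\<Sum>\<^sub>\<infinity>m. p (m - k) * fexp (m - k) x) * (c k * fexp k x)"
      by (rule infsum_cmult_left')
    also have "(\<Sum>\<^sub>\<infinity>m. p (m - k) * fexp (m - k) x) = fser p x"
      unfolding fser_def by (rule infsum_shift_int[where f="\<lambda>m. p m * fexp m x"])
    finally show "(\<Sum>\<^sub>\<infinity>m. p (m - k) * c k * fexp m x) = fser p x * (c k * fexp k x)" .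
  qed
  also have "\<dots> = fser p x * fser c x"
    unfolding fser_def[of c] by (rule infsum_cmult_right')
  finally show ?thesis .
qed

lemma fcoeff_mult:
  assumes p: "omega_bounded p" and f: "continuous_on {0..2} f"
  shows "fcoeff (\<lambda>x. fser p x * f x) m = matvec (toeplitz p) (fcoeff f) m"
proof -
  have "((\<lambda>k. p k * integral {0..2} (\<lambda>x. fexp k x * (f x * fexp (- m) x))) has_sum
      integral {0..2} (\<lambda>x. fser p x * (f x * fexp (- m) x))) UNIV"
    by (rule integral_fser_mult[OF p]) (intro continuous_intros f)
  moreover have "integral {0..2} (\<lambda>x. fexp k x * (f x * fexp (- m) x)) = 2 * fcoeff f (m - k)" for k
  proof -
    have "fexp k x * (f x * fexp (- m) x) = f x * fexp (- (m - k)) x" for x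
      using fexp_mult[of k x "- m"] by (simp add: mult.left_commute)
    then show ?thesis by (simp only: fcoeff_def) simp
  qed
  ultimately have "((\<lambda>k. 2 * (p k * fcoeff f (m - k))) has_sum 2 * fcoeff (\<lambda>x. fser p x * f x) m) UNIV"
    by (simp add: fcoeff_def mult_ac)
  from has_sum_cmult_right[OF this, of "1 / 2"]
  have "((\<lambda>k. p k * fcoeff f (m - k)) has_sum fcoeff (\<lambda>x. fser p x * f x) m) UNIV"
    by simp
  then have "fcoeff (\<lambda>x. fser p x * f x) m = (\<Sum>\<^sub>\<infinity>k. p k * fcoeff f (m - k))"
    by (simp add: infsumI)
  also have "\<dots> = matvec (toeplitz p) (fcoeff f) m"
    using infsum_reflect_int[where f="\<lambda>k. p k * fcoeff f (m - k)" and m=m] by (simp add: matvec_def toeplitz_def)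
  finally show ?thesis .
qed

text \<open>The equation supplies the regularity: \<open>(pi m)^2 c m\<close> equals the sequence d,
  which is \<open>omega_bounded\<close>, so \<open>fser c\<close> can be differentiated twice
  termwise.\<close>

lemma root_seq_imp_root_space:
  assumes p: "omega_bounded p" and "c \<in> root_seq p \<mu> k"
  shows "fser c \<in> root_space (fser p) \<mu> k"
  using assms(2)
proof (induction k arbitrary: c)
  case (Suc k)
  then obtain g where g: "g \<in> root_seq p \<mu> k" "\<And>m. hill_seq p c m = \<mu> * c m + g m"
    and c: "omega_bounded c" by auto
  have gb: "omega_bounded g" using root_seq_omega_bounded[OF g(1)] .
  have rg: "fser g \<in> root_space (fser p) \<mu> k" by (rule Suc.IH[OF g(1)])
  let ?z = "\<lambda>m. \<i> * of_real (pi * of_int m)"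
  define d where "d m = (\<mu> * c m + g m) - matvec (toeplitz p) c m" for m
  have d: "omega_bounded d"
    unfolding d_def[abs_def] by (intro omega_bounded_diff omega_bounded_add omega_bounded_scale omega_bounded_matvec p c gb)
  have dc: "of_real ((pi * of_int m)\<^sup>2) * c m = d m" for m
    using g(2)[of m] by (simp add: d_def hill_seq_def algebra_simps)
  have c1: "omega_bounded (\<lambda>m. ?z m * c m)"
    by (rule omega_bounded_derivative[OF c]) (unfold dc, rule d)
  have zz: "?z m * (?z m * c m) = - 1 * d m" for m
  proof -
    have "?z m * (?z m * c m) = - (of_real ((pi * of_int m)\<^sup>2) * c m)"
      by (simp add: power2_eq_square mult_ac)
    then show ?thesis using dc by simp
  qed
  have c2: "omega_bounded (\<lambda>m. ?z m * (?z m * c m))"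
    unfolding zz by (rule omega_bounded_scale[OF d])
  define h where "h = fser (\<lambda>m. ?z m * (?z m * c m))"
  have h: "continuous_on UNIV h" unfolding h_def by (rule continuous_on_fser[OF c2])
  have h_eq: "h x = fser p x * fser c x - (\<mu> * fser c x + fser g x)" for x
  proof -
    have "h x = - 1 * fser d x" unfolding h_def zz by (rule fser_scale)
    also have "fser d x = (\<mu> * fser c x + fser g x) - fser p x * fser c x"
      unfolding d_def[abs_def]
      by (simp add: fser_diff fser_add fser_scale fser_mult omega_bounded_add omega_bounded_scale omega_bounded_matvec p c gb)
    finally show ?thesis by simp
  qed
  have "has_second_derivative (fser c) h"
    unfolding has_second_derivative_def
  proof (intro conjI exI[of _ "fser (\<lambda>m. ?z m * c m)"] allI impI)
    show "h \<in> L2_per 2" by (rule continuous_L2_per[OF h]) (simp add: h_def fser_periodic)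
    show "(fser c has_vector_derivative fser (\<lambda>m. ?z m * c m) x) (at x)" for x
      by (rule fser_has_vector_derivative[OF c c1])
    fix a b :: real assume "a \<le> b"
    then have "(h has_integral fser (\<lambda>m. ?z m * c m) b - fser (\<lambda>m. ?z m * c m) a) {a..b}"
      unfolding h_def by (rule fundamental_theorem_of_calculus)
        (rule has_vector_derivative_at_within[OF fser_has_vector_derivative[OF c1 c2]])
    then show "fser (\<lambda>m. ?z m * c m) b - fser (\<lambda>m. ?z m * c m) a = (LINT x:{a..b}|lebesgue. h x)"
      unfolding LINT_continuous[OF h] by (simp add: integral_unique)
  qed
  then have "hill_op (fser p) (fser c) (\<lambda>x. \<mu> * fser c x + fser g x)"
    unfolding hill_op_def by (auto simp: fser_periodic h_eq intro!: exI[of _ h])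
  then show ?case using rg by auto
qed simp

text \<open>A regularity bootstrap: all other terms of the equation are continuous, so f is twice
  continuously differentiable. Bounded coefficients of f and of its second derivative then show that
  c is \<open>omega_bounded\<close>, and f equals its series by uniqueness, since both are
  differentiable.\<close>

lemma root_space_imp_root_seq:
  assumes p: "omega_bounded p" and "f \<in> root_space (fser p) \<mu> k"
  obtains c where "c \<in> root_seq p \<mu> k" "f = fser c"
  using assms(2)
proof (induction k arbitrary: f thesis)
  case 0
  then show ?case by auto
next
  case (Suc k)
  then obtain g where g: "g \<in> root_space (fser p) \<mu> k" and hill: "hill_op (fser p) f (\<lambda>x. \<mu> * f x + g x)"
    by auto
  obtain d where d: "d \<in> root_seq p \<mu> k" "g = fser d" using Suc.IH[OF _ g] by blast
  have db: "omega_bounded d" by (rule root_seq_omega_bounded[OF d(1)])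
  obtain h where per: "\<And>x. f (x + 2) = f x" and h2: "has_second_derivative f h"
    and ae: "AE x in lebesgue. - h x + fser p x * f x = \<mu> * f x + g x"
    using hill unfolding hill_op_def by blast
  obtain f' where f': "\<And>x. (f has_vector_derivative f' x) (at x)"
    and f'h: "\<And>a b. a \<le> b \<Longrightarrow> f' b - f' a = (LINT x:{a..b}|lebesgue. h x)"
    and hL2: "h \<in> L2_per 2"
    using h2 unfolding has_second_derivative_def by blast
  have f_cont: "continuous_on A f" for A
    by (meson f' continuous_at_imp_continuous_on has_vector_derivative_continuous)
  \<comment> \<open>The continuous representative of the second derivative h.\<close>
  define H where "H x = fser p x * f x - (\<mu> * f x + fser d x)" for x
  have H: "continuous_on A H" for A
    unfolding H_def[abs_def] by (intro continuous_intros continuous_on_fser p db f_cont)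
  have hH: "f' b - f' a = integral {a..b} H" if "a \<le> b" for a b
  proof -
    have "(LINT x:{a..b}|lebesgue. h x) = (LINT x:{a..b}|lebesgue. H x)"
    proof (rule set_lebesgue_integral_cong_AE)
      show "h \<in> borel_measurable lebesgue" using hL2 by (simp add: L2_per_def)
      show "H \<in> borel_measurable lebesgue" by (rule continuous_borel_measurable_lebesgue[OF H])
      show "AE x\<in>{a..b} in lebesgue. h x = H x"
        using ae by eventually_elim (auto simp: H_def d(2) algebra_simps)
    qed auto
    then show ?thesis using f'h[OF that] LINT_continuous[OF H] by simp
  qed
  have f'': "(f' has_vector_derivative H x) (at x)" for x
    by (rule continuous_derivative_of_integral[OF H hH])
  have f'c: "continuous_on A f'" for A
    by (meson f'' continuous_at_imp_continuous_on has_vector_derivative_continuous)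
  \<comment> \<open>Periodicity of f' removes the boundary terms when its derivative is integrated
    against a character.\<close>
  have per': "f' (x + 2) = f' x" for x
  proof -
    have "((\<lambda>y. y + 2) has_real_derivative 1) (at x)"
      by (auto intro!: derivative_eq_intros)
    from vector_diff_chain_at[OF this[THEN has_real_derivative_iff_has_vector_derivative[THEN iffD1]], of f "f' (x + 2)"]
    have "((f \<circ> (\<lambda>y. y + 2)) has_vector_derivative f' (x + 2)) (at x)"
      using f'[of "x + 2"] by simp
    moreover have "f \<circ> (\<lambda>y. y + 2) = f" by (simp add: per fun_eq_iff)
    ultimately show ?thesis using f'[of x] vector_derivative_unique_at by metis
  qed
  define c where "c = fcoeff f"
  have fcH: "fcoeff H m = - (of_real ((pi * of_int m)\<^sup>2) * c m)" for m
    using fcoeff_derivative[OF f'' H per', of m] fcoeff_derivative[OF f' f'c per, of m]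
    by (simp add: c_def power2_eq_square mult_ac)
  have fcH': "fcoeff H m = matvec (toeplitz p) c m - (\<mu> * c m + d m)" for m
  proof -
    have H_eq: "H = (\<lambda>x. (fser p x * f x - \<mu> * f x) - 1 * fser d x)"
      by (simp add: H_def fun_eq_iff)
    have "fcoeff H m = fcoeff (\<lambda>x. fser p x * f x - \<mu> * f x) m - 1 * fcoeff (fser d) m"
      unfolding H_eq by (rule fcoeff_lincomb) (intro continuous_intros continuous_on_fser p db f_cont)+
    also have "fcoeff (\<lambda>x. fser p x * f x - \<mu> * f x) m = fcoeff (\<lambda>x. fser p x * f x) m - \<mu> * fcoeff f m"
      by (rule fcoeff_lincomb) (intro continuous_intros continuous_on_fser p db f_cont)+
    finally show ?thesis using fcoeff_mult[OF p f_cont, of m] fcoeff_fser[OF db] by (simp add: c_def)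
  qed
  have hs: "hill_seq p c m = \<mu> * c m + d m" for m
  proof -
    have "of_real ((pi * of_int m)\<^sup>2) * c m = - fcoeff H m"
      unfolding fcH by (simp only: minus_minus)
    then show ?thesis unfolding hill_seq_def fcH'[of m] by simp
  qed
  obtain K where K: "\<And>m. cmod (fcoeff f m) \<le> K" by (meson fcoeff_bound f_cont)
  obtain K' where K': "\<And>m. cmod (fcoeff H m) \<le> K'" by (meson fcoeff_bound H)
  \<comment> \<open>The bounds for \<open>c m\<close> and for \<open>m^2 c m\<close> add up to one
    for \<open>(1 + m^2) c m\<close>, the reciprocal weight of \<open>omega\<close>.\<close>
  have cb: "omega_bounded c"
    unfolding omega_bounded_def
  proof (intro exI[of _ "K + K'"] allI)
    fix m
    have "1 \<le> pi\<^sup>2" by (rule one_le_power) (use pi_ge_two in simp)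
    then have "1 * ((of_int m)\<^sup>2 * cmod (c m)) \<le> pi\<^sup>2 * ((of_int m)\<^sup>2 * cmod (c m))"
      by (rule mult_right_mono) simp
    also have "\<dots> = cmod (fcoeff H m)"
      unfolding fcH norm_minus_cancel norm_mult norm_of_real by (simp add: power_mult_distrib)
    also have "\<dots> \<le> K'" by (rule K')
    finally have "(of_int m)\<^sup>2 * cmod (c m) \<le> K'" by simp
    moreover have "cmod (c m) \<le> K" unfolding c_def by (rule K)
    ultimately have "(1 + (of_int m)\<^sup>2) * cmod (c m) \<le> K + K'"
      unfolding distrib_right by linarith
    then show "cmod (c m) \<le> (K + K') * omega m"
      by (simp add: omega_def pos_le_divide_eq add_pos_nonneg mult.commute)
  qed
  have c_root: "c \<in> root_seq p \<mu> (Suc k)" using cb d(1) hs by auto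
  have "omega_bounded (\<lambda>m. of_real ((pi * of_int m)\<^sup>2) * c m)"
  proof -
    have "of_real ((pi * of_int m)\<^sup>2) * c m = (\<mu> * c m + d m) - matvec (toeplitz p) c m" for m
      using hs[of m] by (simp add: hill_seq_def algebra_simps)
    then show ?thesis by (simp add: omega_bounded_diff omega_bounded_add omega_bounded_scale omega_bounded_matvec p cb db)
  qed
  from fser_has_vector_derivative[OF cb omega_bounded_derivative[OF cb this]]
  have u: "((\<lambda>x. f x - fser c x) has_vector_derivative
      f' x - fser (\<lambda>m. (\<i> * of_real (pi * of_int m)) * c m) x) (at x)" for x
    by (intro has_vector_derivative_diff f')
  have "f x - fser c x = 0" for x
  proof (rule fourier_unique[OF u])
    show "fcoeff (\<lambda>x. f x - fser c x) m = 0" for m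
      using fcoeff_lincomb[OF f_cont continuous_on_fser[OF cb], of 1 m] fcoeff_fser[OF cb] by (simp add: c_def)
    show "f (x + 2) - fser c (x + 2) = f x - fser c x" for x by (simp add: per fser_periodic)
  qed
  then have "f = fser c" by (simp add: fun_eq_iff)
  then show ?case using Suc.prems(1) c_root by blast
qed

text \<open>The character of index n for period 1 is the one of index 2 n for period 2. On the unit
  interval the even characters are orthogonal, and the coefficients at odd indices vanish.\<close>

lemma fourier_coeff_fser:
  assumes p: "omega_bounded p" and odd: "\<And>k. odd k \<Longrightarrow> p k = 0"
  shows "fourier_coeff (fser p) n = p (2 * n)"
proof -
  have cis_fexp: "cis (- (2 * of_int n * pi * x)) = fexp (- (2 * n)) x" for x
    by (simp add: fexp_def mult_ac)
  have "fourier_coeff (fser p) n = integral {0..1} (\<lambda>x. fser p x * fexp (- (2 * n)) x)"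
    unfolding fourier_coeff_def cis_fexp
    by (rule LINT_continuous) (intro continuous_intros continuous_on_fser p)
  moreover have sum: "((\<lambda>k. p k * integral {0..1} (\<lambda>x. fexp k x * fexp (- (2 * n)) x)) has_sum
      integral {0..1} (\<lambda>x. fser p x * fexp (- (2 * n)) x)) UNIV"
    by (rule integral_fser_mult[OF p]) (intro continuous_intros)
  moreover have coeff: "p k * integral {0..1} (\<lambda>x. fexp k x * fexp (- (2 * n)) x) = (if k = 2 * n then p (2 * n) else 0)" for k
  proof (cases "even k \<and> k \<noteq> 2 * n")
    case True
    define j where "j = k + - (2 * n)"
    have j: "even j" "j \<noteq> 0" using True by (auto simp: j_def)
    define z where "z = \<i> * of_real (pi * of_int j)"
    have "((\<lambda>x. z * fexp j x) has_integral (fexp j 1 - fexp j 0)) {0..1}"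
      unfolding z_def by (rule fundamental_theorem_of_calculus) (simp, rule fexp_has_vector_derivative)
    then have "((\<lambda>x. z * fexp j x) has_integral 0) {0..1}"
      using fexp_periodic_even[OF j(1), of 0] by simp
    from integral_unique[OF this] have "integral {0..1} (fexp j) = 0"
      using j(2) by (simp add: z_def)
    then show ?thesis using True unfolding fexp_mult j_def[symmetric] by simp
  next
    case False
    then consider "k = 2 * n" | "k \<noteq> 2 * n" "p k = 0" using odd by blast
    then show ?thesis
    proof cases
      case 1
      have "(\<lambda>x. fexp k x * fexp (- (2 * n)) x) = (\<lambda>x. 1)" by (simp add: fun_eq_iff fexp_mult 1)
      then show ?thesis using 1 by simp
    qed simp
  qed
  moreover have "((\<lambda>k. if k = 2 * n then p (2 * n) else 0) has_sum p (2 * n)) UNIV"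
    using has_sum_finite_neutralI[of "{2 * n}" UNIV "\<lambda>k. if k = 2 * n then p (2 * n) else 0"] by auto
  ultimately show ?thesis
    using has_sum_unique[OF sum[unfolded coeff]] by simp
qed

lemma fser_L2_per:
  assumes "omega_bounded p" "\<And>k. odd k \<Longrightarrow> p k = 0" shows "fser p \<in> L2_per 1"
  by (rule continuous_L2_per[OF continuous_on_fser[OF assms(1)]]) (rule fser_periodic_even[OF assms(2)])

section \<open>Multiplicities, ordering of the eigenvalues, and density\<close>

lemma sum_fun_apply: "(\<Sum>i\<in>A. F i) x = (\<Sum>i\<in>A. F i x)" for F :: "'i \<Rightarrow> 'a \<Rightarrow> 'b::comm_monoid_add"
  by (induction A rule: infinite_finite_induct) (auto simp: plus_fun_def zero_fun_def)

lemma fser_sum: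
  assumes "\<And>j. j \<in> J \<Longrightarrow> omega_bounded (f j)"
  shows "fser (\<lambda>m. \<Sum>j\<in>J. a j * f j m) x = (\<Sum>j\<in>J. a j * fser (f j) x)"
  using assms
proof (induction J rule: infinite_finite_induct)
  case (insert j J)
  have "fser (\<lambda>m. a j * f j m + (\<Sum>j\<in>J. a j * f j m)) x = fser (\<lambda>m. a j * f j m) x + fser (\<lambda>m. \<Sum>j\<in>J. a j * f j m) x"
    by (intro fser_add omega_bounded_scale omega_bounded_sum) (use insert in auto)
  then show ?case using insert by (simp add: fser_scale)
qed auto

context jordan_diagonalized
begin

lemma omega_bounded_p: "omega_bounded p"
  unfolding omega_bounded_def
proof (intro exI[of _ S] allI)
  fix m
  have "cmod (p m) \<le> S * kappa m" using decaysD[OF P_decays, of m 0] by (simp add: toeplitz_def)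
  also have "\<dots> \<le> S * omega m"
    using kappa_le decays_nonneg[OF P_decays] by (intro mult_left_mono) auto
  finally show "cmod (p m) \<le> S * omega m" .
qed

text \<open>The functions \<open>fser (\<psi> j)\<close> with \<nu> j = \<mu> form a basis of the
  root space. Independence passes from sequences to functions because \<open>fcoeff\<close> recovers
  the coefficients of a series.\<close>

lemma alg_multiplicity_fser: "alg_multiplicity (fser p) \<mu> = card {j. \<nu> j = \<mu>}"
proof -
  let ?J = "{j. \<nu> j = \<mu>}"
  let ?E = "(\<lambda>j. fser (\<psi> j)) ` ?J"
  have coeff: "(\<Sum>j\<in>J. a j * \<psi> j m) = 0" if "\<And>x. (\<Sum>j\<in>J. a j * fser (\<psi> j) x) = 0" for J a m
  proof -
    have "fser (\<lambda>m. \<Sum>j\<in>J. a j * \<psi> j m) = (\<lambda>x. 0)"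
      using that fser_sum[of J \<psi> a] omega_bounded_\<psi> by (simp add: fun_eq_iff)
    moreover have "omega_bounded (\<lambda>m. \<Sum>j\<in>J. a j * \<psi> j m)"
      by (intro omega_bounded_sum omega_bounded_scale omega_bounded_\<psi>)
    ultimately show ?thesis using fcoeff_fser[of "\<lambda>m. \<Sum>j\<in>J. a j * \<psi> j m" m] by (simp add: fcoeff_def)
  qed
  have inj: "inj_on (\<lambda>j. fser (\<psi> j)) ?J"
  proof (rule inj_onI, rule ccontr)
    fix i j assume eq: "fser (\<psi> i) = fser (\<psi> j)" and "i \<noteq> j"
    define a where "a k = (if k = i then 1 else - 1 :: complex)" for k
    have "(\<Sum>k\<in>{i, j}. a k * fser (\<psi> k) x) = 0" for x
      using \<open>i \<noteq> j\<close> eq by (simp add: a_def)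
    from \<psi>_independent[OF _ coeff[OF this], of i] show False by (simp add: a_def)
  qed
  have "card ?E = cfun.dim (\<Union>k. root_space (fser p) \<mu> k)"
  proof (rule cfun.basis_card_eq_dim)
    show "?E \<subseteq> (\<Union>k. root_space (fser p) \<mu> k)"
      using \<psi>_root root_seq_imp_root_space[OF omega_bounded_p] by fastforce
    show "(\<Union>k. root_space (fser p) \<mu> k) \<subseteq> cfun.span ?E"
    proof
      fix f assume "f \<in> (\<Union>k. root_space (fser p) \<mu> k)"
      then obtain k where "f \<in> root_space (fser p) \<mu> k" by blast
      then obtain c where c: "c \<in> root_seq p \<mu> k" "f = fser c"
        by (meson root_space_imp_root_seq omega_bounded_p)
      obtain a where c_eq: "c = (\<lambda>m. \<Sum>j\<in>?J. a j * \<psi> j m)" by (rule root_seq_span[OF c(1)]) blast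
      have "f x = (\<Sum>j\<in>?J. a j * fser (\<psi> j) x)" for x
        unfolding c(2) c_eq by (rule fser_sum) (rule omega_bounded_\<psi>)
      then have "f = (\<Sum>j\<in>?J. cfun_scale (a j) (fser (\<psi> j)))"
        by (simp add: fun_eq_iff sum_fun_apply cfun_scale_def)
      also have "\<dots> \<in> cfun.span ?E"
        by (intro cfun.span_sum cfun.span_scale cfun.span_base) auto
      finally show "f \<in> cfun.span ?E" .
    qed
    show "cfun.independent ?E"
    proof (rule cfun.independent_if_scalars_zero)
      show "finite ?E" using finite_\<nu> by simp
      fix b v assume b: "(\<Sum>v\<in>?E. cfun_scale (b v) v) = 0" and "v \<in> ?E"
      then obtain j where j: "j \<in> ?J" "v = fser (\<psi> j)" by blast
      define a where "a j = b (fser (\<psi> j))" for j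
      have "(\<Sum>j\<in>?J. cfun_scale (a j) (fser (\<psi> j))) = 0"
        using b by (simp add: sum.reindex[OF inj] a_def)
      then have "(\<Sum>j\<in>?J. a j * fser (\<psi> j) x) = 0" for x
        by (drule_tac fun_cong[of _ _ x]) (simp add: sum_fun_apply cfun_scale_def)
      from \<psi>_independent[OF finite_\<nu> coeff[OF this] j(1)] show "b v = 0"
        by (simp add: a_def j(2))
    qed
  qed
  then show ?thesis using card_image[OF inj] by (simp add: alg_multiplicity_def)
qed

end

section \<open>Listing the eigenvalues in lexicographic order\<close>

text \<open>Insertion sort for a total preorder. It is applied to indices compared through their
  eigenvalues, where distinct indices can tie, so antisymmetry fails.\<close>

lemma exists_sorted_list:
  assumes total: "\<And>x y. P x y \<or> P y x" and trans: "\<And>x y z. P x y \<Longrightarrow> P y z \<Longrightarrow> P x z"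
  shows "\<exists>ys. sorted_wrt P ys \<and> mset ys = mset xs"
proof (induction xs)
  case (Cons x xs)
  have "\<exists>zs. sorted_wrt P zs \<and> mset zs = add_mset x (mset ys)" if "sorted_wrt P ys" for ys
    using that
  proof (induction ys)
    case (Cons y ys)
    show ?case
    proof (cases "P x y")
      case True
      then have "sorted_wrt P (x # y # ys)" using Cons.prems trans by auto
      then show ?thesis by (intro exI[of _ "x # y # ys"]) simp
    next
      case False
      then have "P y x" using total by blast
      obtain zs where zs: "sorted_wrt P zs" "mset zs = add_mset x (mset ys)" using Cons by auto
      have "set zs = insert x (set ys)" using arg_cong[OF zs(2), of set_mset] by simp
      then have "sorted_wrt P (y # zs)" using zs(1) Cons.prems \<open>P y x\<close> by auto
      then show ?thesis using zs(2) by (intro exI[of _ "y # zs"]) simp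
    qed
  qed (auto intro!: exI[of _ "[x]"])
  then show ?case using Cons by fastforce
qed simp

lemma lex_le_total: "lex_le x y \<or> lex_le y x"
  by (auto simp: lex_le_def)

lemma lex_le_trans: "lex_le x y \<Longrightarrow> lex_le y z \<Longrightarrow> lex_le x z"
  by (auto simp: lex_le_def)

text \<open>The positions 2 n - 1 and 2 n, which \<open>gap_length\<close> compares, receive the
  indices -n and n.\<close>

lemma high_positions_bij:
  "bij_betw (\<lambda>k. if odd k then - int ((k + 1) div 2) else int ((k + 1) div 2)) {2 * M + 1..} {j. int M < \<bar>j\<bar>}"
proof (rule bij_betwI[where g="\<lambda>j. if j < 0 then nat (- 2 * j - 1) else nat (2 * j)"])
  show "(\<lambda>k. if odd k then - int ((k + 1) div 2) else int ((k + 1) div 2)) \<in> {2 * M + 1..} \<rightarrow> {j. int M < \<bar>j\<bar>}"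
    by (auto; presburger)
  show "(\<lambda>j. if j < 0 then nat (- 2 * j - 1) else nat (2 * j)) \<in> {j. int M < \<bar>j\<bar>} \<rightarrow> {2 * M + 1..}"
    by auto
  fix k :: nat assume k: "k \<in> {2 * M + 1..}"
  show "(if (if odd k then - int ((k + 1) div 2) else int ((k + 1) div 2)) < 0
     then nat (- 2 * (if odd k then - int ((k + 1) div 2) else int ((k + 1) div 2)) - 1)
     else nat (2 * (if odd k then - int ((k + 1) div 2) else int ((k + 1) div 2)))) = k"
    using k by (cases "odd k") (auto elim!: oddE evenE)
next
  fix j :: int assume j: "j \<in> {j. int M < \<bar>j\<bar>}"
  show "(if odd (if j < 0 then nat (- 2 * j - 1) else nat (2 * j))
     then - int (((if j < 0 then nat (- 2 * j - 1) else nat (2 * j)) + 1) div 2)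
     else int (((if j < 0 then nat (- 2 * j - 1) else nat (2 * j)) + 1) div 2)) = j"
  proof (cases "j < 0")
    case True
    define i where "i = nat (- j)"
    have "j = - int i" "0 < i" using True by (auto simp: i_def)
    moreover from this have "nat (- 2 * j - 1) = 2 * (i - 1) + 1" by auto
    ultimately show ?thesis by auto
  next
    case False
    define i where "i = nat j"
    have "j = int i" using False by (simp add: i_def)
    then show ?thesis by (simp add: nat_mult_distrib)
  qed
qed

text \<open>Finitely many eigenvalues are sorted. Beyond M the asymptotics separate the real parts
  of consecutive pairs, so the enumeration by pairs is already in order.\<close>

lemma eigenvalue_listing:
  fixes \<nu> :: "int \<Rightarrow> complex"
  assumes N: "0 \<le> N" and double: "\<And>j. N < \<bar>j\<bar> \<Longrightarrow> \<nu> j = \<nu> (- j)"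
    and asymp: "\<And>j. N < \<bar>j\<bar> \<Longrightarrow> cmod (\<nu> j - of_real ((pi * of_int j)\<^sup>2)) \<le> S"
    and fin: "\<And>\<mu>. finite {j. \<nu> j = \<mu>}"
  obtains l M where "\<And>k. lex_le (l k) (l (Suc k))"
    "\<And>\<mu>. finite {k. l k = \<mu>} \<and> card {k. l k = \<mu>} = card {j. \<nu> j = \<mu>}"
    "\<And>n. M < n \<Longrightarrow> l (2 * n) = l (2 * n - 1)"
proof -
  define K where "K = (\<Sum>i\<in>{-N..N}. cmod (\<nu> i))"
  have K: "Re (\<nu> i) \<le> K" if "\<bar>i\<bar> \<le> N" for i
  proof -
    have "cmod (\<nu> i) \<le> K"
      unfolding K_def using that by (intro member_le_sum) auto
    then show ?thesis using complex_Re_le_cmod[of "\<nu> i"] by linarith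
  qed
  have K0: "0 \<le> K" by (simp add: K_def sum_nonneg)
  have S0: "0 \<le> S" using asymp[of "N + 1"] N order_trans[OF norm_ge_zero] by force
  \<comment> \<open>The bound \<open>K + S \<le> M\<close> serves twice: beyond M, consecutive
    values of \<open>pi^2 j^2\<close> differ by more than the total error 2 S, and the value at M +
    1 exceeds all earlier ones, including the block eigenvalues bounded by K.\<close>
  define M where "M = nat (max N \<lceil>K + S\<rceil>)"
  have M: "N \<le> int M" "K + S \<le> real M"
    unfolding M_def using N by (simp, linarith)
  have pi1: "1 \<le> pi\<^sup>2" using pi_ge_two by (intro one_le_power) simp
  have Re_lower: "pi\<^sup>2 * (of_int j)\<^sup>2 - S \<le> Re (\<nu> j)" and Re_upper: "Re (\<nu> j) \<le> pi\<^sup>2 * (of_int j)\<^sup>2 + S"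
    if "N < \<bar>j\<bar>" for j
    using asymp[OF that] abs_Re_le_cmod[of "\<nu> j - of_real ((pi * of_int j)\<^sup>2)"]
    by (auto simp: power_mult_distrib)
  have sq_step: "pi\<^sup>2 * t\<^sup>2 + 2 * t + 1 \<le> pi\<^sup>2 * (t + 1)\<^sup>2" if "0 \<le> t" for t :: real
  proof -
    have "1 * (2 * t + 1) \<le> pi\<^sup>2 * (2 * t + 1)" using that pi1 by (intro mult_right_mono) auto
    then show ?thesis by (simp add: power2_eq_square algebra_simps)
  qed
  have sq_mono: "pi\<^sup>2 * s\<^sup>2 \<le> pi\<^sup>2 * t\<^sup>2" if "0 \<le> s" "s \<le> t" for s t :: real
    using that by (intro mult_left_mono power_mono) auto
  have Re_mono: "Re (\<nu> j) < Re (\<nu> (j + 1))" if "int M < j" for j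
  proof -
    have "real M < of_int j" using that by linarith
    then show ?thesis
      using Re_upper[of j] Re_lower[of "j + 1"] sq_step[of "of_int j"] that M K0 S0 N by simp
  qed
  have Re_jump: "Re (\<nu> i) < Re (\<nu> (int M + 1))" if "\<bar>i\<bar> \<le> int M" for i
  proof -
    have up: "pi\<^sup>2 * (real M)\<^sup>2 + 2 * real M + 1 - S \<le> Re (\<nu> (int M + 1))"
      using Re_lower[of "int M + 1"] sq_step[of "real M"] M(1) N by (simp add: add.commute)
    have "Re (\<nu> i) \<le> pi\<^sup>2 * (real M)\<^sup>2 + (K + S)"
    proof (cases "\<bar>i\<bar> \<le> N")
      case True
      have "0 \<le> pi\<^sup>2 * (real M)\<^sup>2" by simp
      then show ?thesis using K[OF True] S0 by linarith
    next
      case False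
      have "pi\<^sup>2 * \<bar>of_int i\<bar>\<^sup>2 \<le> pi\<^sup>2 * (real M)\<^sup>2"
        using that by (intro sq_mono) linarith+
      then show ?thesis
        using Re_upper[of i] False K0 unfolding power2_abs by linarith
    qed
    then show ?thesis using up M(2) S0 K0 by linarith
  qed
  obtain idx where idx: "sorted_wrt (\<lambda>i j. lex_le (\<nu> i) (\<nu> j)) idx" "mset idx = mset [- int M..int M]"
    using exists_sorted_list[of "\<lambda>i j. lex_le (\<nu> i) (\<nu> j)" "[- int M..int M]"] lex_le_total lex_le_trans
    by blast
  have set_idx: "set idx = {- int M..int M}" using arg_cong[OF idx(2), of set_mset] by simp
  have dist: "distinct idx" using mset_eq_imp_distinct_iff[OF idx(2)] by simp
  have len: "length idx = 2 * M + 1" using arg_cong[OF idx(2), of size] by simp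
  define b where "b k = (if odd k then - int ((k + 1) div 2) else int ((k + 1) div 2))" for k :: nat
  define \<sigma> where "\<sigma> k = (if k < 2 * M + 1 then idx ! k else b k)" for k
  have "bij_betw \<sigma> ({..<2 * M + 1} \<union> {2 * M + 1..}) ({- int M..int M} \<union> {j. int M < \<bar>j\<bar>})"
  proof (rule bij_betw_combine)
    have "bij_betw (\<lambda>k. idx ! k) {..<2 * M + 1} {- int M..int M}"
      by (rule bij_betw_nth) (auto simp: dist len set_idx)
    then show "bij_betw \<sigma> {..<2 * M + 1} {- int M..int M}"
      by (rule bij_betw_cong[THEN iffD1, rotated]) (auto simp: \<sigma>_def)
    show "bij_betw \<sigma> {2 * M + 1..} {j. int M < \<bar>j\<bar>}"
      using high_positions_bij[of M]
      by (rule bij_betw_cong[THEN iffD1, rotated]) (auto simp: \<sigma>_def b_def)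
  qed auto
  moreover have "{..<2 * M + 1} \<union> {2 * M + 1..} = (UNIV :: nat set)" by auto
  moreover have "{- int M..int M} \<union> {j. int M < \<bar>j\<bar>} = UNIV" by auto
  ultimately have bij: "bij \<sigma>" by simp
  define l where "l k = \<nu> (\<sigma> k)" for k
  have l_high: "l k = \<nu> (int ((k + 1) div 2))" if "2 * M + 1 \<le> k" for k
  proof -
    define h where "h = int ((k + 1) div 2)"
    have "N < \<bar>h\<bar>" using that M(1) by (auto simp: h_def)
    then have "\<nu> h = \<nu> (- h)" by (rule double)
    moreover have "\<sigma> k = h \<or> \<sigma> k = - h" using that by (auto simp: \<sigma>_def b_def h_def)
    ultimately show ?thesis unfolding l_def h_def[symmetric] by metis
  qed
  show ?thesis
  proof (rule that[of l M])
    fix k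
    show "lex_le (l k) (l (Suc k))"
    proof -
      consider "Suc k < 2 * M + 1" | "k = 2 * M" | "2 * M + 1 \<le> k" by linarith
      then show ?thesis
      proof cases
        case 1
        then show ?thesis using sorted_wrt_nth_less[OF idx(1), of k "Suc k"] len by (simp add: l_def \<sigma>_def)
      next
        case 2
        have "idx ! k \<in> {- int M..int M}" using nth_mem[of k "idx"] len 2 set_idx by simp
        then have "Re (\<nu> (idx ! k)) < Re (\<nu> (int M + 1))" by (intro Re_jump) auto
        moreover have "l (Suc k) = \<nu> (int M + 1)" using l_high[of "Suc k"] 2 by (simp add: add.commute)
        moreover have "l k = \<nu> (idx ! k)" using 2 by (simp add: l_def \<sigma>_def)
        ultimately show ?thesis by (simp add: lex_le_def)
      next
        case 3
        \<comment> \<open>An odd k opens a pair, so k and k + 1 carry the same value; an even k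
          closes one, and the next pair has a larger real part.\<close>
        show ?thesis
        proof (cases "odd k")
          case True
          then have "(Suc k + 1) div 2 = (k + 1) div 2" by (auto elim!: oddE)
          then show ?thesis using l_high[of k] l_high[of "Suc k"] 3 by (simp add: lex_le_def)
        next
          case False
          define h where "h = int ((k + 1) div 2)"
          have "int ((Suc k + 1) div 2) = h + 1" using False by (auto elim!: evenE simp: h_def)
          then have "l (Suc k) = \<nu> (h + 1)" using l_high[of "Suc k"] 3 by (simp only: le_SucI)
          moreover have "l k = \<nu> h" unfolding h_def by (rule l_high[OF 3])
          moreover have "int M < h" using 3 by (auto simp: h_def)
          ultimately show ?thesis using Re_mono[of h] by (simp add: lex_le_def)
        qed
      qed
    qed
  next
    fix \<mu>
    have "bij_betw \<sigma> {k. l k = \<mu>} {j. \<nu> j = \<mu>}"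
      using bij bij_is_surj[OF bij] unfolding bij_betw_def l_def
      by (auto intro: inj_on_subset)
    then show "finite {k. l k = \<mu>} \<and> card {k. l k = \<mu>} = card {j. \<nu> j = \<mu>}"
      using bij_betw_finite bij_betw_same_card fin by blast
  next
    fix n :: nat assume "M < n"
    then have "l (2 * n) = \<nu> (int ((2 * n + 1) div 2))" "l (2 * n - 1) = \<nu> (int ((2 * n - 1 + 1) div 2))"
      by (intro l_high; simp)+
    then show "l (2 * n) = l (2 * n - 1)" using \<open>M < n\<close> by simp
  qed
qed


section \<open>Approximation in the weighted norm\<close>

text \<open>On the unit interval, square integrability gives integrability through
  \<open>|q| \<le> 1 + |q|^2\<close>.\<close>

lemma set_integrable_mult_cis:
  assumes "q \<in> L2_per 1"
  shows "set_integrable lebesgue {0..1} (\<lambda>x. q x * cis (- (2 * of_int n * pi * x)))"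
proof (rule set_integrable_bound)
  have "set_integrable lebesgue {0..1::real} (\<lambda>x. (cmod (q x))\<^sup>2)"
    using assms by (simp add: L2_per_def)
  moreover have "set_integrable lebesgue {0..1::real} (\<lambda>x. 1 :: real)"
    by (rule absolutely_integrable_continuous_real) simp
  ultimately show "set_integrable lebesgue {0..1} (\<lambda>x. 1 + (cmod (q x))\<^sup>2)"
    by (intro set_integral_add(1))
  have "continuous_on UNIV (\<lambda>x. cis (- (2 * of_int n * pi * x)))"
    by (intro continuous_intros)
  from continuous_borel_measurable_lebesgue[OF this]
  show "set_borel_measurable lebesgue {0..1} (\<lambda>x. q x * cis (- (2 * of_int n * pi * x)))"
    unfolding set_borel_measurable_def using assms
    by (intro borel_measurable_scaleR borel_measurable_indicator borel_measurable_times)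
      (auto simp: L2_per_def)
  show "AE x in lebesgue. x \<in> {0..1} \<longrightarrow> norm (q x * cis (- (2 * of_int n * pi * x))) \<le> norm (1 + (cmod (q x))\<^sup>2)"
  proof (intro always_eventually allI impI)
    fix x
    have "0 \<le> (cmod (q x) - 1 / 2)\<^sup>2" by simp
    then have "cmod (q x) \<le> 1 + (cmod (q x))\<^sup>2"
      by (simp add: power2_eq_square algebra_simps)
    then show "norm (q x * cis (- (2 * of_int n * pi * x))) \<le> norm (1 + (cmod (q x))\<^sup>2)"
      by (simp add: norm_mult)
  qed
qed

lemma fourier_coeff_diff:
  assumes "q \<in> L2_per 1" "p \<in> L2_per 1"
  shows "fourier_coeff (\<lambda>x. q x - p x) n = fourier_coeff q n - fourier_coeff p n"
  unfolding fourier_coeff_def left_diff_distrib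
  by (rule set_integral_diff(2)) (intro set_integrable_mult_cis assms)+

text \<open>Index 0 is excluded because w 0 may exceed 1, the value of the right side there.\<close>

lemma submultiplicative_bound:
  assumes "normalized_weight w" "submultiplicative w" "n \<noteq> 0"
  shows "w n \<le> w 1 ^ nat \<bar>n\<bar>"
proof -
  have w1: "1 \<le> w 1" and sym: "w (- k) = w k" for k
    using assms(1) by (auto simp: normalized_weight_def)
  have pos: "w (int (Suc k)) \<le> w 1 ^ Suc k" for k
  proof (induction k)
    case (Suc k)
    have "w (int (Suc k) + 1) \<le> w (int (Suc k)) * w 1"
      using assms(2) unfolding submultiplicative_def by blast
    also have "\<dots> \<le> w 1 ^ Suc k * w 1" using Suc w1 by (intro mult_right_mono) auto
    finally show ?case by (simp add: mult.commute add.commute)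
  qed simp
  obtain k where "nat \<bar>n\<bar> = Suc k" using assms(3) by (cases "nat \<bar>n\<bar>") auto
  then have "n = int (Suc k) \<or> n = - int (Suc k)" by linarith
  then show ?thesis using pos[of k] sym[of "int (Suc k)"] \<open>nat \<bar>n\<bar> = Suc k\<close> by auto
qed

lemma summable_tail_small:
  fixes f :: "int \<Rightarrow> real"
  assumes f: "f summable_on UNIV" and nonneg: "\<And>n. 0 \<le> f n" and "0 < \<epsilon>"
  obtains M where "0 \<le> M" "(\<Sum>\<^sub>\<infinity>n. if \<bar>n\<bar> \<le> M then 0 else f n) \<le> \<epsilon>"
    "(\<lambda>n. if \<bar>n\<bar> \<le> M then 0 else f n) summable_on UNIV"
proof -
  obtain F where F: "finite F" "dist (sum f F) (infsum f UNIV) \<le> \<epsilon>"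
    using infsum_finite_approximation[OF f \<open>0 < \<epsilon>\<close>] by blast
  \<comment> \<open>A crude radius: each element of F is at most the sum of all moduli.\<close>
  define M where "M = (\<Sum>n\<in>F. \<bar>n\<bar>)"
  have FM: "F \<subseteq> {-M..M}"
    using F(1) member_le_sum[of _ F abs] by (force simp: M_def abs_le_iff)
  have s: "(\<lambda>n. if \<bar>n\<bar> \<le> M then 0 else f n) summable_on UNIV"
    by (rule summable_on_comparison_test[OF f]) (auto simp: nonneg)
  have s': "((\<lambda>n. if \<bar>n\<bar> \<le> M then f n else 0) has_sum sum f {-M..M}) UNIV"
    by (rule has_sum_finite_neutralI[of "{-M..M}" UNIV]) (auto intro!: sum.cong)
  have "infsum f UNIV = (\<Sum>\<^sub>\<infinity>n. (if \<bar>n\<bar> \<le> M then f n else 0) + (if \<bar>n\<bar> \<le> M then 0 else f n))"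
    by (rule infsum_cong) auto
  also have "\<dots> = sum f {-M..M} + (\<Sum>\<^sub>\<infinity>n. if \<bar>n\<bar> \<le> M then 0 else f n)"
    by (subst infsum_add[OF has_sum_imp_summable[OF s'] s]) (simp add: infsumI[OF s'])
  finally have "(\<Sum>\<^sub>\<infinity>n. if \<bar>n\<bar> \<le> M then 0 else f n) = infsum f UNIV - sum f {-M..M}" by simp
  also have "\<dots> \<le> infsum f UNIV - sum f F"
    using sum_mono2[OF _ FM, of f] nonneg by simp
  also have "\<dots> \<le> \<epsilon>" using F(2) by (simp add: dist_real_def)
  finally show ?thesis using that[of M] s by (simp add: M_def sum_nonneg)
qed

theorem theorem2:
  fixes w :: "int \<Rightarrow> real"
  assumes "normalized_weight w" and "submultiplicative w"
  shows "\<forall>q\<in>weighted_space w. \<forall>\<epsilon>>0. \<exists>p\<in>(\<Union>N. gap_potentials w N). wnorm w (\<lambda>x. q x - p x) < \<epsilon>"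
proof (intro ballI allI impI)
  fix q \<epsilon> assume q: "q \<in> weighted_space w" and \<epsilon>: "0 < (\<epsilon> :: real)"
  have w1: "1 \<le> w n" for n using assms(1) by (simp add: normalized_weight_def)
  \<comment> \<open>With base w 1 the exponential kernel dominates the growth of w by
    submultiplicativity.\<close>
  interpret decay "w 1" by unfold_locales (rule w1)
  define a where "a n = (w n)\<^sup>2 * (cmod (fourier_coeff q n))\<^sup>2" for n
  have q2: "q \<in> L2_per 1" and a: "a summable_on UNIV"
    using q unfolding weighted_space_def a_def[abs_def] by auto
  have a0: "0 \<le> a n" for n by (simp add: a_def)
  \<comment> \<open>Squaring a sum costs a factor 2, so the tail of q will contribute at most
    \<open>\<epsilon>^2 / 4\<close>.\<close>
  obtain M where M: "0 \<le> M" "(\<Sum>\<^sub>\<infinity>n. if \<bar>n\<bar> \<le> M then 0 else a n) \<le> \<epsilon>\<^sup>2 / 8"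
    and tail: "(\<lambda>n. if \<bar>n\<bar> \<le> M then 0 else a n) summable_on UNIV"
    using summable_tail_small[OF a a0, of "\<epsilon>\<^sup>2 / 8"] \<epsilon> by auto
  define \<tau> where "\<tau> k = (if even k \<and> \<bar>k\<bar> \<le> 2 * M then fourier_coeff q (k div 2) else 0)" for k
  \<comment> \<open>Finite support makes every decay rate available, at the price of a possibly huge
    R, for which \<sigma> and N compensate.\<close>
  define R where "R = (\<Sum>k\<in>{-2*M..2*M}. cmod (\<tau> k) / kappa k)"
  have \<tau>: "cmod (\<tau> k) \<le> R * kappa k" for k
  proof (cases "k \<in> {-2*M..2*M}")
    case True
    then have "cmod (\<tau> k) / kappa k \<le> R" unfolding R_def by (intro member_le_sum) auto
    then show ?thesis using kappa_pos[of k] by (simp add: pos_divide_le_eq)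
  next
    case False
    then have "\<tau> k = 0" by (auto simp: \<tau>_def abs_le_iff)
    moreover have "0 \<le> R" unfolding R_def by (intro sum_nonneg) simp
    ultimately show ?thesis by simp
  qed
  \<comment> \<open>The correction will contribute \<open>\<rho>^2 omegaC / 2\<close> to the squared
    norm, at most \<open>\<epsilon>^2 / 2\<close> if \<open>\<rho> omegaC \<le> \<epsilon>\<close>;
    the bound 1 is required by the contraction.\<close>
  define \<rho> where "\<rho> = min 1 (\<epsilon> / omegaC)"
  have \<rho>: "0 < \<rho>" "\<rho> \<le> 1" "\<rho> * omegaC \<le> \<epsilon>"
    using \<epsilon> omegaC_ge by (auto simp: \<rho>_def min_def field_simps)
  obtain N p X B S where N: "M \<le> N" "0 < N" and p_odd: "\<And>k. odd k \<Longrightarrow> p k = 0"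
    and p_low: "\<And>k. \<bar>k\<bar> \<le> 2 * N \<Longrightarrow> p k = \<tau> k"
    and p_high: "\<And>k. even k \<Longrightarrow> 2 * N < \<bar>k\<bar> \<Longrightarrow> cmod (p k) \<le> \<rho> * kappa k"
    and dec: "decays S (toeplitz p)" "decays (1 / 2) X" "decays S B"
    and XB: "\<And>m. X m m = 0" "\<And>m. X (- m) m = 0" "\<And>m n. \<not> diag_pos N m n \<Longrightarrow> B m n = 0"
    and eq: "\<And>m n. of_real ((pi * of_int m)\<^sup>2) * X m n + (toeplitz p m n + matmat (toeplitz p) X m n)
       = of_real ((pi * of_int n)\<^sup>2) * X m n + (B m n + matmat X B m n)"
  proof (rule block_diagonalization[OF \<tau> _ \<rho>(1,2), of M])
    fix N p X B S
    assume bd: "M \<le> N" "0 < N" "\<And>k. odd k \<Longrightarrow> p k = 0"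
      "\<And>k. \<bar>k\<bar> \<le> 2 * N \<Longrightarrow> p k = \<tau> k"
      "\<And>k. even k \<Longrightarrow> 2 * N < \<bar>k\<bar> \<Longrightarrow> cmod (p k) \<le> \<rho> * kappa k"
      "decays S (toeplitz p)" "decays (1 / 2) X" "decays S B"
      "\<And>m. X m m = 0" "\<And>m. X (- m) m = 0" "\<And>m n. \<not> diag_pos N m n \<Longrightarrow> B m n = 0"
      "\<And>m n. of_real ((pi * of_int m)\<^sup>2) * X m n + (toeplitz p m n + matmat (toeplitz p) X m n)
       = of_real ((pi * of_int n)\<^sup>2) * X m n + (B m n + matmat X B m n)"
    show thesis by (rule that) (fact bd)+
  qed (simp add: \<tau>_def)
  interpret diagonalized "w 1" N p X B S
    by unfold_locales (use N dec XB eq in auto)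
  obtain Q Q' \<nu> e where "jordan_diagonalized (w 1) N p X B S Q Q' \<nu> e"
  proof (rule low_jordan)
    fix Q Q' \<nu> e
    assume jd:
      "\<And>i j. \<bar>i\<bar> \<le> N \<Longrightarrow> \<bar>j\<bar> \<le> N \<Longrightarrow> (\<Sum>k\<in>{-N..N}. Q i k * Q' k j) = (if i = j then 1 else 0)"
      "\<And>i j. \<bar>i\<bar> \<le> N \<Longrightarrow> \<bar>j\<bar> \<le> N \<Longrightarrow> (\<Sum>k\<in>{-N..N}. Q' i k * Q k j) = (if i = j then 1 else 0)"
      "\<And>i j. \<bar>i\<bar> \<le> N \<Longrightarrow> \<bar>j\<bar> \<le> N \<Longrightarrow>
         (\<Sum>k\<in>{-N..N}. ((if i = k then of_real ((pi * of_int i)\<^sup>2) else 0) + B i k) * Q k j)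
         = \<nu> j * Q i j + e j * Q i (j - 1)"
      "\<And>j. \<bar>j\<bar> \<le> N \<Longrightarrow> e j \<noteq> 0 \<Longrightarrow> - N < j \<and> \<nu> (j - 1) = \<nu> j"
      "\<And>j. N < \<bar>j\<bar> \<Longrightarrow> \<nu> j = of_real ((pi * of_int j)\<^sup>2) + B j j"
      "\<And>j. N < \<bar>j\<bar> \<Longrightarrow> e j = 0"
    have "jordan_diagonalized (w 1) N p X B S Q Q' \<nu> e"
      by unfold_locales (fact jd)+
    then show thesis by (rule that)
  qed
  then interpret jordan_diagonalized "w 1" N p X B S Q Q' \<nu> e .
  \<comment> \<open>The threshold L of the gaps comes from the ordering and may exceed N, since
    eigenvalues of the finite block can lie among those of larger index.\<close>
  obtain l L where l: "\<And>k. lex_le (l k) (l (Suc k))"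
    "\<And>\<mu>. finite {k. l k = \<mu>} \<and> card {k. l k = \<mu>} = card {j. \<nu> j = \<mu>}"
    "\<And>n. L < n \<Longrightarrow> l (2 * n) = l (2 * n - 1)"
    using eigenvalue_listing[OF less_imp_le[OF N_pos] \<nu>_double \<nu>_asymp finite_\<nu>] by blast
  have list: "lists_periodic_eigenvalues (fser p) l"
    using l(1,2) by (simp add: lists_periodic_eigenvalues_def alg_multiplicity_fser)
  have p_coeff: "fourier_coeff (fser p) n = p (2 * n)" for n
    by (rule fourier_coeff_fser[OF omega_bounded_p p_odd])
  have p2: "fser p \<in> L2_per 1" by (rule fser_L2_per[OF omega_bounded_p p_odd])
  \<comment> \<open>The coefficient n has index 2 n for period 2, so \<open>kappa\<close> offers the
    power \<open>2 |n|\<close> of w 1, more than the power \<open>|n|\<close> that the weight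
    costs.\<close>
  have w_kappa: "w n * kappa (2 * n) \<le> omega n" if "n \<noteq> 0" for n
  proof -
    have "w n \<le> w 1 ^ nat \<bar>2 * n\<bar>"
      using submultiplicative_bound[OF assms that] power_increasing[of "nat \<bar>n\<bar>" "nat \<bar>2 * n\<bar>" "w 1"] w1[of 1]
      by (simp add: nat_mono)
    also have "\<dots> \<le> omegaC * w 1 ^ nat \<bar>2 * n\<bar>"
      using omegaC_ge r_pow_ge_1[of "nat \<bar>2 * n\<bar>"] by (simp add: mult_le_cancel_right1)
    finally have le: "w n \<le> omegaC * w 1 ^ nat \<bar>2 * n\<bar>" .
    define D where "D = omegaC * w 1 ^ nat \<bar>2 * n\<bar>"
    have D: "0 < D" "w n \<le> D" using omegaC_ge r_pos le by (auto simp: D_def)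
    have "w n * (omega (2 * n) / D) = omega (2 * n) * w n / D" by simp
    also have "\<dots> \<le> omega (2 * n)"
      using D(1) mult_left_mono[OF D(2) omega_nonneg[of "2 * n"]] by (simp add: pos_divide_le_eq)
    also have "\<dots> \<le> omega n"
      unfolding omega_def by (intro divide_left_mono mult_pos_pos) (auto intro: add_pos_nonneg simp: power_mult_distrib)
    finally show ?thesis by (simp add: kappa_def D_def)
  qed
  have p_eq: "p (2 * n) = fourier_coeff q n" if "\<bar>n\<bar> \<le> M" for n
    using that p_low[of "2 * n"] N by (simp add: \<tau>_def abs_mult)
  have p_le: "w n * cmod (p (2 * n)) \<le> \<rho> * omega n" if "M < \<bar>n\<bar>" for n
  proof (cases "\<bar>n\<bar> \<le> N")
    case True
    then have "p (2 * n) = 0" using that p_low[of "2 * n"] by (simp add: \<tau>_def abs_mult)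
    then show ?thesis using \<rho>(1) by simp
  next
    case False
    have "w n * cmod (p (2 * n)) \<le> w n * (\<rho> * kappa (2 * n))"
      using False p_high[of "2 * n"] w1[of n] by (intro mult_left_mono) (auto simp: abs_mult)
    also have "\<dots> \<le> \<rho> * omega n"
      using mult_left_mono[OF w_kappa[of n], of \<rho>] \<rho>(1) that M(1) by (simp add: mult_ac)
    finally show ?thesis .
  qed
  have sq_sum: "(x + y)\<^sup>2 \<le> 2 * x\<^sup>2 + 2 * y\<^sup>2" for x y :: real
    using zero_le_power2[of "x - y"] by (simp add: power2_eq_square algebra_simps)
  have omega_sq: "(\<rho> * omega n)\<^sup>2 \<le> \<rho>\<^sup>2 * omega n" for n
  proof -
    have "omega n * omega n \<le> omega n" using mult_left_mono[OF omega_le_1[of n] omega_nonneg[of n]] by simp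
    then have "\<rho>\<^sup>2 * (omega n * omega n) \<le> \<rho>\<^sup>2 * omega n" by (rule mult_left_mono) simp
    moreover have "(\<rho> * omega n)\<^sup>2 = \<rho>\<^sup>2 * (omega n * omega n)" by (simp add: power2_eq_square mult_ac)
    ultimately show ?thesis by simp
  qed
  \<comment> \<open>A crude bound that serves only to place \<open>fser p\<close> in the weighted
    space.\<close>
  have p_sq: "(w n)\<^sup>2 * (cmod (p (2 * n)))\<^sup>2 \<le> a n + \<rho>\<^sup>2 * omega n" for n
  proof (cases "\<bar>n\<bar> \<le> M")
    case True
    then show ?thesis by (simp add: p_eq a_def)
  next
    case False
    have "(w n * cmod (p (2 * n)))\<^sup>2 \<le> (\<rho> * omega n)\<^sup>2"
      using p_le[of n] False w1[of n] by (intro power_mono) auto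
    then show ?thesis using omega_sq[of n] a0[of n] by (simp add: power_mult_distrib)
  qed
  have omega_s: "(\<lambda>n. \<rho>\<^sup>2 * omega n) summable_on UNIV"
    by (rule summable_on_cmult_right[OF omega_summable])
  have "(\<lambda>n. (w n)\<^sup>2 * (cmod (fourier_coeff (fser p) n))\<^sup>2) summable_on UNIV"
    unfolding p_coeff
    by (rule summable_on_comparison_test[OF summable_on_add[OF a omega_s]]) (use p_sq in auto)
  then have "fser p \<in> gap_potentials w L"
    using p2 list l(3) by (auto simp: gap_potentials_def weighted_space_def gap_length_def)
  moreover have "wnorm w (\<lambda>x. q x - fser p x) < \<epsilon>"
  proof -
    define d where "d n = (w n)\<^sup>2 * (cmod (fourier_coeff (\<lambda>x. q x - fser p x) n))\<^sup>2" for n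
    have d_le: "d n \<le> 2 * (if \<bar>n\<bar> \<le> M then 0 else a n) + 2 * (\<rho>\<^sup>2 * omega n)" for n
    proof (cases "\<bar>n\<bar> \<le> M")
      case True
      then show ?thesis by (simp add: d_def fourier_coeff_diff[OF q2 p2] p_coeff p_eq)
    next
      case False
      have "w n * cmod (fourier_coeff q n - p (2 * n)) \<le> w n * (cmod (fourier_coeff q n) + cmod (p (2 * n)))"
        using w1[of n] by (intro mult_left_mono norm_triangle_ineq4) simp
      also have "\<dots> \<le> w n * cmod (fourier_coeff q n) + \<rho> * omega n"
        using p_le[of n] False by (simp add: distrib_left)
      finally have "(w n * cmod (fourier_coeff q n - p (2 * n)))\<^sup>2
          \<le> (w n * cmod (fourier_coeff q n) + \<rho> * omega n)\<^sup>2"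
        using w1[of n] by (intro power_mono) auto
      also have "\<dots> \<le> 2 * (w n * cmod (fourier_coeff q n))\<^sup>2 + 2 * (\<rho> * omega n)\<^sup>2" by (rule sq_sum)
      finally show ?thesis
        using False omega_sq[of n] by (simp add: d_def a_def fourier_coeff_diff[OF q2 p2] p_coeff power_mult_distrib)
    qed
    have hs: "((\<lambda>n. 2 * (if \<bar>n\<bar> \<le> M then 0 else a n) + 2 * (\<rho>\<^sup>2 * omega n)) has_sum
        2 * (\<Sum>\<^sub>\<infinity>n. if \<bar>n\<bar> \<le> M then 0 else a n) + 2 * (\<rho>\<^sup>2 * (\<Sum>\<^sub>\<infinity>n. omega n))) UNIV"
      by (intro has_sum_add has_sum_cmult_right has_sum_infsum tail omega_summable)
    have "d summable_on UNIV"
      by (rule summable_on_comparison_test[OF has_sum_imp_summable[OF hs] d_le]) (simp add: d_def)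
    from infsum_mono[OF this has_sum_imp_summable[OF hs] d_le]
    have "infsum d UNIV \<le> 2 * (\<Sum>\<^sub>\<infinity>n. if \<bar>n\<bar> \<le> M then 0 else a n) + 2 * (\<rho>\<^sup>2 * (\<Sum>\<^sub>\<infinity>n. omega n))"
      using infsumI[OF hs] by simp
    also have "\<dots> \<le> \<epsilon>\<^sup>2 / 4 + \<rho>\<^sup>2 * omegaC / 2"
      using M(2) by (simp add: omegaC_def)
    also have "\<dots> < \<epsilon>\<^sup>2"
    proof -
      have "\<rho>\<^sup>2 * omegaC * 1 \<le> \<rho>\<^sup>2 * omegaC * omegaC"
        using omegaC_ge by (intro mult_left_mono) auto
      also have "\<dots> = (\<rho> * omegaC)\<^sup>2" by (simp add: power2_eq_square)
      also have "\<dots> \<le> \<epsilon>\<^sup>2" using \<rho> omegaC_ge by (intro power_mono) auto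
      finally have "\<rho>\<^sup>2 * omegaC \<le> \<epsilon>\<^sup>2" by simp
      moreover have "0 < \<epsilon>\<^sup>2" using \<epsilon> by simp
      ultimately show ?thesis by linarith
    qed
    finally have "sqrt (infsum d UNIV) < \<epsilon>" using \<epsilon> by (intro real_less_lsqrt) auto
    then show ?thesis by (simp add: wnorm_def d_def[abs_def])
  qed
  ultimately show "\<exists>p\<in>(\<Union>N. gap_potentials w N). wnorm w (\<lambda>x. q x - p x) < \<epsilon>" by blast
qed

end
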